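(* Let $(H,W,\mu)$ be an abstract Wiener space and let $\{X_n\}_{n\ge1}$ be a sequence of independent and identically distributed random variables defined on a probability space $(\Omega,\mathcal{F},\mathcal{P})$ and taking values in $(W,\mathcal{B}(W))$. Suppose that the common law of the $X_n$'s is absolutely continuous with respect to $\mu$ with a density of the form $\Gamma(\sqrt\alpha)f$, where $\alpha\in\,]0,1[$ and $f$ is a non-negative element of $\mathcal{L}^p(W,\mu)$ for some $p>1$. If the density of the $X_n$'s is orthogonal to the first and the second Wiener chaoses, i.e. $J_1(\Gamma(\sqrt\alpha)f)=0$ and $J_2(\Gamma(\sqrt\alpha)f)=0$, then the density $\rho_n$ with respect to $\mu$ of (the law of) $$\frac{X_1+\cdots+X_n}{\sqrt n}$$ converges to $1$ in $\mathcal{L}^1(W,\mu)$ as $n\to\infty$, with rate of convergence of order $\frac1{\sqrt n}$, i.e. $\|\rho_n-1\|_1=O(n^{-1/2})$.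
   Context: Abstract Wiener space $(H,W,\mu)$: $(H,\langle\cdot,\cdot\rangle_H)$ is a separable real Hilbert space continuously and densely embedded in the Banach space $(W,\|\cdot\|_W)$, and $\mu$ is a Gaussian probability measure on the Borel sets $\mathcal{B}(W)$ such that $\int_W e^{i\langle w,w^*\rangle}d\mu(w)=e^{-\frac12\|w^*\|_H^2}$ for all $w^*\in W^*$, where $W^*\subset H$ is the dual space of $W$ (dense in $H$) and $\langle\cdot,\cdot\rangle$ is the dual pairing between $W$ and $W^*$. For $p\ge1$, $\mathcal{L}^p(W,\mu)$ is the space of real-valued $f$ with $\|f\|_p=(\int_W|f|^pd\mu)^{1/p}<\infty$. By the Wiener–Itô chaos decomposition every $f\in\mathcal{L}^2(W,\mu)$ has an orthogonal expansion $f=\sum_{n\ge0}\delta^n(\mathfrak{h}_n)$ with $\mathfrak{h}_n\in H^{\hat\otimes n}$ (symmetric elements of $H^{\otimes n}$), where $\delta^n(\mathfrak{h}_n)$ is the multiple Wiener–Itô integral of $\mathfrak{h}_n$; $J_n(f)=\delta^n(\mathfrak{h}_n)$ is the orthogonal projection onto the $n$-th Wiener chaos. For every $p>1$, $J_n$ extends to a continuous linear operator from $\mathcal{L}^p(W,\mu)$ into itself, also denoted $J_n$. For $|\lambda|\le1$, $\Gamma(\lambda)$ is defined on $\mathcal{L}^2(W,\mu)$ by $\Gamma(\lambda)\big(\sum_{n\ge0}\delta^n(\mathfrak{h}_n)\big)=\sum_{n\ge0}\lambda^n\delta^n(\mathfrak{h}_n)$; it extends to a continuous linear operator on $\mathcal{L}^p(W,\mu)$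 for every $p\ge1$ and coincides with the Ornstein–Uhlenbeck operator: for $\lambda\in\,]0,1]$, $(\Gamma(\lambda)f)(w)=\int_Wf(\lambda w+\sqrt{1-\lambda^2}\,\tilde w)\,d\mu(\tilde w)$. Under the stated assumptions the law of $\frac{X_1+\cdots+X_n}{\sqrt n}$ is absolutely continuous with respect to $\mu$ for every $n$, so its density is well defined. *)

theory Defs
  imports "HOL-Probability.Probability" "HOL-Library.Landau_Symbols"
begin

section \<open>Abstract Wiener spaces\<close>

lemma riesz_representation_ex1:
  fixes L :: "'h::{real_inner,banach} \<Rightarrow> real"
  assumes "bounded_linear L"
  shows "\<exists>!k. \<forall>h. L h = inner k h"
proof -
  interpret L: bounded_linear L by fact
  obtain K where K: "\<And>x. norm (L x) \<le> norm x * K" using L.bounded by blast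
  define J where "J x = (norm x)\<^sup>2 - 2 * L x" for x
  have bdd: "- K\<^sup>2 \<le> J x" for x
  proof -
    have "L x \<le> norm x * K" using K[of x] by simp
    moreover have "0 \<le> (norm x - K)\<^sup>2" by simp
    ultimately show ?thesis unfolding J_def power2_diff by linarith
  qed
  define m where "m = (INF x. J x)"
  have bb: "bdd_below (range J)" using bdd by (auto intro!: bdd_belowI)
  have m_le: "m \<le> J x" for x unfolding m_def by (intro cINF_lower bb) simp
  have "\<exists>x. J x < m + 1 / real (Suc n)" for n
    using cInf_lessD[of "range J" "m + 1 / real (Suc n)"] unfolding m_def by auto
  then obtain x where x: "\<And>n. J (x n) < m + 1 / real (Suc n)" by metis
  have par: "(norm (a - b))\<^sup>2 = 2 * J a + 2 * J b - 4 * J ((1/2) *\<^sub>R (a + b))" for a b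
    unfolding J_def
    by (simp add: power2_norm_eq_inner L.scaleR L.add algebra_simps inner_add_left inner_add_right
        inner_diff_left inner_diff_right inner_commute)
  have close: "(norm (x i - x j))\<^sup>2 \<le> 2 / real (Suc i) + 2 / real (Suc j)" for i j
    using par[of "x i" "x j"] x[of i] x[of j] m_le[of "(1/2) *\<^sub>R (x i + x j)"] by simp
  have "Cauchy x"
  proof (rule CauchyI)
    fix e :: real assume e: "0 < e"
    obtain N where N: "4 / e\<^sup>2 < real N" using reals_Archimedean2 by blast
    show "\<exists>M. \<forall>m\<ge>M. \<forall>n\<ge>M. norm (x m - x n) < e"
    proof (intro exI allI impI)
      fix i j assume ij: "N \<le> i" "N \<le> j"
      have N0: "0 < real N" using N e by (smt (verit) divide_nonneg_nonneg zero_le_power2)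
      have "2 / real (Suc i) \<le> 2 / real N" "2 / real (Suc j) \<le> 2 / real N"
        using ij N0 by (auto intro!: divide_left_mono)
      hence "(norm (x i - x j))\<^sup>2 \<le> 4 / real N" using close[of i j] by linarith
      also have "\<dots> < e\<^sup>2" using N N0 e by (simp add: field_simps)
      finally show "norm (x i - x j) < e" using e by (simp add: power_less_imp_less_base)
    qed
  qed
  then obtain k where k: "x \<longlonglongrightarrow> k" using Cauchy_convergent convergent_def by blast
  have "(\<lambda>n. J (x n)) \<longlonglongrightarrow> J k"
    unfolding J_def by (intro tendsto_intros k L.tendsto)
  moreover have "(\<lambda>n. m + 1 / real (Suc n)) \<longlonglongrightarrow> m + 0"
    by (intro tendsto_add tendsto_const LIMSEQ_Suc lim_1_over_n)
  ultimately have Jk: "J k \<le> m"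
    using LIMSEQ_le[of "\<lambda>n. J (x n)" "J k" "\<lambda>n. m + 1 / real (Suc n)" "m + 0"] x
    by (auto intro: less_imp_le)
  have "L h = inner k h" for h
  proof (cases "h = 0")
    case False
    define c where "c = inner k h - L h"
    define t where "t = - c / (norm h)\<^sup>2"
    have n0: "(norm h)\<^sup>2 > 0" using False by simp
    have "J (k + t *\<^sub>R h) = J k + 2 * t * c + t\<^sup>2 * (norm h)\<^sup>2"
    proof -
      have "(norm (k + t *\<^sub>R h))\<^sup>2 = (norm k)\<^sup>2 + 2 * t * inner k h + t\<^sup>2 * (norm h)\<^sup>2"
        unfolding power2_norm_eq_inner
        by (simp add: inner_add_left inner_add_right inner_commute power2_eq_square algebra_simps)
      thus ?thesis unfolding J_def c_def by (simp add: L.scaleR L.add algebra_simps)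
    qed
    moreover have "2 * t * c + t\<^sup>2 * (norm h)\<^sup>2 = - c\<^sup>2 / (norm h)\<^sup>2"
      unfolding t_def using n0 by (simp add: field_simps power2_eq_square)
    ultimately have "0 \<le> - c\<^sup>2 / (norm h)\<^sup>2" using m_le[of "k + t *\<^sub>R h"] Jk by linarith
    hence "c = 0" using n0 by (simp add: field_simps)
    thus ?thesis by (simp add: c_def)
  qed simp
  moreover have "k' = k" if "\<forall>h. L h = inner k' h" for k'
    using that \<open>\<And>h. L h = inner k h\<close> by (metis vector_eq_rdot)
  ultimately show ?thesis by blast
qed

text \<open>
  The embedding of the dual of \<open>W\<close> into \<open>H\<close>: a functional on \<open>W\<close>, restricted to \<open>H\<close> along the
  inclusion \<open>\<iota>\<close>, is identified with its Riesz representative.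
\<close>

definition dual_embed ::
    "('h::{real_inner,banach} \<Rightarrow> 'w::banach) \<Rightarrow> ('w \<Rightarrow>\<^sub>L real) \<Rightarrow> 'h" where
  "dual_embed \<iota> \<phi> = (THE k. \<forall>h. blinfun_apply \<phi> (\<iota> h) = inner k h)"

lemma dual_embed:
  assumes "bounded_linear \<iota>"
  shows "blinfun_apply \<phi> (\<iota> h) = inner (dual_embed \<iota> \<phi>) h"
proof -
  have "bounded_linear (\<lambda>h. blinfun_apply \<phi> (\<iota> h))"
    using assms by (rule bounded_linear_compose[OF blinfun.bounded_linear_right])
  from theI'[OF riesz_representation_ex1[OF this]] show ?thesis
    unfolding dual_embed_def by blast
qed

text \<open>
  Gaussianity of \<open>\<mu>\<close> is contained in the formula for its characteristic functional.
  Second countability of \<open>'w\<close> is no restriction: \<open>W\<close> has a dense continuous image of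
  the separable space \<open>H\<close>.
\<close>

locale abstract_wiener_space = prob_space \<mu>
  for \<iota> :: "'h::{real_inner,banach,second_countable_topology} \<Rightarrow>
            'w::{banach,second_countable_topology}"
    and \<mu> :: "'w measure" +
  assumes sets_mu: "sets \<mu> = sets borel"
    and bounded_linear_embedding: "bounded_linear \<iota>"
    and inj_embedding: "inj \<iota>"
    and dense_embedding: "closure (range \<iota>) = UNIV"
    and characteristic_functional:
      "\<And>\<phi>. (\<integral>w. iexp (blinfun_apply \<phi> w) \<partial>\<mu>)
            = complex_of_real (exp (- (norm (dual_embed \<iota> \<phi>))\<^sup>2 / 2))"

section \<open>\<open>L\<^sup>p\<close> spaces of representatives\<close>

definition Lp :: "'a measure \<Rightarrow> real \<Rightarrow> ('a \<Rightarrow> real) set" where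
  "Lp M p = {f \<in> borel_measurable M. integrable M (\<lambda>x. \<bar>f x\<bar> powr p)}"

definition Lp_norm :: "'a measure \<Rightarrow> real \<Rightarrow> ('a \<Rightarrow> real) \<Rightarrow> real" where
  "Lp_norm M p f = (\<integral>x. \<bar>f x\<bar> powr p \<partial>M) powr (1 / p)"

text \<open>
  Membership is part of convergence, since the Bochner integral in \<open>Lp_norm\<close> is \<open>0\<close> for
  non-integrable integrands.
\<close>

definition Lp_converges ::
    "'a measure \<Rightarrow> real \<Rightarrow> (nat \<Rightarrow> 'a \<Rightarrow> real) \<Rightarrow> ('a \<Rightarrow> real) \<Rightarrow> bool" where
  "Lp_converges M p u f \<longleftrightarrow> (\<forall>k. u k \<in> Lp M p) \<and> f \<in> Lp M p \<and>
     (\<lambda>k. Lp_norm M p (\<lambda>x. u k x - f x)) \<longlonglongrightarrow> 0"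

section \<open>Wiener chaos\<close>

text \<open>
  \<open>hermite s n x\<close> is \<open>s\<^bsup>n/2\<^esup> He\<^sub>n (x / s\<^bsup>1/2\<^esup>)\<close> with \<open>He\<^sub>n\<close> the monic (probabilists')
  Hermite polynomial; the homogeneous form also covers \<open>s = 0\<close>.
\<close>

fun hermite :: "real \<Rightarrow> nat \<Rightarrow> real \<Rightarrow> real" where
  "hermite s 0 x = 1"
| "hermite s (Suc 0) x = x"
| "hermite s (Suc (Suc n)) x = x * hermite s (Suc n) x - real (Suc n) * s * hermite s n x"

text \<open>
  The multiple Wiener-Ito integral \<open>\<delta>\<^sup>n(\<phi>\<^sup>\<otimes>\<^sup>n)\<close> of the \<open>n\<close>-th tensor power of
  \<open>\<phi> \<in> W\<^sup>* \<subseteq> H\<close>.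
\<close>

definition wiener_ito_power ::
    "('h::{real_inner,banach} \<Rightarrow> 'w::banach) \<Rightarrow> nat \<Rightarrow> ('w \<Rightarrow>\<^sub>L real) \<Rightarrow> 'w \<Rightarrow> real" where
  "wiener_ito_power \<iota> n \<phi> w = hermite ((norm (dual_embed \<iota> \<phi>))\<^sup>2) n (blinfun_apply \<phi> w)"

text \<open>
  The integral \<open>\<delta>\<^sup>n\<close> on finite linear combinations of tensor powers. These combinations are dense
  in the symmetric tensors of order \<open>n\<close> over \<open>H\<close> (polarization and density of \<open>W\<^sup>*\<close> in \<open>H\<close>), and
  \<open>\<delta>\<^sup>n\<close> is the extension by continuity of this map, which is isometric up to the factor
  \<open>\<surd>(n!)\<close>. Hence the range of \<open>\<delta>\<^sup>n\<close>, the \<open>n\<close>-th chaos, is the \<open>L\<^sup>2\<close>-closure of the following set.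
\<close>

definition simple_chaos ::
    "('h::{real_inner,banach} \<Rightarrow> 'w::banach) \<Rightarrow> nat \<Rightarrow> ('w \<Rightarrow> real) set" where
  "simple_chaos \<iota> n = {(\<lambda>w. \<Sum>i<m. c i * wiener_ito_power \<iota> n (\<phi> i) w) | (m::nat) c \<phi>. True}"

definition wiener_chaos ::
    "('h::{real_inner,banach} \<Rightarrow> 'w::banach) \<Rightarrow> 'w measure \<Rightarrow> nat \<Rightarrow> ('w \<Rightarrow> real) set" where
  "wiener_chaos \<iota> \<mu> n =
     {Y. \<exists>u. (\<forall>k. u k \<in> simple_chaos \<iota> n) \<and> Lp_converges \<mu> 2 u Y}"

section \<open>The operators \<open>J\<^sub>n\<close> and \<open>\<Gamma>(r)\<close>\<close>

text \<open>
  Elements of \<open>L\<^sup>p\<close> are classes of functions, so an operator is given by its graph on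
  representatives: \<open>T f g\<close> says that \<open>g\<close> is a version of the image of \<open>f\<close>.
  \<open>chaos_projection \<iota> \<mu> n\<close> is the orthogonal projection \<open>J\<^sub>n\<close> on \<open>L\<^sup>2\<close>, and
  \<open>second_quantization \<iota> \<mu> r\<close> is \<open>\<Gamma>(r)\<close> on \<open>L\<^sup>2\<close>.
\<close>

definition chaos_projection ::
    "('h::{real_inner,banach} \<Rightarrow> 'w::banach) \<Rightarrow> 'w measure \<Rightarrow> nat \<Rightarrow>
     ('w \<Rightarrow> real) \<Rightarrow> ('w \<Rightarrow> real) \<Rightarrow> bool" where
  "chaos_projection \<iota> \<mu> n f g \<longleftrightarrow> f \<in> Lp \<mu> 2 \<and> g \<in> wiener_chaos \<iota> \<mu> n \<and>
     (\<forall>Y \<in> wiener_chaos \<iota> \<mu> n. (\<integral>w. (f w - g w) * Y w \<partial>\<mu>) = 0)"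

definition second_quantization ::
    "('h::{real_inner,banach} \<Rightarrow> 'w::banach) \<Rightarrow> 'w measure \<Rightarrow> real \<Rightarrow>
     ('w \<Rightarrow> real) \<Rightarrow> ('w \<Rightarrow> real) \<Rightarrow> bool" where
  "second_quantization \<iota> \<mu> r f g \<longleftrightarrow>
     (\<exists>J. (\<forall>n. chaos_projection \<iota> \<mu> n f (J n)) \<and>
          Lp_converges \<mu> 2 (\<lambda>N w. \<Sum>n<N. r ^ n * J n w) g)"

text \<open>
  The extension by continuity to \<open>L\<^sup>p\<close> of an operator \<open>T\<close> on \<open>L\<^sup>2\<close>: its graph is the closure of
  the graph of \<open>T\<close> on the dense subspace \<open>L\<^sup>2 \<inter> L\<^sup>p\<close>.
\<close>

definition Lp_extension ::
    "'a measure \<Rightarrow> real \<Rightarrow> (('a \<Rightarrow> real) \<Rightarrow> ('a \<Rightarrow> real) \<Rightarrow> bool) \<Rightarrow>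
     ('a \<Rightarrow> real) \<Rightarrow> ('a \<Rightarrow> real) \<Rightarrow> bool" where
  "Lp_extension M p T f g \<longleftrightarrow>
     (\<exists>u v. (\<forall>k. u k \<in> Lp M 2 \<and> T (u k) (v k)) \<and>
            Lp_converges M p u f \<and> Lp_converges M p v g)"

definition Lp_chaos_projection ::
    "('h::{real_inner,banach} \<Rightarrow> 'w::banach) \<Rightarrow> 'w measure \<Rightarrow> real \<Rightarrow> nat \<Rightarrow>
     ('w \<Rightarrow> real) \<Rightarrow> ('w \<Rightarrow> real) \<Rightarrow> bool" where
  "Lp_chaos_projection \<iota> \<mu> p n = Lp_extension \<mu> p (chaos_projection \<iota> \<mu> n)"

definition Lp_second_quantization ::
    "('h::{real_inner,banach} \<Rightarrow> 'w::banach) \<Rightarrow> 'w measure \<Rightarrow> real \<Rightarrow> real \<Rightarrow>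
     ('w \<Rightarrow> real) \<Rightarrow> ('w \<Rightarrow> real) \<Rightarrow> bool" where
  "Lp_second_quantization \<iota> \<mu> p r = Lp_extension \<mu> p (second_quantization \<iota> \<mu> r)"

section \<open>Normalized sums\<close>

definition normalized_sum_law ::
    "'a measure \<Rightarrow> (nat \<Rightarrow> 'a \<Rightarrow> 'w::{banach,second_countable_topology}) \<Rightarrow> nat \<Rightarrow> 'w measure"
  where
  "normalized_sum_law P X n = distr P borel (\<lambda>\<omega>. (1 / sqrt (real n)) *\<^sub>R (\<Sum>i=1..n. X i \<omega>))"

definition normalized_sum_density ::
    "'w measure \<Rightarrow> 'a measure \<Rightarrow> (nat \<Rightarrow> 'a \<Rightarrow> 'w::{banach,second_countable_topology}) \<Rightarrow>
     nat \<Rightarrow> 'w \<Rightarrow> real" where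
  "normalized_sum_density \<mu> P X n w = enn2real (RN_deriv \<mu> (normalized_sum_law P X n) w)"

end

theory Submission
  imports Defs "HOL-Real_Asymp.Real_Asymp"
begin

text \<open>
  A density of the form \<open>\<Gamma>(\<surd>\<alpha>) f\<close> splits every summand: \<open>X\<^sub>i\<close> has the law of
  \<open>\<surd>\<alpha> Y + \<surd>(1 - \<alpha>) Z\<close>, where \<open>Y\<close> has density \<open>f\<close>, \<open>Z\<close> has law \<open>\<mu>\<close>, and both are independent.
  The summands \<open>X\<^sub>1, \<dots>, X\<^sub>n\<close> are replaced one after the other by Gaussian ones
  (\<open>law_power_total_variation\<close>). In each replacement the other \<open>n - 1\<close> summands contain an
  independent Gaussian part of variance \<open>(1 - \<alpha>) (n - 1)\<close>. After rescaling, the replacement changes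
  the probability of a Borel set by the integral of \<open>(g - 1) \<Gamma>(r) 1\<^sub>A\<close> for some Borel set \<open>A\<close>, where
  \<open>r\<close> is of order \<open>n\<^bsup>-1/2\<^esup>\<close> (\<open>smoothed_law_diff\<close>). The function \<open>g - 1\<close> is orthogonal to the chaoses of
  order 0, 1 and 2, and \<open>\<Gamma>(r)\<close> multiplies the chaos of order \<open>k\<close> by \<open>r\<^sup>k\<close>, so this integral is
  \<open>O(r\<^sup>3)\<close> (\<open>smoothing_bound\<close>), and \<open>n\<close> replacements cost \<open>n \<sqdot> O(n\<^bsup>-3/2\<^esup>)\<close>. Total variation turns into the
  \<open>L\<^sup>1\<close> norm of the density by \<open>density_total_variation\<close>.

  For \<open>g\<close> in \<open>L\<^sup>2\<close> the estimate \<open>O(r\<^sup>3)\<close> is Parseval's identity (\<open>chaos_remainder_bound\<close>). For \<open>g\<close> in \<open>L\<^sup>p\<close>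
  it also uses hypercontractivity: \<open>\<Gamma>(r\<^sub>0)\<close> is a contraction from \<open>L\<^sup>2\<close> to \<open>L\<^bsup>2m\<^esup>\<close> for
  \<open>r\<^sub>0 = 1 / (4 m)\<close>, where \<open>2 m\<close> is at least the exponent conjugate to \<open>p\<close>. This holds for a single random
  sign by an elementary inequality, passes to sums of independent signs by induction
  (\<open>noisy_sign_hypercontractive\<close>), and reaches \<open>\<mu>\<close> by the central limit theorem
  (\<open>trig_poly_hypercontractive\<close>), since the inequality for a trigonometric polynomial involves the
  underlying law only through its characteristic functional.

  Trigonometric polynomials of continuous functionals are the test functions throughout: they are
  closed under products and under \<open>\<Gamma>(r)\<close>, and their integrals are explicit. They are rich enough
  because half-spaces generate the Borel sets (\<open>borel_eq_cylinders\<close>, by the Hahn-Banach theorem),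
  whence uniqueness (\<open>signed_laws_eqI\<close>) and density in \<open>L\<^sup>2\<close> (\<open>indicator_trig_approx\<close>). The operators,
  which are given as closures of graphs, are brought to these test functions by the Hermite series
  of the cosine (\<open>hermite_series_integral\<close>); in particular \<open>g = \<Gamma>(\<surd>\<alpha>) f\<close> becomes an identity
  between cosine integrals (\<open>second_quantization_cos\<close>).
\<close>

section \<open>Continuous functionals and the Borel sets\<close>

definition sublinear_contraction :: "('w::real_normed_vector \<Rightarrow> real) \<Rightarrow> bool" where
  "sublinear_contraction q \<longleftrightarrow>
     (\<forall>x y. q (x + y) \<le> q x + q y) \<and> (\<forall>c x. 0 \<le> c \<longrightarrow> q (c *\<^sub>R x) = c * q x) \<and> (\<forall>x. q x \<le> norm x)"

text \<open>
  Lowering a sublinear functional along the ray of \<open>y\<close> makes it odd at \<open>y\<close>. A sublinear functional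
  that is odd everywhere is linear, so this is the step of a Hahn-Banach argument.
\<close>

definition odd_at :: "'w::real_normed_vector \<Rightarrow> ('w \<Rightarrow> real) \<Rightarrow> 'w \<Rightarrow> real" where
  "odd_at y q x = (INF t\<in>{0..}. q (x + t *\<^sub>R y) - t * q y)"

lemma sublinear_contractionD:
  assumes "sublinear_contraction q"
  shows "q (x + y) \<le> q x + q y" "0 \<le> c \<Longrightarrow> q (c *\<^sub>R x) = c * q x" "q x \<le> norm x" "q 0 = 0"
    "- q (- x) \<le> q x" "- norm x \<le> q x"
proof -
  show a: "q (x + y) \<le> q x + q y" "0 \<le> c \<Longrightarrow> q (c *\<^sub>R x) = c * q x" "q x \<le> norm x" for x y c
    using assms by (auto simp: sublinear_contraction_def)
  show z: "q 0 = 0" using a(2)[of 0 0] by simp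
  show m: "- q (- x) \<le> q x" using a(1)[of x "- x"] z by simp
  show "- norm x \<le> q x" using m a(3)[of "- x"] by simp
qed

lemma odd_at:
  assumes q: "sublinear_contraction q"
  shows "sublinear_contraction (odd_at y q)" "odd_at y q x \<le> q x" "odd_at y q (- y) \<le> - q y"
proof -
  note D = sublinear_contractionD[OF q]
  have low: "- q (- x) \<le> q (x + t *\<^sub>R y) - t * q y" if "t \<ge> 0" for x t
    using D(1)[of "x + t *\<^sub>R y" "- x"] D(2)[of t y] that by simp
  have bdd: "bdd_below ((\<lambda>t. q (x + t *\<^sub>R y) - t * q y) ` {0..})" for x
    using low by (intro bdd_belowI[of _ "- q (- x)"]) auto
  have le: "odd_at y q x \<le> q (x + t *\<^sub>R y) - t * q y" if "t \<ge> 0" for x t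
    unfolding odd_at_def using that by (intro cINF_lower bdd) auto
  have ge: "z \<le> odd_at y q x" if "\<And>t. t \<ge> 0 \<Longrightarrow> z \<le> q (x + t *\<^sub>R y) - t * q y" for x z
    unfolding odd_at_def using that by (intro cINF_greatest) auto
  show le0: "odd_at y q x \<le> q x" for x using le[of 0 x] by simp
  show "odd_at y q (- y) \<le> - q y" using le[of 1 "- y"] D(4) by simp
  have add: "odd_at y q (u + v) \<le> odd_at y q u + odd_at y q v" for u v
  proof -
    have "odd_at y q (u + v) - (q (v + s *\<^sub>R y) - s * q y) \<le> odd_at y q u" if s: "s \<ge> 0" for s
    proof (rule ge)
      fix t :: real assume t: "t \<ge> 0"
      have "odd_at y q (u + v) \<le> q (u + v + (t + s) *\<^sub>R y) - (t + s) * q y"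
        using s t by (intro le) auto
      also have "u + v + (t + s) *\<^sub>R y = (u + t *\<^sub>R y) + (v + s *\<^sub>R y)"
        by (simp add: algebra_simps)
      also have "q \<dots> \<le> q (u + t *\<^sub>R y) + q (v + s *\<^sub>R y)" by (rule D(1))
      finally show "odd_at y q (u + v) - (q (v + s *\<^sub>R y) - s * q y) \<le> q (u + t *\<^sub>R y) - t * q y"
        by (simp add: algebra_simps)
    qed
    hence "odd_at y q (u + v) - odd_at y q u \<le> odd_at y q v" by (intro ge) (simp add: algebra_simps)
    thus ?thesis by simp
  qed
  have hom_le: "odd_at y q (c *\<^sub>R u) \<le> c * odd_at y q u" if c: "c > 0" for c u
  proof -
    have "odd_at y q (c *\<^sub>R u) / c \<le> odd_at y q u"
    proof (rule ge)
      fix t :: real assume t: "t \<ge> 0"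
      have "odd_at y q (c *\<^sub>R u) \<le> q (c *\<^sub>R u + (c * t) *\<^sub>R y) - (c * t) * q y"
        using c t by (intro le) auto
      also have "c *\<^sub>R u + (c * t) *\<^sub>R y = c *\<^sub>R (u + t *\<^sub>R y)" by (simp add: algebra_simps)
      also have "q \<dots> = c * q (u + t *\<^sub>R y)" using c by (intro D(2)) simp
      finally show "odd_at y q (c *\<^sub>R u) / c \<le> q (u + t *\<^sub>R y) - t * q y"
        using c by (simp add: field_simps)
    qed
    thus ?thesis using c by (simp add: field_simps)
  qed
  have zero: "odd_at y q 0 = 0"
  proof (rule antisym)
    show "odd_at y q 0 \<le> 0" using le0[of 0] D(4) by simp
    show "0 \<le> odd_at y q 0" by (rule ge) (simp add: D(2))
  qed
  have hom: "odd_at y q (c *\<^sub>R u) = c * odd_at y q u" if c: "c \<ge> 0" for c u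
  proof (cases "c = 0")
    case False
    hence c: "c > 0" using c by simp
    have "odd_at y q (inverse c *\<^sub>R (c *\<^sub>R u)) \<le> inverse c * odd_at y q (c *\<^sub>R u)"
      using c by (intro hom_le) simp
    hence "c * odd_at y q u \<le> odd_at y q (c *\<^sub>R u)" using c by (simp add: field_simps)
    with hom_le[OF c] show ?thesis by (intro antisym)
  qed (simp add: zero)
  show "sublinear_contraction (odd_at y q)"
    unfolding sublinear_contraction_def using add hom order_trans[OF le0 D(3)] by blast
qed

text \<open>
  In a separable space countably many steps replace Zorn's lemma: the norm is lowered along the points
  of a dense sequence. The limit is odd on the sequence and, being continuous, everywhere.
\<close>

lemma norming_functional:
  fixes x0 :: "'w::{real_normed_vector,second_countable_topology}"
  shows "\<exists>\<phi> :: 'w \<Rightarrow>\<^sub>L real. blinfun_apply \<phi> x0 = norm x0 \<and> (\<forall>x. blinfun_apply \<phi> x \<le> norm x)"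
proof -
  obtain D :: "'w set" where D: "countable D" "\<And>U. open U \<Longrightarrow> U \<noteq> {} \<Longrightarrow> \<exists>y\<in>D. y \<in> U"
    using countable_dense_setE by metis
  \<comment> \<open>\<open>x0\<close> is treated first, while the sublinear functional there is still the norm.\<close>
  define d where "d n = (case n of 0 \<Rightarrow> x0 | Suc k \<Rightarrow> from_nat_into (insert x0 D) k)" for n
  have rd: "\<exists>n. d n = y" if "y \<in> D" for y
  proof -
    have "\<exists>k. from_nat_into (insert x0 D) k = y"
      by (rule from_nat_into_surj) (use D(1) that in auto)
    then obtain k where "from_nat_into (insert x0 D) k = y" ..
    hence "d (Suc k) = y" by (simp add: d_def)
    thus ?thesis ..
  qed
  define qs where "qs = rec_nat norm (\<lambda>n q. odd_at (d n) q)"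
  have qs0: "qs 0 = norm" and qsS: "qs (Suc n) = odd_at (d n) (qs n)" for n
    unfolding qs_def by simp_all
  have sc: "sublinear_contraction (qs n)" for n
  proof (induction n)
    case 0
    show ?case unfolding qs0 sublinear_contraction_def by (simp add: norm_triangle_ineq)
  next
    case (Suc n)
    show ?case unfolding qsS by (rule odd_at(1)[OF Suc])
  qed
  note qD = sublinear_contractionD[OF sc]
  have dec: "decseq (\<lambda>n. qs n x)" for x by (intro decseq_SucI) (simp add: qsS odd_at sc)
  have bdd: "bdd_below (range (\<lambda>n. qs n x))" for x
    using qD(6) by (intro bdd_belowI[of _ "- norm x"]) auto
  define Q where "Q x = (INF n. qs n x)" for x
  have lim: "(\<lambda>n. qs n x) \<longlonglongrightarrow> Q x" for x
    unfolding Q_def by (rule LIMSEQ_decseq_INF[OF bdd dec])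
  have Qle: "Q x \<le> qs n x" for n x unfolding Q_def by (intro cINF_lower bdd) simp
  have "Q (x + y) \<le> Q x + Q y" for x y
    using qD(1) by (intro LIMSEQ_le[OF lim tendsto_add[OF lim lim]]) auto
  moreover have "Q (c *\<^sub>R x) = c * Q x" if "c \<ge> 0" for c x
    using LIMSEQ_unique[OF lim[of "c *\<^sub>R x"]] tendsto_mult[OF tendsto_const lim[of x]] qD(2)[OF that] by simp
  moreover have "Q x \<le> norm x" for x using Qle[of x 0] qs0 by simp
  ultimately have scQ: "sublinear_contraction Q" by (auto simp: sublinear_contraction_def)
  note QD = sublinear_contractionD[OF scQ]
  have Qd: "Q (- d n) \<le> - qs n (d n)" for n
    using Qle[of "- d n" "Suc n"] odd_at(3)[OF sc, of "d n" n] by (simp add: qsS)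
  have odd: "Q (- x) = - Q x" for x
  proof (rule antisym)
    show "- Q x \<le> Q (- x)" using QD(5)[of x] by simp
    show "Q (- x) \<le> - Q x"
    proof (rule field_le_epsilon)
      fix e :: real assume e: "e > 0"
      obtain y where y: "y \<in> D" "y \<in> ball x (e / 2)" using D(2)[of "ball x (e/2)"] e by auto
      then obtain n where n: "d n = y" using rd by blast
      have "Q (- y) \<le> - Q y" using Qd[of n] Qle[of y n] n by simp
      moreover have "Q x \<le> Q y + norm (x - y)" using QD(1)[of y "x - y"] QD(3)[of "x - y"] by simp
      moreover have "Q (- x) \<le> Q (- y) + norm (x - y)"
        using QD(1)[of "- y" "y - x"] QD(3)[of "y - x"] by (simp add: norm_minus_commute)
      moreover have "norm (x - y) < e / 2" using y by (simp add: dist_norm)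
      ultimately show "Q (- x) \<le> - Q x + e" by linarith
    qed
  qed
  have lin: "bounded_linear Q"
  proof (rule bounded_linear_intro[where K=1])
    show "Q (x + y) = Q x + Q y" for x y
      using QD(1)[of x y] QD(1)[of "- x" "- y"] odd[of x] odd[of y] odd[of "x + y"] by simp
    show "Q (r *\<^sub>R x) = r *\<^sub>R Q x" for r x
      using QD(2)[of r x] QD(2)[of "- r" x] odd[of "r *\<^sub>R x"] by (cases "r \<ge> 0") auto
    show "norm (Q x) \<le> norm x * 1" for x using QD(3)[of x] QD(6)[of x] by auto
  qed
  define \<phi> where "\<phi> = Blinfun Q"
  have \<phi>: "blinfun_apply \<phi> = Q" unfolding \<phi>_def using lin by (rule bounded_linear_Blinfun_apply)
  have "Q (- x0) \<le> - norm x0" using Qd[of 0] by (simp add: qs0 d_def)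
  hence "Q x0 = norm x0" using QD(3)[of x0] odd[of x0] by simp
  thus ?thesis using QD(3) by (intro exI[of _ \<phi>]) (simp add: \<phi>)
qed

text \<open>
  A list rather than a finite set of half-spaces: intersection becomes concatenation, and
  induction adds one half-space at a time.
\<close>

definition cylinder :: "(('w::real_normed_vector \<Rightarrow>\<^sub>L real) \<times> real) list \<Rightarrow> 'w set" where
  "cylinder xs = {w. \<forall>(\<phi>, a)\<in>set xs. blinfun_apply \<phi> w \<le> a}"

lemma borel_measurable_blinfun [measurable]: "blinfun_apply \<phi> \<in> borel_measurable borel"
  for \<phi> :: "'w::real_normed_vector \<Rightarrow>\<^sub>L 'v::real_normed_vector"
  by (intro borel_measurable_continuous_onI linear_continuous_on blinfun.bounded_linear_right)

text \<open>
  With norming functionals for the points of a countable dense set, a closed ball is a countable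
  intersection of half-spaces, and an open set is a countable union of closed balls.
\<close>

lemma borel_eq_cylinders:
  "sets (borel :: 'w::{real_normed_vector,second_countable_topology} measure) = sigma_sets UNIV (range cylinder)"
proof (rule antisym)
  show "sigma_sets UNIV (range cylinder) \<subseteq> sets (borel :: 'w measure)"
  proof (rule sets.sigma_sets_subset[of _ borel, simplified space_borel], safe)
    fix xs :: "(('w \<Rightarrow>\<^sub>L real) \<times> real) list"
    have "cylinder xs = (\<Inter>x\<in>set xs. {w \<in> space borel. blinfun_apply (fst x) w \<le> snd x})"
      by (fastforce simp: cylinder_def)
    also have "\<dots> \<in> sets borel" by (cases "xs = []") (auto intro!: sets.finite_INT)
    finally show "cylinder xs \<in> sets borel" .
  qed
  let ?S = "sigma_sets UNIV (range (cylinder :: (('w \<Rightarrow>\<^sub>L real) \<times> real) list \<Rightarrow> _))"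
  interpret sigma_algebra UNIV ?S by (rule sigma_algebra_sigma_sets) simp
  obtain D :: "'w set" where D: "countable D" "\<And>U. open U \<Longrightarrow> U \<noteq> {} \<Longrightarrow> \<exists>y\<in>D. y \<in> U"
    using countable_dense_setE by metis
  obtain \<phi> :: "'w \<Rightarrow> 'w \<Rightarrow>\<^sub>L real" where \<phi>: "\<And>d. blinfun_apply (\<phi> d) d = norm d"
      "\<And>d x. blinfun_apply (\<phi> d) x \<le> norm x"
    using norming_functional by metis
  have ball: "cball x e \<in> ?S" for x e
  proof -
    have "cball x e = (\<Inter>d\<in>D. cylinder [(\<phi> d, e + \<phi> d x)])" (is "_ = ?R")
    proof (intro set_eqI iffI)
      fix w assume "w \<in> cball x e"
      hence "norm (w - x) \<le> e" by (simp add: dist_norm norm_minus_commute)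
      hence "\<phi> d (w - x) \<le> e" for d using \<phi>(2)[of d "w - x"] by simp
      thus "w \<in> ?R" by (auto simp: cylinder_def blinfun.diff_right algebra_simps)
    next
      fix w assume w: "w \<in> ?R"
      have *: "\<phi> d (w - x) \<le> e" if "d \<in> D" for d
        using w that by (auto simp: cylinder_def blinfun.diff_right algebra_simps)
      have "norm (w - x) \<le> e"
      proof (rule field_le_epsilon)
        fix r :: real assume r: "r > 0"
        obtain d where d: "d \<in> D" "d \<in> ball (w - x) (r / 2)" using D(2)[of "ball (w - x) (r/2)"] r by auto
        hence n: "norm (d - (w - x)) < r / 2" by (simp add: dist_norm norm_minus_commute)
        have "norm (w - x) \<le> norm d + norm (d - (w - x))"
          using norm_triangle_ineq4[of d "d - (w - x)"] by simp
        also have "norm d = \<phi> d (w - x) + \<phi> d (d - (w - x))"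
          by (simp add: \<phi>(1) flip: blinfun.add_right)
        also have "\<dots> \<le> e + norm (d - (w - x))" using *[OF d(1)] \<phi>(2) by (intro add_mono)
        finally show "norm (w - x) \<le> e + r" using n by simp
      qed
      thus "w \<in> cball x e" by (simp add: dist_norm norm_minus_commute)
    qed
    also have "\<dots> \<in> ?S" 
    proof (cases "D = {}")
      case False
      thus ?thesis using D(1) by (intro countable_INT') (auto intro: sigma_sets.Basic)
    qed simp
    finally show ?thesis .
  qed
  have "U \<in> ?S" if U: "open U" for U
  proof -
    let ?I = "{(x, n). x \<in> D \<and> cball x (1 / real (Suc n)) \<subseteq> U}"
    have "U = (\<Union>(x, n)\<in>?I. cball x (1 / real (Suc n)))"
    proof (intro set_eqI iffI)
      fix w assume "w \<in> U"
      then obtain e where e: "e > 0" "ball w e \<subseteq> U" using U by (auto simp: open_contains_ball)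
      obtain n where n: "1 / real (Suc n) < e / 2" using e nat_approx_posE half_gt_zero by metis
      obtain x where x: "x \<in> D" "x \<in> ball w (1 / real (Suc n))" 
        using D(2)[of "ball w (1 / real (Suc n))"] by auto
      have "cball x (1 / real (Suc n)) \<subseteq> ball w e"
      proof
        fix y assume "y \<in> cball x (1 / real (Suc n))"
        thus "y \<in> ball w e" using x(2) n dist_triangle[of w y x] by simp
      qed
      hence "(x, n) \<in> ?I" using e x by blast
      thus "w \<in> (\<Union>(x, n)\<in>?I. cball x (1 / real (Suc n)))"
        using x by (intro UN_I[of "(x, n)"]) (auto simp: dist_commute less_imp_le)
    qed auto
    also have "\<dots> \<in> ?S"
    proof (intro countable_UN')
      show "countable ?I" by (rule countable_subset[of _ "D \<times> UNIV"]) (use D(1) in auto)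
    qed (use ball in auto)
    finally show ?thesis .
  qed
  thus "sets (borel :: 'w measure) \<subseteq> ?S"
    unfolding borel_def by (subst sets_measure_of) (auto intro!: sigma_sets_subset)
qed

lemma Int_stable_cylinders: "Int_stable (range cylinder)"
proof (rule Int_stableI, safe)
  fix xs ys :: "(('w::real_normed_vector \<Rightarrow>\<^sub>L real) \<times> real) list"
  have "cylinder xs \<inter> cylinder ys = cylinder (xs @ ys)" by (auto simp: cylinder_def)
  thus "cylinder xs \<inter> cylinder ys \<in> range cylinder" by simp
qed

lemma cylinder_in_borel [measurable]: 
  "cylinder xs \<in> sets (borel :: 'w::{real_normed_vector,second_countable_topology} measure)"
  unfolding borel_eq_cylinders by auto

section \<open>Trigonometric polynomials\<close>

text \<open>
  The phase \<open>\<theta>\<close>, in place of sines or complex exponentials, keeps these functions real while they remain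
  closed under products. Restricting the frequencies to \<open>\<Phi>\<close> expresses dependence on finitely many
  functionals, as needed for finite-dimensional approximation.
\<close>

inductive_set trig_poly :: "('w::real_normed_vector \<Rightarrow>\<^sub>L real) set \<Rightarrow> ('w \<Rightarrow> real) set" for \<Phi> where
  trig_cos: "\<phi> \<in> \<Phi> \<Longrightarrow> (\<lambda>w. cos (blinfun_apply \<phi> w + \<theta>)) \<in> trig_poly \<Phi>"
| trig_add: "T \<in> trig_poly \<Phi> \<Longrightarrow> U \<in> trig_poly \<Phi> \<Longrightarrow> (\<lambda>w. T w + U w) \<in> trig_poly \<Phi>"
| trig_scale: "T \<in> trig_poly \<Phi> \<Longrightarrow> (\<lambda>w. c * T w) \<in> trig_poly \<Phi>"

lemma trig_poly_mono:
  assumes "T \<in> trig_poly \<Phi>" "\<Phi> \<subseteq> \<Psi>"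
  shows "T \<in> trig_poly \<Psi>"
  using assms(1) by induction (use assms(2) in \<open>auto intro: trig_poly.intros\<close>)

lemma trig_poly_finite_support:
  assumes "T \<in> trig_poly \<Phi>"
  shows "\<exists>\<Psi>. finite \<Psi> \<and> \<Psi> \<subseteq> \<Phi> \<and> T \<in> trig_poly \<Psi>"
  using assms
proof induction
  case (trig_cos \<phi> \<theta>)
  thus ?case by (intro exI[of _ "{\<phi>}"]) (auto intro: trig_poly.intros)
next
  case (trig_add T U)
  then obtain A B where "finite A" "A \<subseteq> \<Phi>" "T \<in> trig_poly A" "finite B" "B \<subseteq> \<Phi>" "U \<in> trig_poly B" by blast
  thus ?case by (intro exI[of _ "A \<union> B"]) (auto intro!: trig_poly.intros intro: trig_poly_mono)
qed (auto intro: trig_poly.intros)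

lemma trig_poly_const: "0 \<in> \<Phi> \<Longrightarrow> (\<lambda>w. c) \<in> trig_poly \<Phi>"
  using trig_scale[OF trig_cos[of 0 \<Phi> 0], of c] by simp

lemma trig_poly_diff:
  assumes "T \<in> trig_poly \<Phi>" "U \<in> trig_poly \<Phi>"
  shows "(\<lambda>w. T w - U w) \<in> trig_poly \<Phi>"
  using trig_add[OF assms(1) trig_scale[OF assms(2), of "-1"]] by simp

lemma trig_poly_mult:
  assumes T: "T \<in> trig_poly \<Phi>" and U: "U \<in> trig_poly \<Phi>" and \<Phi>: "subspace \<Phi>"
  shows "(\<lambda>w. T w * U w) \<in> trig_poly \<Phi>"
  using T
proof induction
  case (trig_cos \<phi> \<theta>)
  note \<phi> = this
  show ?case using U
  proof induction
    case (trig_cos \<psi> \<eta>)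
    have *: "cos (blinfun_apply \<phi> w + \<theta>) * cos (blinfun_apply \<psi> w + \<eta>) =
        (1/2) * cos (blinfun_apply (\<phi> - \<psi>) w + (\<theta> - \<eta>)) + (1/2) * cos (blinfun_apply (\<phi> + \<psi>) w + (\<theta> + \<eta>))" for w
    proof -
      have "blinfun_apply (\<phi> - \<psi>) w + (\<theta> - \<eta>) = (blinfun_apply \<phi> w + \<theta>) - (blinfun_apply \<psi> w + \<eta>)"
        and "blinfun_apply (\<phi> + \<psi>) w + (\<theta> + \<eta>) = (blinfun_apply \<phi> w + \<theta>) + (blinfun_apply \<psi> w + \<eta>)"
        by (simp_all add: blinfun.add_left blinfun.diff_left)
      thus ?thesis by (simp only: cos_times_cos add_divide_distrib)
    qed
    show ?case unfolding *
      using \<phi> trig_cos \<Phi> by (intro trig_poly.intros) (auto simp: subspace_add subspace_diff)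
  next
    case (trig_add T U)
    thus ?case by (simp add: distrib_left trig_poly.trig_add)
  next
    case (trig_scale T c)
    thus ?case using trig_poly.trig_scale[OF trig_scale.IH, of c] by (simp add: mult_ac)
  qed
next
  case (trig_add T U)
  thus ?case by (simp add: distrib_right trig_poly.trig_add)
next
  case (trig_scale T c)
  thus ?case using trig_poly.trig_scale[OF trig_scale.IH, of c] by (simp add: mult_ac)
qed

lemma trig_poly_power:
  assumes "T \<in> trig_poly \<Phi>" "subspace \<Phi>"
  shows "(\<lambda>w. T w ^ n) \<in> trig_poly \<Phi>"
  by (induction n) (auto intro: trig_poly_mult trig_poly_const assms subspace_0)

lemma trig_poly_sin: "\<phi> \<in> \<Phi> \<Longrightarrow> (\<lambda>w. sin (blinfun_apply \<phi> w)) \<in> trig_poly \<Phi>"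
  using trig_cos[of \<phi> \<Phi> "- (pi/2)"] by (simp only: cos_add cos_minus sin_minus cos_pi_half sin_pi_half) simp

lemma trig_poly_polynomial:
  assumes "real_polynomial_function p" "T \<in> trig_poly \<Phi>" "subspace \<Phi>"
  shows "(\<lambda>w. p (T w)) \<in> trig_poly \<Phi>"
  using assms(1)
proof induction
  case (linear f)
  then interpret bounded_linear f .
  have "f x = f 1 * x" for x using scaleR[of x 1] by simp
  hence "(\<lambda>w. f (T w)) = (\<lambda>w. f 1 * T w)" by (rule ext)
  thus ?case using trig_scale[OF assms(2), of "f 1"] by simp
qed (auto intro: trig_poly_const trig_add trig_poly_mult assms subspace_0)

lemma trig_poly_bounded: "T \<in> trig_poly \<Phi> \<Longrightarrow> \<exists>B. \<forall>w. \<bar>T w\<bar> \<le> B"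
proof (induction rule: trig_poly.induct)
  case (trig_cos \<phi> \<theta>)
  show ?case by (intro exI[of _ 1]) simp
next
  case (trig_add T U)
  then obtain A B where "\<forall>w. \<bar>T w\<bar> \<le> A" "\<forall>w. \<bar>U w\<bar> \<le> B" by blast
  thus ?case by (intro exI[of _ "A + B"]) (auto intro: order_trans[OF abs_triangle_ineq add_mono])
next
  case (trig_scale T c)
  then obtain A where "\<forall>w. \<bar>T w\<bar> \<le> A" by blast
  thus ?case by (intro exI[of _ "\<bar>c\<bar> * A"]) (simp add: abs_mult mult_left_mono)
qed

lemma trig_poly_measurable:
  "T \<in> trig_poly \<Phi> \<Longrightarrow> T \<in> borel_measurable borel"
  by (induction rule: trig_poly.induct) simp_all

section \<open>Laws on a Banach space are determined by their characteristic functionals\<close>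

text \<open>
  Since \<open>n sin (\<phi> / n)\<close> tends to \<open>\<phi>\<close> with an error of order \<open>n\<^bsup>-2\<^esup>\<close>, a ramp of slope \<open>n\<close> in this variable
  still converges to the indicator. The ramp is a continuous function of a sine, hence nearly a
  polynomial in it by Weierstrass' theorem.
\<close>

lemma halfspace_trig_approx:
  fixes \<phi> :: "'w::real_normed_vector \<Rightarrow>\<^sub>L real"
  shows "\<exists>T. (\<forall>n. T n \<in> trig_poly UNIV) \<and> (\<forall>n w. \<bar>T n w\<bar> \<le> 2) \<and>
     (\<forall>w. (\<lambda>n. T n w) \<longlonglongrightarrow> (if blinfun_apply \<phi> w \<le> a then 1 else 0))"
proof -
  define N where "N n = real (Suc n)" for n
  define F where "F n x = max 0 (min 1 (1 - N n * (N n * x - a)))" for n x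
  have "\<exists>p. real_polynomial_function p \<and> (\<forall>x\<in>{-1..1}. \<bar>F n x - p x\<bar> < 1 / N n)" for n
  proof -
    have "continuous_on {-1..1} (F n)" unfolding F_def by (intro continuous_intros)
    moreover have "1 / N n > 0" by (simp add: N_def)
    ultimately obtain p where "real_polynomial_function p" "\<And>x. x \<in> {-1..1} \<Longrightarrow> \<bar>F n x - p x\<bar> < 1 / N n"
      by (rule Stone_Weierstrass_real_polynomial_function[OF compact_Icc]) (rule that, assumption, simp)
    thus ?thesis by blast
  qed
  then obtain p where p: "\<And>n. real_polynomial_function (p n)"
      "\<And>n x. x \<in> {-1..1} \<Longrightarrow> \<bar>F n x - p n x\<bar> < 1 / N n" by metis
  define T where "T n w = p n (sin (blinfun_apply ((1 / N n) *\<^sub>R \<phi>) w))" for n w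
  have T: "T n \<in> trig_poly UNIV" for n
    unfolding T_def by (rule trig_poly_polynomial[OF p(1) trig_poly_sin]) simp_all
  have close: "\<bar>F n (sin (blinfun_apply \<phi> w / N n)) - T n w\<bar> < 1 / N n" for n w
    using p(2)[of "sin (blinfun_apply \<phi> w / N n)" n] unfolding T_def by (simp add: blinfun.scaleR_left)
  have F01: "0 \<le> F n x" "F n x \<le> 1" for n x by (auto simp: F_def)
  have bd: "\<bar>T n w\<bar> \<le> 2" for n w
  proof -
    have "1 / N n \<le> 1" by (simp add: N_def)
    thus ?thesis using close[of n w] F01[of n "sin (blinfun_apply \<phi> w / N n)"] by linarith
  qed
  have err: "(\<lambda>n. N n * (N n * sin (x / N n) - x)) \<longlonglongrightarrow> 0" for x
    unfolding N_def by real_asymp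
  have N: "(\<lambda>n. 1 / N n) \<longlonglongrightarrow> 0" unfolding N_def by real_asymp
  have "(\<lambda>n. F n (sin (x / N n))) \<longlonglongrightarrow> (if x \<le> a then 1 else 0)" for x :: real
  proof (cases "x \<le> a")
    case True
    have "(\<lambda>n. F n (sin (x / N n))) \<longlonglongrightarrow> 1"
    proof (rule tendsto_sandwich[OF always_eventually always_eventually, where h="\<lambda>_. 1"])
      show "\<forall>n. min 1 (1 - N n * (N n * sin (x / N n) - x)) \<le> F n (sin (x / N n))"
      proof
        fix n
        have "N n * x \<le> N n * a" using True by (intro mult_left_mono) (auto simp: N_def)
        thus "min 1 (1 - N n * (N n * sin (x / N n) - x)) \<le> F n (sin (x / N n))"
          unfolding F_def by (auto simp: algebra_simps)
      qed
      have "(\<lambda>n. min 1 (1 - N n * (N n * sin (x / N n) - x))) \<longlonglongrightarrow> min 1 (1 - 0)"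
        by (intro tendsto_intros err)
      thus "(\<lambda>n. min 1 (1 - N n * (N n * sin (x / N n) - x))) \<longlonglongrightarrow> 1" by simp
    qed (use F01 in auto)
    thus ?thesis using True by simp
  next
    case False
    have "filterlim (\<lambda>n. N n * (x - a)) at_top sequentially"
      unfolding N_def using False by real_asymp
    hence "filterlim (\<lambda>n. N n * (N n * sin (x / N n) - x) + N n * (x - a)) at_top sequentially"
      by (intro filterlim_tendsto_add_at_top[OF err])
    hence "eventually (\<lambda>n. N n * (N n * sin (x / N n) - x) + N n * (x - a) \<ge> 1) sequentially"
      by (simp add: filterlim_at_top)
    hence "eventually (\<lambda>n. F n (sin (x / N n)) = 0) sequentially"
      by eventually_elim (auto simp: F_def algebra_simps)
    thus ?thesis using False by (simp add: tendsto_eventually)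
  qed
  moreover have "(\<lambda>n. T n w - F n (sin (blinfun_apply \<phi> w / N n))) \<longlonglongrightarrow> 0" for w
    by (rule Lim_null_comparison[OF always_eventually N])
       (use close in \<open>auto simp: abs_minus_commute less_imp_le\<close>)
  ultimately have "(\<lambda>n. T n w - F n (sin (blinfun_apply \<phi> w / N n)) + F n (sin (blinfun_apply \<phi> w / N n)))
      \<longlonglongrightarrow> 0 + (if blinfun_apply \<phi> w \<le> a then 1 else 0)" for w
    by (intro tendsto_add)
  hence "(\<lambda>n. T n w) \<longlonglongrightarrow> (if blinfun_apply \<phi> w \<le> a then 1 else 0)" for w by simp
  thus ?thesis using T bd by blast
qed

lemma cylinder_trig_approx:
  "\<exists>T B. (\<forall>n. T n \<in> trig_poly UNIV) \<and> (\<forall>n w. \<bar>T n w\<bar> \<le> B) \<and>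
     (\<forall>w. (\<lambda>n. T n w) \<longlonglongrightarrow> indicator (cylinder xs) w)"
proof (induction xs)
  case Nil
  show ?case
    by (intro exI[of _ "\<lambda>_ _. 1"] exI[of _ 1]) (auto simp: cylinder_def intro: trig_poly_const)
next
  case (Cons x xs)
  obtain \<phi> a where x: "x = (\<phi>, a)" by (cases x)
  obtain T B where T: "\<And>n. T n \<in> trig_poly UNIV" "\<And>n w. \<bar>T n w\<bar> \<le> B"
     "\<And>w. (\<lambda>n. T n w) \<longlonglongrightarrow> indicator (cylinder xs) w" using Cons.IH by blast
  obtain U where U: "\<And>n. U n \<in> trig_poly UNIV" "\<And>n w. \<bar>U n w\<bar> \<le> 2"
     "\<And>w. (\<lambda>n. U n w) \<longlonglongrightarrow> (if blinfun_apply \<phi> w \<le> a then 1 else 0)" 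
    using halfspace_trig_approx[of \<phi> a] by blast
  have "(\<lambda>n. U n w * T n w) \<longlonglongrightarrow> indicator (cylinder (x # xs)) w" for w
  proof -
    have "(\<lambda>n. U n w * T n w) \<longlonglongrightarrow> (if blinfun_apply \<phi> w \<le> a then 1 else 0) * indicator (cylinder xs) w"
      by (intro tendsto_mult U T)
    also have "(if blinfun_apply \<phi> w \<le> a then 1 else 0) * indicator (cylinder xs) w = 
       (indicator (cylinder (x # xs)) w :: real)"
      by (auto simp: cylinder_def x indicator_def)
    finally show ?thesis .
  qed
  moreover have "\<bar>U n w * T n w\<bar> \<le> 2 * B" for n w
    unfolding abs_mult by (intro mult_mono T U) auto
  ultimately show ?case
    by (intro exI[of _ "\<lambda>n w. U n w * T n w"] exI[of _ "2 * B"]) (auto intro: trig_poly_mult T U)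
qed

lemma cylinders_Pow: "range cylinder \<subseteq> Pow UNIV" by simp

lemma integrable_mult_bounded:
  fixes G h :: "'a \<Rightarrow> real"
  assumes G: "integrable M G" and h: "h \<in> borel_measurable M" "\<And>x. \<bar>h x\<bar> \<le> B"
  shows "integrable M (\<lambda>x. G x * h x)"
proof (rule Bochner_Integration.integrable_bound)
  show "integrable M (\<lambda>x. G x * B)" using G by simp
  show "AE x in M. norm (G x * h x) \<le> norm (G x * B)"
  proof (rule AE_I2)
    fix x
    have "\<bar>h x\<bar> \<le> \<bar>B\<bar>" using h(2)[of x] by linarith
    thus "norm (G x * h x) \<le> norm (G x * B)" by (simp add: abs_mult mult_left_mono)
  qed
qed (use G h in measurable)

text \<open>
  Dominated convergence gives the equality on cylinders, and the sets for which it holds form a Dynkin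
  system. Weights and two underlying spaces are allowed because the lemma serves both for the
  uniqueness of laws and for identifying a density with an integral over a product space.
\<close>

lemma signed_laws_eqI:
  fixes Y1 :: "'a \<Rightarrow> 'w::{real_normed_vector,second_countable_topology}" and Y2 :: "'b \<Rightarrow> 'w"
  assumes G: "integrable M1 G1" "integrable M2 G2"
    and Y [measurable]: "Y1 \<in> borel_measurable M1" "Y2 \<in> borel_measurable M2"
    and eq: "\<And>\<phi> \<theta>. (\<integral>x. G1 x * cos (blinfun_apply \<phi> (Y1 x) + \<theta>) \<partial>M1) =
                    (\<integral>x. G2 x * cos (blinfun_apply \<phi> (Y2 x) + \<theta>) \<partial>M2)"
    and A: "A \<in> sets borel"
  shows "(\<integral>x. G1 x * indicator A (Y1 x) \<partial>M1) = (\<integral>x. G2 x * indicator A (Y2 x) \<partial>M2 :: real)"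
proof -
  note [measurable] = borel_measurable_integrable[OF G(1)] borel_measurable_integrable[OF G(2)]
  note [measurable del] = borel_measurable_integrable
  have int: "integrable M (\<lambda>x. G x * F (Y x))"
    if "integrable M G" "Y \<in> borel_measurable M" "F \<in> borel_measurable borel" "\<And>w. \<bar>F w\<bar> \<le> B"
    for M :: "'c measure" and G :: "'c \<Rightarrow> real" and Y and F :: "'w \<Rightarrow> real" and B
    by (rule integrable_mult_bounded[OF that(1) measurable_compose[OF that(2,3)] that(4)])
  have intT: "integrable M1 (\<lambda>x. G1 x * T (Y1 x))" "integrable M2 (\<lambda>x. G2 x * T (Y2 x))" 
    if "T \<in> trig_poly UNIV" for T
    using trig_poly_bounded[OF that] trig_poly_measurable[OF that] int[OF G(1) Y(1)] int[OF G(2) Y(2)] by blast+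
  have trig: "(\<integral>x. G1 x * T (Y1 x) \<partial>M1) = (\<integral>x. G2 x * T (Y2 x) \<partial>M2)" if "T \<in> trig_poly UNIV" for T
    using that
  proof induction
    case (trig_cos \<phi> \<theta>)
    show ?case by (rule eq)
  next
    case (trig_add T U)
    thus ?case using intT by (simp add: distrib_left)
  next
    case (trig_scale T c)
    thus ?case by (simp add: mult.left_commute)
  qed
  have tot: "(\<integral>x. G1 x \<partial>M1) = (\<integral>x. G2 x \<partial>M2)" using eq[of 0 0] by simp
  have intA: "integrable M1 (\<lambda>x. G1 x * indicator A (Y1 x))" "integrable M2 (\<lambda>x. G2 x * indicator A (Y2 x))" 
    if "A \<in> sets borel" for A
    using that by (intro int[OF G(1) Y(1), of _ 1] int[OF G(2) Y(2), of _ 1]; simp add: indicator_def)+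
  define P where "P A \<longleftrightarrow> (\<integral>x. G1 x * indicator A (Y1 x) \<partial>M1) = (\<integral>x. G2 x * indicator A (Y2 x) \<partial>M2)" for A
  have "P A" using Int_stable_cylinders cylinders_Pow A[unfolded borel_eq_cylinders]
  proof (induction rule: sigma_sets_induct_disjoint)
    case empty
    show ?case by (simp add: P_def)
  next
    case (basic A)
    then obtain xs where A: "A = cylinder xs" by blast
    obtain T B where T: "\<And>n. T n \<in> trig_poly UNIV" "\<And>n w. \<bar>T n w\<bar> \<le> B"
     "\<And>w. (\<lambda>n. T n w) \<longlonglongrightarrow> indicator (cylinder xs) w" using cylinder_trig_approx[of xs] by blast
    have lim: "(\<lambda>n. \<integral>x. G x * T n (Y x) \<partial>M) \<longlonglongrightarrow> (\<integral>x. G x * indicator A (Y x) \<partial>M)"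
      if G: "integrable M G" "Y \<in> borel_measurable M" for M :: "'c measure" and G :: "'c \<Rightarrow> real" and Y
    proof (rule integral_dominated_convergence[where w="\<lambda>x. \<bar>G x\<bar> * B"])
      show "(\<lambda>x. G x * indicator A (Y x)) \<in> borel_measurable M"
        using G(2) borel_measurable_integrable[OF G(1)] unfolding A by measurable
      show "(\<lambda>x. G x * T n (Y x)) \<in> borel_measurable M" for n
        using G(2) borel_measurable_integrable[OF G(1)] trig_poly_measurable[OF T(1)] by measurable
    qed (use G T in \<open>auto simp: A abs_mult intro!: mult_left_mono tendsto_mult AE_I2\<close>)
    show ?case unfolding P_def
      by (rule LIMSEQ_unique[OF lim[OF G(1) Y(1)]]) (simp add: trig[OF T(1)] lim[OF G(2) Y(2)])
  next
    case (compl A)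
    hence A: "A \<in> sets borel" by (simp add: borel_eq_cylinders)
    have *: "G * indicator (UNIV - A) y = G - G * indicator A y" for G :: real and y
      by (simp add: indicator_def)
    show ?case unfolding P_def * using intA[OF A] G tot compl.IH[unfolded P_def] by simp
  next
    case (union A)
    hence A: "A i \<in> sets borel" for i by (auto simp: borel_eq_cylinders)
    have lim: "(\<lambda>n. \<Sum>i<n. \<integral>x. G x * indicator (A i) (Y x) \<partial>M) \<longlonglongrightarrow> (\<integral>x. G x * indicator (\<Union>i. A i) (Y x) \<partial>M)"
      if G: "integrable M G" "Y \<in> borel_measurable M" for M :: "'c measure" and G :: "'c \<Rightarrow> real" and Y
    proof -
      note [measurable] = G(2) borel_measurable_integrable[OF G(1)] A
      have ind: "(\<Sum>i<n. indicator (A i) y) = (indicator (\<Union>i<n. A i) y :: real)" for n y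
        using union(1) by (intro indicator_UN_disjoint[symmetric]) (auto simp: disjoint_family_on_def)
      have i1: "integrable M (\<lambda>x. G x * indicator (A i) (Y x))" for i
        using int[OF G, of "indicator (A i)" 1] by (auto simp: indicator_def)
      have "(\<lambda>n. \<integral>x. G x * indicator (\<Union>i<n. A i) (Y x) \<partial>M) \<longlonglongrightarrow> (\<integral>x. G x * indicator (\<Union>i. A i) (Y x) \<partial>M)"
      proof (rule integral_dominated_convergence[where w="\<lambda>x. \<bar>G x\<bar>"])
        show "AE x in M. (\<lambda>n. G x * indicator (\<Union>i<n. A i) (Y x)) \<longlonglongrightarrow> G x * indicator (\<Union>i. A i) (Y x)"
          by (intro AE_I2 tendsto_mult tendsto_const LIMSEQ_indicator_UN)
      qed (use G in \<open>auto simp: indicator_def\<close>)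
      also have "(\<lambda>n. \<integral>x. G x * indicator (\<Union>i<n. A i) (Y x) \<partial>M) = (\<lambda>n. \<Sum>i<n. \<integral>x. G x * indicator (A i) (Y x) \<partial>M)"
      proof
        fix n
        have "(\<integral>x. G x * indicator (\<Union>i<n. A i) (Y x) \<partial>M) = (\<integral>x. (\<Sum>i<n. G x * indicator (A i) (Y x)) \<partial>M)"
          by (simp only: ind[symmetric] sum_distrib_left)
        also have "\<dots> = (\<Sum>i<n. \<integral>x. G x * indicator (A i) (Y x) \<partial>M)"
          by (intro Bochner_Integration.integral_sum i1)
        finally show "(\<integral>x. G x * indicator (\<Union>i<n. A i) (Y x) \<partial>M) = (\<Sum>i<n. \<integral>x. G x * indicator (A i) (Y x) \<partial>M)" .
      qed
      finally show ?thesis .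
    qed
    show ?case unfolding P_def
      by (rule LIMSEQ_unique[OF lim[OF G(1) Y(1)]]) (simp add: union(3)[unfolded P_def] lim[OF G(2) Y(2)])
  qed
  thus ?thesis by (simp add: P_def)
qed

text \<open>
  The sets whose indicators can be approximated form a Dynkin system containing the cylinders. The
  measure \<open>M\<close> is arbitrary, so that one approximation can be made good for several measures at once.
\<close>

lemma indicator_trig_approx:
  fixes M :: "'w::{real_normed_vector,second_countable_topology} measure"
  assumes "finite_measure M" and sets: "sets M = sets borel" and A: "A \<in> sets borel" and e: "e > 0"
  shows "\<exists>T\<in>trig_poly UNIV. (\<integral>w. (T w - indicator A w)\<^sup>2 \<partial>M) < e"
proof -
  interpret finite_measure M by fact
  have meas: "f \<in> borel_measurable M" if "f \<in> borel_measurable borel" for f :: "'w \<Rightarrow> real"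
    using that measurable_cong_sets[OF sets refl] by blast
  define bm where "bm F \<longleftrightarrow> F \<in> borel_measurable borel \<and> (\<exists>B. \<forall>w. \<bar>F w\<bar> \<le> B)" for F :: "'w \<Rightarrow> real"
  define apx where "apx F \<longleftrightarrow> (\<forall>e>0. \<exists>T\<in>trig_poly UNIV. (\<integral>w. (T w - F w)\<^sup>2 \<partial>M) < e)" for F
  have bmT: "bm T" if "T \<in> trig_poly UNIV" for T
    using that trig_poly_bounded trig_poly_measurable by (auto simp: bm_def)
  have bmI: "bm (indicator A)" if "A \<in> sets borel" for A
    using that by (auto simp: bm_def intro!: exI[of _ 1])
  have int: "integrable M (\<lambda>w. (F w - G w)\<^sup>2)" if FG: "bm F" "bm G" for F G
  proof -
    obtain A B where "F \<in> borel_measurable borel" "\<And>w. \<bar>F w\<bar> \<le> A" "G \<in> borel_measurable borel" "\<And>w. \<bar>G w\<bar> \<le> B"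
      using FG unfolding bm_def by blast
    note FG = this
    show ?thesis
    proof (rule integrable_const_bound[where B="(A + B)\<^sup>2"])
      have "\<bar>F w - G w\<bar> \<le> A + B" for w using FG(2,4)[of w] by linarith
      hence "(F w - G w)\<^sup>2 \<le> (A + B)\<^sup>2" for w by (rule power2_le_iff_abs_le[THEN iffD2, rotated])
        (use FG(2,4)[of w] in linarith)
      thus "AE w in M. norm ((F w - G w)\<^sup>2) \<le> (A + B)\<^sup>2" by simp
      show "(\<lambda>w. (F w - G w)\<^sup>2) \<in> borel_measurable M" using FG(1,3) by (intro meas) measurable
    qed
  qed
  have tri: "(\<integral>w. (F w + G w - (F' w + G' w))\<^sup>2 \<partial>M) \<le> 2 * (\<integral>w. (F w - F' w)\<^sup>2 \<partial>M) + 2 * (\<integral>w. (G w - G' w)\<^sup>2 \<partial>M)"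
    if "bm F" "bm G" "bm F'" "bm G'" for F G F' G'
  proof -
    have "(\<integral>w. (F w + G w - (F' w + G' w))\<^sup>2 \<partial>M) \<le> (\<integral>w. 2 * (F w - F' w)\<^sup>2 + 2 * (G w - G' w)\<^sup>2 \<partial>M)"
    proof (rule integral_mono_AE')
      show "integrable M (\<lambda>w. 2 * (F w - F' w)\<^sup>2 + 2 * (G w - G' w)\<^sup>2)" using that int by simp
      have *: "(a + b - (c + d))\<^sup>2 \<le> 2 * (a - c)\<^sup>2 + 2 * (b - d)\<^sup>2" for a b c d :: real
        using zero_le_power2[of "(a - c) - (b - d)"] by (simp add: power2_eq_square algebra_simps)
      show "AE w in M. (F w + G w - (F' w + G' w))\<^sup>2 \<le> 2 * (F w - F' w)\<^sup>2 + 2 * (G w - G' w)\<^sup>2"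
        using * by simp
    qed simp
    thus ?thesis using that int by simp
  qed
  have bm0: "bm (\<lambda>_. 0)" by (auto simp: bm_def)
  have apx_add: "apx (\<lambda>w. F w + G w)" if "bm F" "bm G" "apx F" "apx G" for F G
    unfolding apx_def
  proof (intro allI impI)
    fix e :: real assume "e > 0"
    hence "e / 4 > 0" by simp
    then obtain T U where TU: "T \<in> trig_poly UNIV" "(\<integral>w. (T w - F w)\<^sup>2 \<partial>M) < e / 4"
        "U \<in> trig_poly UNIV" "(\<integral>w. (U w - G w)\<^sup>2 \<partial>M) < e / 4"
      using \<open>apx F\<close> \<open>apx G\<close> unfolding apx_def by meson
    show "\<exists>T\<in>trig_poly UNIV. (\<integral>w. (T w - (F w + G w))\<^sup>2 \<partial>M) < e"
      using tri[OF bmT[OF TU(1)] bmT[OF TU(3)] that(1,2)] TU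
      by (intro bexI[of _ "\<lambda>w. T w + U w"] trig_add) auto
  qed
  have apx_lim: "apx F" if F: "\<And>n. apx (F' n)" "\<And>n. bm (F' n)" "bm F" "\<And>n w. \<bar>F' n w\<bar> \<le> B"
      "\<And>w. (\<lambda>n. F' n w) \<longlonglongrightarrow> F w" for F and F' :: "nat \<Rightarrow> _" and B
    unfolding apx_def
  proof (intro allI impI)
    fix e :: real assume e: "e > 0"
    have "(\<lambda>n. \<integral>w. (F' n w - F w)\<^sup>2 \<partial>M) \<longlonglongrightarrow> (\<integral>w. 0 \<partial>M)"
    proof (rule integral_dominated_convergence[where w="\<lambda>_. (B + B)\<^sup>2"])
      show "(\<lambda>w. (F' n w - F w)\<^sup>2) \<in> borel_measurable M" for n
        using F(2)[of n] F(3) unfolding bm_def by (intro meas borel_measurable_power borel_measurable_diff) auto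
      show "AE w in M. (\<lambda>n. (F' n w - F w)\<^sup>2) \<longlonglongrightarrow> 0"
      proof (rule AE_I2)
        fix w
        have "(\<lambda>n. (F' n w - F w)\<^sup>2) \<longlonglongrightarrow> (F w - F w)\<^sup>2" by (intro tendsto_intros F)
        thus "(\<lambda>n. (F' n w - F w)\<^sup>2) \<longlonglongrightarrow> 0" by simp
      qed
      have FB: "\<bar>F w\<bar> \<le> B" for w
        by (rule LIMSEQ_le_const2[OF tendsto_rabs[OF F(5)]]) (use F(4) in auto)
      show "AE w in M. norm ((F' n w - F w)\<^sup>2) \<le> (B + B)\<^sup>2" for n
      proof (rule AE_I2)
        fix w
        have "\<bar>F' n w - F w\<bar> \<le> B + B" using FB[of w] F(4)[of n w] by linarith
        hence "\<bar>F' n w - F w\<bar> ^ 2 \<le> (B + B) ^ 2" by (rule power_mono) simp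
        thus "norm ((F' n w - F w)\<^sup>2) \<le> (B + B)\<^sup>2" by simp
      qed
    qed simp_all
    hence "eventually (\<lambda>n. (\<integral>w. (F' n w - F w)\<^sup>2 \<partial>M) < e / 4) sequentially"
      by (rule order_tendstoD) (use e in simp)
    then obtain n where n: "(\<integral>w. (F' n w - F w)\<^sup>2 \<partial>M) < e / 4" by (auto simp: eventually_sequentially)
    obtain T where T: "T \<in> trig_poly UNIV" "(\<integral>w. (T w - F' n w)\<^sup>2 \<partial>M) < e / 4"
      using F(1)[of n] e unfolding apx_def by (meson divide_pos_pos zero_less_numeral)
    have "(\<integral>w. (T w + F' n w - (F' n w + F w))\<^sup>2 \<partial>M) < e"
      using tri[OF bmT[OF T(1)] F(2)[of n] F(2)[of n] F(3)] T(2) n by linarith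
    thus "\<exists>T\<in>trig_poly UNIV. (\<integral>w. (T w - F w)\<^sup>2 \<partial>M) < e"
      using T(1) by (intro bexI[of _ T]) (simp_all add: algebra_simps)
  qed
  have apxT: "apx T" if "T \<in> trig_poly UNIV" for T
    unfolding apx_def using that by (intro allI impI bexI[of _ T]) simp_all
  have "apx (indicator A)" using Int_stable_cylinders cylinders_Pow A[unfolded borel_eq_cylinders]
  proof (induction rule: sigma_sets_induct_disjoint)
    case empty
    show ?case using apxT[OF trig_poly_const[of UNIV 0]] by simp
  next
    case (basic A)
    then obtain xs where A: "A = cylinder xs" by blast
    obtain T B where T: "\<And>n. T n \<in> trig_poly UNIV" "\<And>n w. \<bar>T n w\<bar> \<le> B"
     "\<And>w. (\<lambda>n. T n w) \<longlonglongrightarrow> indicator (cylinder xs) w" using cylinder_trig_approx[of xs] by blast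
    show ?case unfolding A
      by (rule apx_lim[OF apxT[OF T(1)] bmT[OF T(1)] _ T(2) T(3)]) (intro bmI cylinder_in_borel)
  next
    case (compl A)
    have *: "(T w - indicator A w)\<^sup>2 = (1 - T w - indicator (UNIV - A) w)\<^sup>2" for T :: "'w \<Rightarrow> real" and w
      by (simp add: indicator_def power2_commute)
    show ?case unfolding apx_def
    proof (intro allI impI)
      fix e :: real assume "e > 0"
      then obtain T where T: "T \<in> trig_poly UNIV" "(\<integral>w. (T w - indicator A w)\<^sup>2 \<partial>M) < e"
        using compl.IH unfolding apx_def by blast
      thus "\<exists>T\<in>trig_poly UNIV. (\<integral>w. (T w - indicator (UNIV - A) w)\<^sup>2 \<partial>M) < e"
        unfolding * by (intro bexI[of _ "\<lambda>w. 1 - T w"] trig_poly_diff trig_poly_const) auto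
    qed
  next
    case (union A)
    hence A: "A i \<in> sets borel" for i by (auto simp: borel_eq_cylinders)
    have UN: "(\<Union>i<n. A i) \<in> sets borel" for n :: nat by (intro sets.finite_UN) (auto simp: A)
    have "apx (indicator (\<Union>i<n. A i))" for n :: nat
    proof (induction n)
      case 0
      show ?case using apxT[OF trig_poly_const[of UNIV 0]] by simp
    next
      case (Suc n)
      have "A i \<inter> A n = {}" if "i < n" for i using union(1) that by (simp add: disjoint_family_on_def)
      hence disj: "(\<Union>i<n. A i) \<inter> A n = {}" by blast
      have "indicator (\<Union>i<Suc n. A i) w = (indicator (\<Union>i<n. A i) w + indicator (A n) w :: real)" for w
        using disj by (auto simp: lessThan_Suc indicator_def)
      hence "indicator (\<Union>i<Suc n. A i) = (\<lambda>w. indicator (\<Union>i<n. A i) w + indicator (A n) w :: real)"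
        by (rule ext)
      thus ?case using apx_add[OF bmI[OF UN] bmI[OF A] Suc.IH union(3)] by simp
    qed
    thus ?case
    proof (rule apx_lim)
      have "(\<Union>i. A i) \<in> sets borel" by (intro sets.countable_UN) (use A in auto)
      thus "bm (indicator (\<Union>i. A i))" by (rule bmI)
      show "bm (indicator (\<Union>i<n. A i))" for n :: nat by (rule bmI[OF UN])
      show "\<bar>indicator (\<Union>i<n. A i) w :: real\<bar> \<le> 1" for n :: nat and w by (simp add: indicator_def)
      show "(\<lambda>n. indicator (\<Union>i<n. A i) w :: real) \<longlonglongrightarrow> indicator (\<Union>i. A i) w" for w
        by (rule LIMSEQ_indicator_UN)
    qed
  qed
  thus ?thesis using e unfolding apx_def by blast
qed

section \<open>Hermite polynomials\<close>

lemma real_powser_unique: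
  fixes a b :: "nat \<Rightarrow> real"
  assumes "\<And>t. (\<lambda>n. a n * t ^ n) sums f t" "\<And>t. (\<lambda>n. b n * t ^ n) sums f t"
  shows "a n = b n"
proof -
  define d where "d n = a n - b n" for n
  have d: "(\<lambda>n. d n * t ^ n) sums 0" for t
    using sums_diff[OF assms(1)[of t] assms(2)[of t]] by (simp add: d_def left_diff_distrib)
  have "d n = 0"
  proof (induction n rule: less_induct)
    case (less n)
    have "(\<lambda>k. d (k + n) * t ^ k) sums 0" if "t \<noteq> 0" for t
    proof -
      have "(\<lambda>k. d (k + n) * t ^ (k + n)) sums (0 - (\<Sum>k<n. d k * t ^ k))"
        using d[of t] by (subst sums_iff_shift) simp
      also have "(\<Sum>k<n. d k * t ^ k) = 0" using less by (intro sum.neutral) auto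
      finally have "(\<lambda>k. (d (k + n) * t ^ (k + n)) / t ^ n) sums ((0 - 0) / t ^ n)" by (rule sums_divide)
      thus ?thesis using that by (simp add: power_add)
    qed
    moreover have "(\<lambda>k. d (k + n) * t ^ k) sums d n" if "t = 0" for t
      using that powser_sums_zero[of "\<lambda>k. d (k + n)"] by simp
    ultimately have "(\<lambda>k. d (k + n) * t ^ k) sums (if t = 0 then d n else 0)" for t by auto
    from powser_limit_0[OF zero_less_one this] have "((\<lambda>t. if t = 0 then d n else 0) \<longlongrightarrow> d n) (at (0::real))"
      by simp
    moreover have "((\<lambda>t::real. if t = 0 then d n else 0) \<longlongrightarrow> 0) (at 0)"
      by (rule tendsto_eventually) (auto simp: eventually_at_filter)
    ultimately show ?case by (intro tendsto_unique[of "at (0::real)"]) auto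
  qed
  thus ?thesis by (simp add: d_def)
qed

text \<open>The coefficients of \<open>exp (- s t\<^sup>2 / 2)\<close> as a power series in \<open>t\<close>.\<close>

definition gauss_coeff :: "real \<Rightarrow> nat \<Rightarrow> real" where
  "gauss_coeff s j = (if even j then (- s / 2) ^ (j div 2) / fact (j div 2) else 0)"

text \<open>
  Both sides are coefficients of \<open>exp (t x - s t\<^sup>2 / 2)\<close>. For the convolution, multiplying by \<open>n\<close> acts like
  differentiation of a product and yields the recurrence that defines the Hermite polynomials.
\<close>

lemma hermite_eq_convolution:
  "hermite s n x / fact n = (\<Sum>j\<le>n. gauss_coeff s j * (x ^ (n - j) / fact (n - j)))"
proof -
  define e where "e m = x ^ m / fact m" for m
  define q where "q n = (\<Sum>j\<le>n. gauss_coeff s j * e (n - j))" for n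
  have e: "real (Suc m) * e (Suc m) = x * e m" for m by (simp add: e_def)
  have c: "real (Suc (Suc i)) * gauss_coeff s (Suc (Suc i)) = - s * gauss_coeff s i" for i
  proof (cases "even i")
    case True
    then obtain m where i: "i = 2 * m" by auto
    have alg: "2 * r * (a * (- s / 2) / (r * f)) = - s * (a / f)" if "r \<noteq> 0" for a r f :: real
      using that by simp
    have "gauss_coeff s (Suc (Suc i)) = (- s / 2) ^ m * (- s / 2) / (real (Suc m) * fact m)"
      by (simp add: i gauss_coeff_def)
    moreover have "real (Suc (Suc i)) = 2 * real (Suc m)" by (simp add: i)
    moreover have "gauss_coeff s i = (- s / 2) ^ m / fact m" by (simp add: i gauss_coeff_def)
    ultimately show ?thesis using alg[of "real (Suc m)" "(- s / 2) ^ m" "fact m"] by simp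
  qed (simp add: gauss_coeff_def)
  have rec: "real (Suc (Suc k)) * q (Suc (Suc k)) = x * q (Suc k) - s * q k" for k
  proof -
    let ?n = "Suc (Suc k)"
    have "real ?n * q ?n = (\<Sum>j\<le>?n. real j * gauss_coeff s j * e (?n - j))
        + (\<Sum>j\<le>?n. gauss_coeff s j * (real (?n - j) * e (?n - j)))"
      unfolding q_def sum_distrib_left sum.distrib[symmetric]
      by (intro sum.cong refl) (auto simp: of_nat_diff algebra_simps)
    also have "(\<Sum>j\<le>?n. real j * gauss_coeff s j * e (?n - j)) =
        (\<Sum>i\<le>k. (real (Suc (Suc i)) * gauss_coeff s (Suc (Suc i))) * e (k - i))"
      by (simp only: sum.atMost_Suc_shift) (simp add: gauss_coeff_def)
    also have "\<dots> = - s * q k" unfolding c q_def by (simp add: sum_distrib_left mult_ac)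
    also have "(\<Sum>j\<le>?n. gauss_coeff s j * (real (?n - j) * e (?n - j))) =
        (\<Sum>j\<le>Suc k. gauss_coeff s j * (real (?n - j) * e (?n - j)))"
      by (subst sum.atMost_Suc) simp
    also have "\<dots> = (\<Sum>j\<le>Suc k. gauss_coeff s j * (x * e (Suc k - j)))"
      by (intro sum.cong refl) (simp add: Suc_diff_le e del: of_nat_Suc)
    also have "\<dots> = x * q (Suc k)" unfolding q_def sum_distrib_left by (simp add: mult_ac)
    finally show ?thesis by simp
  qed
  have "hermite s n x / fact n = q n"
  proof (induction n rule: less_induct)
    case (less n)
    consider "n = 0" | "n = 1" | k where "n = Suc (Suc k)" by (metis One_nat_def not0_implies_Suc)
    thus ?case
    proof cases
      case (3 k)
      have IH: "hermite s (Suc k) x = fact (Suc k) * q (Suc k)" "hermite s k x = fact k * q k"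
        using less[of "Suc k"] less[of k] 3
        by (simp_all add: nonzero_divide_eq_eq mult.commute del: fact_Suc)
      have f: "fact (Suc (Suc k)) = real (Suc (Suc k)) * (real (Suc k) * fact k)" by simp
      have "hermite s n x = real (Suc k) * fact k * (x * q (Suc k) - s * q k)"
        unfolding 3 hermite.simps IH by (simp add: algebra_simps)
      also have "\<dots> = fact n * q n" unfolding rec[symmetric] 3 f by simp
      finally show ?thesis by simp
    qed (simp_all add: q_def e_def gauss_coeff_def)
  qed
  thus ?thesis by (simp add: q_def e_def)
qed

text \<open>
  The generating function at the imaginary argument \<open>\<i> t\<close>, multiplied by \<open>exp (\<i> \<theta>)\<close>, has these
  real parts. The second claim compares with the Cauchy product of the absolute values; it provides
  the majorant for integrating the series term by term.
\<close>

lemma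
  assumes s: "s \<ge> 0"
  shows hermite_series_sums: "(\<lambda>k. t ^ k * (cos (\<theta> + real k * pi / 2) * (hermite s k x / fact k))) sums
           (exp (t\<^sup>2 * s / 2) * cos (t * x + \<theta>))"
    and hermite_series_bound: "(\<Sum>k<N. \<bar>t\<bar> ^ k * (\<bar>hermite s k x\<bar> / fact k)) \<le> exp (t\<^sup>2 * s / 2) * exp (\<bar>t\<bar> * \<bar>x\<bar>)"
proof -
  define A where "A j = (if even j then (t\<^sup>2 * s / 2) ^ (j div 2) / fact (j div 2) else 0)" for j
  have A0: "A j \<ge> 0" for j using s by (simp add: A_def)
  have exps: "(\<lambda>j. z ^ j / fact j) sums exp z" for z :: real
    using exp_converges[of z] by (simp add: divide_inverse mult.commute)
  have A: "A sums exp (t\<^sup>2 * s / 2)"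
    using sums_if[OF sums_zero exps[of "t\<^sup>2 * s / 2"]] unfolding A_def by simp
  have sA: "summable (\<lambda>j. norm (A j))" using A A0 by (simp add: sums_iff)
  have coeff: "gauss_coeff s j * t ^ j = (if even j then (-1) ^ (j div 2) * A j else 0)" for j
  proof (cases "even j")
    case True
    then obtain m where j: "j = 2 * m" by auto
    have "(- s / 2) ^ m * (t\<^sup>2) ^ m = (-1) ^ m * (t\<^sup>2 * s / 2) ^ m"
      by (simp add: mult.commute flip: power_mult_distrib)
    thus ?thesis using j by (simp add: gauss_coeff_def A_def power_mult)
  qed (simp add: gauss_coeff_def)
  show "(\<Sum>k<N. \<bar>t\<bar> ^ k * (\<bar>hermite s k x\<bar> / fact k)) \<le> exp (t\<^sup>2 * s / 2) * exp (\<bar>t\<bar> * \<bar>x\<bar>)"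
  proof -
    define B where "B j = (\<bar>t\<bar> * \<bar>x\<bar>) ^ j / fact j" for j
    have B0: "B j \<ge> 0" for j by (simp add: B_def)
    have B: "B sums exp (\<bar>t\<bar> * \<bar>x\<bar>)" unfolding B_def by (rule exps)
    have sB: "summable (\<lambda>j. norm (B j))" using B B0 by (simp add: sums_iff)
    have "(\<Sum>k<N. \<bar>t\<bar> ^ k * (\<bar>hermite s k x\<bar> / fact k)) \<le> (\<Sum>k<N. \<Sum>i\<le>k. A i * B (k - i))"
    proof (rule sum_mono)
      fix k
      have "\<bar>t\<bar> ^ k * (\<bar>hermite s k x\<bar> / fact k) = \<bar>t ^ k * (hermite s k x / fact k)\<bar>"
        by (simp add: abs_mult power_abs)
      also have "\<dots> = \<bar>\<Sum>i\<le>k. (gauss_coeff s i * t ^ i) * ((t * x) ^ (k - i) / fact (k - i))\<bar>"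
        unfolding hermite_eq_convolution sum_distrib_left
        by (intro arg_cong[of _ _ abs] sum.cong refl)
           (auto simp: power_mult_distrib mult_ac simp flip: power_add)
      also have "\<dots> \<le> (\<Sum>i\<le>k. \<bar>(gauss_coeff s i * t ^ i) * ((t * x) ^ (k - i) / fact (k - i))\<bar>)"
        by (rule sum_abs)
      also have "\<dots> \<le> (\<Sum>i\<le>k. A i * B (k - i))"
        using A0 by (intro sum_mono) (auto simp: coeff B_def abs_mult power_abs power_mult_distrib)
      finally show "\<bar>t\<bar> ^ k * (\<bar>hermite s k x\<bar> / fact k) \<le> (\<Sum>i\<le>k. A i * B (k - i))" .
    qed
    also have "\<dots> \<le> (\<Sum>k. \<Sum>i\<le>k. A i * B (k - i))"
      using A0 B0 by (intro sum_le_suminf summable_Cauchy_product sA sB) (auto intro: sum_nonneg)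
    also have "\<dots> = exp (t\<^sup>2 * s / 2) * exp (\<bar>t\<bar> * \<bar>x\<bar>)"
      using sums_unique[OF Cauchy_product_sums[OF sA sB]] A B by (simp add: sums_iff)
    finally show ?thesis .
  qed
  define B where "B j = (\<i> * complex_of_real (t * x)) ^ j / fact j" for j
  have B: "B sums exp (\<i> * complex_of_real (t * x))"
    using exp_converges[of "\<i> * complex_of_real (t * x)"] unfolding B_def
    by (simp add: scaleR_conv_of_real divide_inverse mult.commute)
  have sB: "summable (\<lambda>j. norm (B j))"
    using summable_norm_exp[of "\<i> * complex_of_real (t * x)"] unfolding B_def
    by (simp add: scaleR_conv_of_real divide_inverse mult.commute)
  have cA: "(\<lambda>j. complex_of_real (A j)) sums of_real (exp (t\<^sup>2 * s / 2))" using A by (rule sums_of_real)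
  have scA: "summable (\<lambda>j. norm (complex_of_real (A j)))" using sA by simp
  have prod: "(\<lambda>k. \<Sum>i\<le>k. complex_of_real (A i) * B (k - i)) sums
      (of_real (exp (t\<^sup>2 * s / 2)) * exp (\<i> * complex_of_real (t * x)))"
    using Cauchy_product_sums[OF scA sB] cA B by (simp add: sums_iff)
  have cterm: "(\<Sum>i\<le>k. complex_of_real (A i) * B (k - i)) = \<i> ^ k * of_real (t ^ k * (hermite s k x / fact k))" for k
  proof -
    have Ai: "complex_of_real (A i) = \<i> ^ i * of_real (gauss_coeff s i * t ^ i)" for i
    proof (cases "even i")
      case True
      then obtain m where i: "i = 2 * m" by auto
      show ?thesis unfolding coeff by (simp add: i power_mult flip: power_mult_distrib)
    qed (simp add: gauss_coeff_def A_def)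
    have "(\<Sum>i\<le>k. complex_of_real (A i) * B (k - i)) = 
        (\<Sum>i\<le>k. \<i> ^ k * of_real (t ^ k * (gauss_coeff s i * (x ^ (k - i) / fact (k - i)))))"
    proof (intro sum.cong refl)
      fix i assume "i \<in> {..k}"
      hence k: "\<i> ^ k = \<i> ^ i * \<i> ^ (k - i)" "t ^ k = t ^ i * t ^ (k - i)"
        by (simp_all flip: power_add)
      show "complex_of_real (A i) * B (k - i) = \<i> ^ k * of_real (t ^ k * (gauss_coeff s i * (x ^ (k - i) / fact (k - i))))"
        unfolding Ai B_def k by (simp add: power_mult_distrib)
    qed
    also have "\<dots> = \<i> ^ k * of_real (t ^ k * (hermite s k x / fact k))"
      unfolding hermite_eq_convolution by (simp only: sum_distrib_left of_real_sum)
    finally show ?thesis .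
  qed
  have "(\<lambda>k. Re (exp (\<i> * complex_of_real \<theta>) * (\<i> ^ k * of_real (t ^ k * (hermite s k x / fact k))))) sums
      Re (exp (\<i> * complex_of_real \<theta>) * (of_real (exp (t\<^sup>2 * s / 2)) * exp (\<i> * complex_of_real (t * x))))"
    using prod unfolding cterm by (intro sums_Re sums_mult)
  moreover have "Re (exp (\<i> * complex_of_real \<theta>) * (\<i> ^ k * of_real (t ^ k * (hermite s k x / fact k)))) = 
      t ^ k * (cos (\<theta> + real k * pi / 2) * (hermite s k x / fact k))" for k
  proof -
    have "\<i> ^ k = cis (real k * (pi / 2))" using Complex.DeMoivre[of "pi/2" k] by simp
    hence "exp (\<i> * complex_of_real \<theta>) * \<i> ^ k = cis (\<theta> + real k * pi / 2)"
      by (simp add: cis_mult flip: cis_conv_exp)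
    moreover define r where "r = t ^ k * (hermite s k x / fact k)"
    ultimately have "exp (\<i> * complex_of_real \<theta>) * (\<i> ^ k * of_real r) = cis (\<theta> + real k * pi / 2) * of_real r"
      by (simp only: mult.assoc[symmetric])
    hence "Re (exp (\<i> * complex_of_real \<theta>) * (\<i> ^ k * of_real r)) = Re (cis (\<theta> + real k * pi / 2) * of_real r)"
      by (simp only:)
    also have "\<dots> = r * cos (\<theta> + real k * pi / 2)" by simp
    finally have "Re (exp (\<i> * complex_of_real \<theta>) * (\<i> ^ k * of_real r)) = r * cos (\<theta> + real k * pi / 2)" .
    thus ?thesis unfolding r_def by (simp only: mult_ac)
  qed
  moreover have "Re (exp (\<i> * complex_of_real \<theta>) * (of_real (exp (t\<^sup>2 * s / 2)) * exp (\<i> * complex_of_real (t * x)))) = 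
      exp (t\<^sup>2 * s / 2) * cos (t * x + \<theta>)"
  proof -
    have "exp (\<i> * complex_of_real \<theta>) * exp (\<i> * complex_of_real (t * x)) = cis (t * x + \<theta>)"
      by (simp only: cis_mult add.commute cis_conv_exp[symmetric])
    hence "exp (\<i> * complex_of_real \<theta>) * (of_real (exp (t\<^sup>2 * s / 2)) * exp (\<i> * complex_of_real (t * x))) = 
       of_real (exp (t\<^sup>2 * s / 2)) * cis (t * x + \<theta>)" by (subst mult.left_commute) (simp only:)
    hence "Re (exp (\<i> * complex_of_real \<theta>) * (of_real (exp (t\<^sup>2 * s / 2)) * exp (\<i> * complex_of_real (t * x)))) =
       Re (of_real (exp (t\<^sup>2 * s / 2)) * cis (t * x + \<theta>))" by (simp only:)
    thus ?thesis by simp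
  qed
  ultimately show "(\<lambda>k. t ^ k * (cos (\<theta> + real k * pi / 2) * (hermite s k x / fact k))) sums
           (exp (t\<^sup>2 * s / 2) * cos (t * x + \<theta>))" by simp
qed

section \<open>Functions with moments of all orders\<close>

text \<open>
  Unlike a single space \<open>L\<^sup>q\<close> this class is closed under products, and it contains trigonometric
  polynomials, Hermite polynomials and the exponential majorants of the Hermite series.
\<close>

definition all_moments :: "'a measure \<Rightarrow> ('a \<Rightarrow> real) \<Rightarrow> bool" where
  "all_moments M F \<longleftrightarrow> F \<in> borel_measurable M \<and> (\<forall>n. integrable M (\<lambda>x. \<bar>F x\<bar> ^ n))"

lemma all_momentsD:
  assumes "all_moments M F"
  shows "F \<in> borel_measurable M" "integrable M (\<lambda>x. \<bar>F x\<bar> ^ n)" "integrable M (\<lambda>x. F x ^ n)" "integrable M F"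
proof -
  show F: "F \<in> borel_measurable M" "integrable M (\<lambda>x. \<bar>F x\<bar> ^ n)" for n using assms by (auto simp: all_moments_def)
  show n: "integrable M (\<lambda>x. F x ^ n)" for n
    by (rule Bochner_Integration.integrable_bound[OF F(2)[of n]]) (use F(1) in \<open>auto simp: power_abs\<close>)
  show "integrable M F" using n[of 1] by simp
qed

lemma all_moments_bound:
  assumes "all_moments M G" "F \<in> borel_measurable M" "\<And>x. \<bar>F x\<bar> \<le> \<bar>G x\<bar>"
  shows "all_moments M F"
  unfolding all_moments_def
proof (intro conjI allI)
  show "integrable M (\<lambda>x. \<bar>F x\<bar> ^ n)" for n
    by (rule Bochner_Integration.integrable_bound[OF all_momentsD(2)[OF assms(1), of n]])
       (use assms in \<open>auto intro!: AE_I2 power_mono\<close>)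
qed fact

lemma all_moments_mult:
  assumes F: "all_moments M F" and G: "all_moments M G"
  shows "all_moments M (\<lambda>x. F x * G x)"
  unfolding all_moments_def
proof (intro conjI allI)
  note [measurable] = all_momentsD(1)[OF F] all_momentsD(1)[OF G]
  show "(\<lambda>x. F x * G x) \<in> borel_measurable M" by measurable
  fix n
  show "integrable M (\<lambda>x. \<bar>F x * G x\<bar> ^ n)"
  proof (rule Bochner_Integration.integrable_bound)
    show "integrable M (\<lambda>x. \<bar>F x\<bar> ^ (2 * n) + \<bar>G x\<bar> ^ (2 * n))" using F G by (intro Bochner_Integration.integrable_add all_momentsD)
    have "a * b \<le> a\<^sup>2 + b\<^sup>2" for a b :: real
      using zero_le_power2[of "a - b"] zero_le_power2[of a] zero_le_power2[of b] unfolding power2_diff by linarith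
    hence "\<bar>F x\<bar> ^ n * \<bar>G x\<bar> ^ n \<le> (\<bar>F x\<bar> ^ n)\<^sup>2 + (\<bar>G x\<bar> ^ n)\<^sup>2" for x .
    hence "\<bar>F x * G x\<bar> ^ n \<le> \<bar>F x\<bar> ^ (2 * n) + \<bar>G x\<bar> ^ (2 * n)" for x
      by (simp only: abs_mult power_mult_distrib power_mult power_commutes mult.commute[of 2 n])
    thus "AE x in M. norm (\<bar>F x * G x\<bar> ^ n) \<le> norm (\<bar>F x\<bar> ^ (2 * n) + \<bar>G x\<bar> ^ (2 * n))"
      by (intro AE_I2) simp
  qed measurable
qed

lemma (in finite_measure) all_moments_bounded:
  assumes "F \<in> borel_measurable M" "\<And>x. \<bar>F x\<bar> \<le> B"
  shows "all_moments M F"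
proof -
  have c: "all_moments M (\<lambda>_. B)" by (simp add: all_moments_def)
  have b: "\<bar>F x\<bar> \<le> \<bar>B\<bar>" for x using assms(2)[of x] by linarith
  show ?thesis by (rule all_moments_bound[OF c assms(1) b])
qed

lemma all_moments_add:
  assumes F: "all_moments M F" and G: "all_moments M G"
  shows "all_moments M (\<lambda>x. F x + G x)"
  unfolding all_moments_def
proof (intro conjI allI)
  note [measurable] = all_momentsD(1)[OF F] all_momentsD(1)[OF G]
  show "(\<lambda>x. F x + G x) \<in> borel_measurable M" by measurable
  fix n
  show "integrable M (\<lambda>x. \<bar>F x + G x\<bar> ^ n)"
  proof (rule Bochner_Integration.integrable_bound)
    show "integrable M (\<lambda>x. 2 ^ n * (\<bar>F x\<bar> ^ n + \<bar>G x\<bar> ^ n))"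
      using F G by (intro Bochner_Integration.integrable_add integrable_mult_right all_momentsD)
    have "\<bar>a + b\<bar> ^ n \<le> 2 ^ n * (\<bar>a\<bar> ^ n + \<bar>b\<bar> ^ n)" for a b :: real
    proof -
      have "\<bar>a + b\<bar> ^ n \<le> (2 * max \<bar>a\<bar> \<bar>b\<bar>) ^ n" by (intro power_mono) auto
      also have "\<dots> \<le> 2 ^ n * (\<bar>a\<bar> ^ n + \<bar>b\<bar> ^ n)" by (simp add: power_mult_distrib max_def)
      finally show ?thesis .
    qed
    thus "AE x in M. norm (\<bar>F x + G x\<bar> ^ n) \<le> norm (2 ^ n * (\<bar>F x\<bar> ^ n + \<bar>G x\<bar> ^ n))"
      by (intro AE_I2) simp
  qed measurable
qed

lemma all_moments_cmult: "all_moments M F \<Longrightarrow> all_moments M (\<lambda>x. c * F x)"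
  unfolding all_moments_def by (auto simp: abs_mult power_mult_distrib)

section \<open>Gaussian integrals on an abstract Wiener space\<close>

context abstract_wiener_space
begin

lemmas [measurable_cong] = sets_mu

lemma space_mu [simp]: "space \<mu> = UNIV"
  using sets_eq_imp_space_eq[OF sets_mu] by simp

lemma borel_mu: "f \<in> borel_measurable \<mu> \<longleftrightarrow> f \<in> borel_measurable borel"
  using measurable_cong_sets[OF sets_mu refl] by blast

definition rep :: "('w \<Rightarrow>\<^sub>L real) \<Rightarrow> 'h" where "rep \<phi> = dual_embed \<iota> \<phi>"

text \<open>
  The variance of \<open>\<phi>\<close> under \<open>\<mu>\<close>.
\<close>

definition gvar :: "('w \<Rightarrow>\<^sub>L real) \<Rightarrow> real" where "gvar \<phi> = (norm (rep \<phi>))\<^sup>2"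

lemma rep_apply: "blinfun_apply \<phi> (\<iota> h) = inner (rep \<phi>) h"
  unfolding rep_def by (rule dual_embed[OF bounded_linear_embedding])

lemma rep_eqI: "(\<And>h. blinfun_apply \<phi> (\<iota> h) = inner k h) \<Longrightarrow> rep \<phi> = k"
  by (metis rep_apply vector_eq_rdot)

lemma rep_linear: "rep (\<phi> + \<psi>) = rep \<phi> + rep \<psi>" "rep (\<phi> - \<psi>) = rep \<phi> - rep \<psi>" 
    "rep (c *\<^sub>R \<phi>) = c *\<^sub>R rep \<phi>" "rep 0 = 0"
  by (rule rep_eqI, simp only: blinfun.add_left blinfun.diff_left blinfun.scaleR_left blinfun.zero_left,
      simp add: rep_apply inner_simps)+

lemma gvar_nonneg [simp]: "gvar \<phi> \<ge> 0" by (simp add: gvar_def)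

lemma gvar_scaleR: "gvar (c *\<^sub>R \<phi>) = c\<^sup>2 * gvar \<phi>"
  by (simp add: gvar_def rep_linear power_mult_distrib)

lemma gvar_add: "gvar (\<phi> + \<psi>) = gvar \<phi> + gvar \<psi> + 2 * inner (rep \<phi>) (rep \<psi>)"
  and gvar_diff: "gvar (\<phi> - \<psi>) = gvar \<phi> + gvar \<psi> - 2 * inner (rep \<phi>) (rep \<psi>)"
  by (simp_all add: gvar_def rep_linear power2_norm_eq_inner inner_simps inner_commute)

lemma charf_mu: "(\<integral>w. iexp (blinfun_apply \<phi> w) \<partial>\<mu>) = of_real (exp (- gvar \<phi> / 2))"
  using characteristic_functional[of \<phi>] by (simp add: gvar_def rep_def)

lemma integrable_iexp: "integrable \<mu> (\<lambda>w. iexp (blinfun_apply \<phi> w))"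
  by (rule integrable_const_bound[where B=1]) auto

lemma integral_cos_mu: "(\<integral>w. cos (blinfun_apply \<phi> w + \<theta>) \<partial>\<mu>) = cos \<theta> * exp (- gvar \<phi> / 2)"
proof -
  have "(\<integral>w. cos (blinfun_apply \<phi> w + \<theta>) \<partial>\<mu>) = (\<integral>w. Re (cis \<theta> * iexp (blinfun_apply \<phi> w)) \<partial>\<mu>)"
    by (intro Bochner_Integration.integral_cong refl) (simp add: cis_mult add.commute flip: cis_conv_exp)
  also have "\<dots> = Re (cis \<theta> * (\<integral>w. iexp (blinfun_apply \<phi> w) \<partial>\<mu>))"
    using integrable_iexp by simp
  also have "\<dots> = cos \<theta> * exp (- gvar \<phi> / 2)" unfolding charf_mu by simp
  finally show ?thesis .
qed

text \<open>
  Written as an image of the standard normal law, the statement includes the degenerate case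
  \<open>rep \<phi> = 0\<close>.
\<close>

lemma distr_functional: "distr \<mu> borel (blinfun_apply \<phi>) = distr std_normal_distribution borel (\<lambda>x. norm (rep \<phi>) * x)"
proof (rule Levy_uniqueness)
  interpret N: real_distribution std_normal_distribution by (rule real_dist_normal_dist)
  show "real_distribution (distr \<mu> borel (blinfun_apply \<phi>))" by (rule real_distribution_distr) simp
  show "real_distribution (distr std_normal_distribution borel (\<lambda>x. norm (rep \<phi>) * x))"
    by (rule N.real_distribution_distr) simp
  show "char (distr \<mu> borel (blinfun_apply \<phi>)) = char (distr std_normal_distribution borel (\<lambda>x. norm (rep \<phi>) * x))"
  proof
    fix t
    have "char (distr \<mu> borel (blinfun_apply \<phi>)) t = (\<integral>w. iexp (blinfun_apply (t *\<^sub>R \<phi>) w) \<partial>\<mu>)"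
      unfolding char_def by (subst integral_distr) (auto simp: blinfun.scaleR_left)
    also have "\<dots> = of_real (exp (- (t * norm (rep \<phi>))\<^sup>2 / 2))"
      unfolding charf_mu gvar_scaleR by (simp add: gvar_def power_mult_distrib)
    also have "\<dots> = char std_normal_distribution (t * norm (rep \<phi>))"
      by (simp add: char_std_normal_distribution)
    also have "\<dots> = char (distr std_normal_distribution borel (\<lambda>x. norm (rep \<phi>) * x)) t"
      unfolding char_def by (subst integral_distr) (auto simp: mult_ac)
    finally show "char (distr \<mu> borel (blinfun_apply \<phi>)) t = char (distr std_normal_distribution borel (\<lambda>x. norm (rep \<phi>) * x)) t" .
  qed
qed

lemma integrable_exp_abs: "integrable \<mu> (\<lambda>w. exp (c * \<bar>blinfun_apply \<phi> w\<bar>))" for \<phi> :: "'w \<Rightarrow>\<^sub>L real"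
proof -
  define d where "d = \<bar>c\<bar> * norm (rep \<phi>)"
  have "integrable lborel (\<lambda>x. std_normal_density x * exp (d * \<bar>x\<bar>))"
  proof (rule Bochner_Integration.integrable_bound)
    show "integrable lborel (\<lambda>x. (sqrt 2 * exp (d\<^sup>2)) * normal_density 0 (sqrt 2) x)" by simp
    show "AE x in lborel. norm (std_normal_density x * exp (d * \<bar>x\<bar>)) \<le> norm ((sqrt 2 * exp (d\<^sup>2)) * normal_density 0 (sqrt 2) x)"
    proof (rule AE_I2)
      fix x :: real
      have "0 \<le> (d - \<bar>x\<bar> / 2)\<^sup>2" by simp
      hence "d * \<bar>x\<bar> - x\<^sup>2 / 2 \<le> d\<^sup>2 - x\<^sup>2 / 4" by (simp add: power2_diff power_divide)
      hence "exp (- x\<^sup>2 / 2) * exp (d * \<bar>x\<bar>) \<le> exp (d\<^sup>2) * exp (- x\<^sup>2 / 4)" by (simp flip: exp_add)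
      hence "(1 / sqrt (2 * pi)) * (exp (- x\<^sup>2 / 2) * exp (d * \<bar>x\<bar>)) \<le> (1 / sqrt (2 * pi)) * (exp (d\<^sup>2) * exp (- x\<^sup>2 / 4))"
        by (intro mult_left_mono) auto
      also have "\<dots> = (sqrt 2 * exp (d\<^sup>2)) * normal_density 0 (sqrt 2) x"
        by (simp add: normal_density_def real_sqrt_mult field_simps)
      finally show "norm (std_normal_density x * exp (d * \<bar>x\<bar>)) \<le> norm ((sqrt 2 * exp (d\<^sup>2)) * normal_density 0 (sqrt 2) x)"
        by (simp add: std_normal_density_def mult_ac)
    qed
  qed measurable
  hence "integrable std_normal_distribution (\<lambda>x. exp (d * \<bar>x\<bar>))"
    by (subst integrable_density) auto
  hence "integrable (distr std_normal_distribution borel (\<lambda>x. norm (rep \<phi>) * x)) (\<lambda>x. exp (\<bar>c\<bar> * \<bar>x\<bar>))"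
    by (subst integrable_distr_eq) (auto simp: d_def abs_mult mult_ac)
  hence "integrable \<mu> (\<lambda>w. exp (\<bar>c\<bar> * \<bar>blinfun_apply \<phi> w\<bar>))"
    unfolding distr_functional[symmetric] by (subst (asm) integrable_distr_eq) auto
  thus ?thesis
    by (rule Bochner_Integration.integrable_bound) (auto intro!: AE_I2 mult_right_mono)
qed

lemma all_moments_exp_abs: "all_moments \<mu> (\<lambda>w. exp (c * \<bar>blinfun_apply \<phi> w\<bar>))" for \<phi> :: "'w \<Rightarrow>\<^sub>L real"
  unfolding all_moments_def using integrable_exp_abs[of "real n * c" \<phi> for n]
  by (auto simp: mult_ac simp flip: exp_of_nat_mult)

lemma all_moments_functional: "all_moments \<mu> (blinfun_apply \<phi>)"
proof (rule all_moments_bound[OF all_moments_exp_abs[of 1 \<phi>]])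
  show "\<bar>blinfun_apply \<phi> w\<bar> \<le> \<bar>exp (1 * \<bar>blinfun_apply \<phi> w\<bar>)\<bar>" for w
    using exp_ge_add_one_self[of "\<bar>blinfun_apply \<phi> w\<bar>"] by (simp del: exp_ge_add_one_self)
qed simp

definition wiener_hermite :: "nat \<Rightarrow> ('w \<Rightarrow>\<^sub>L real) \<Rightarrow> 'w \<Rightarrow> real" where
  "wiener_hermite n \<phi> w = hermite (gvar \<phi>) n (blinfun_apply \<phi> w)"

lemma wiener_hermite_eq: "wiener_ito_power \<iota> n \<phi> = wiener_hermite n \<phi>"
  by (simp add: fun_eq_iff wiener_hermite_def wiener_ito_power_def gvar_def rep_def)

lemma all_moments_hermite: "all_moments \<mu> (wiener_hermite n \<phi>)"
proof -
  have "all_moments \<mu> (\<lambda>w. hermite s n (blinfun_apply \<phi> w))" for s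
  proof (induction n rule: less_induct)
    case (less n)
    consider "n = 0" | "n = 1" | k where "n = Suc (Suc k)" by (metis One_nat_def not0_implies_Suc)
    thus ?case
    proof cases
      case (3 k)
      have "all_moments \<mu> (\<lambda>w. blinfun_apply \<phi> w * hermite s (Suc k) (blinfun_apply \<phi> w)
          + (- (real (Suc k) * s)) * hermite s k (blinfun_apply \<phi> w))"
        using 3 by (intro all_moments_add all_moments_mult all_moments_cmult all_moments_functional less) auto
      thus ?thesis unfolding 3 hermite.simps by simp
    next
      case 1
      thus ?thesis by (simp add: all_moments_bounded[where B=1])
    next
      case 2
      thus ?thesis using all_moments_functional by simp
    qed
  qed
  thus ?thesis unfolding wiener_hermite_def .
qed

definition sq_integrable :: "('w \<Rightarrow> real) \<Rightarrow> bool" where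
  "sq_integrable u \<longleftrightarrow> u \<in> borel_measurable \<mu> \<and> integrable \<mu> (\<lambda>w. (u w)\<^sup>2)"

lemma Lp_2_iff: "u \<in> Lp \<mu> 2 \<longleftrightarrow> sq_integrable u"
  by (simp add: Lp_def sq_integrable_def)

lemma all_moments_sq: "all_moments \<mu> u \<Longrightarrow> sq_integrable u"
  by (auto simp: sq_integrable_def dest: all_momentsD)

lemma sq_integrable_mult:
  assumes "sq_integrable u" "sq_integrable v"
  shows "integrable \<mu> (\<lambda>w. u w * v w)"
proof (rule Bochner_Integration.integrable_bound)
  show "integrable \<mu> (\<lambda>w. (u w)\<^sup>2 + (v w)\<^sup>2)" using assms by (simp add: sq_integrable_def)
  have "\<bar>a * b\<bar> \<le> a\<^sup>2 + b\<^sup>2" for a b :: real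
  proof -
    have "2 * (\<bar>a\<bar> * \<bar>b\<bar>) \<le> a\<^sup>2 + b\<^sup>2" using zero_le_power2[of "\<bar>a\<bar> - \<bar>b\<bar>"] by (simp add: power2_diff)
    moreover have "0 \<le> \<bar>a\<bar> * \<bar>b\<bar>" by simp
    ultimately show ?thesis unfolding abs_mult by linarith
  qed
  thus "AE w in \<mu>. norm (u w * v w) \<le> norm ((u w)\<^sup>2 + (v w)\<^sup>2)" by simp
  show "(\<lambda>w. u w * v w) \<in> borel_measurable \<mu>" using assms by (auto simp: sq_integrable_def)
qed

text \<open>
  The Hermite series is dominated by an exponential of \<open>\<bar>\<phi>\<bar>\<close>, which is square integrable.
\<close>

lemma hermite_series_integral:
  assumes u: "sq_integrable u"
  shows "(\<lambda>k. t ^ k * (cos (\<theta> + real k * pi / 2) * ((\<integral>w. u w * wiener_hermite k \<phi> w \<partial>\<mu>) / fact k))) sums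
     (exp (t\<^sup>2 * gvar \<phi> / 2) * (\<integral>w. u w * cos (t * blinfun_apply \<phi> w + \<theta>) \<partial>\<mu>))"
proof -
  define c where "c k = t ^ k * (cos (\<theta> + real k * pi / 2) / fact k)" for k
  define E where "E = exp (t\<^sup>2 * gvar \<phi> / 2)"
  have [measurable]: "u \<in> borel_measurable \<mu>" "wiener_hermite k \<phi> \<in> borel_measurable \<mu>" for k
    using u all_momentsD(1)[OF all_moments_hermite] by (auto simp: sq_integrable_def)
  have i: "integrable \<mu> (\<lambda>w. u w * wiener_hermite k \<phi> w)" for k
    by (intro sq_integrable_mult u all_moments_sq all_moments_hermite)
  have "(\<lambda>N. \<integral>w. u w * (\<Sum>k<N. c k * wiener_hermite k \<phi> w) \<partial>\<mu>) \<longlonglongrightarrow>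
      (\<integral>w. u w * (E * cos (t * blinfun_apply \<phi> w + \<theta>)) \<partial>\<mu>)"
  proof (rule integral_dominated_convergence[where w="\<lambda>w. \<bar>u w\<bar> * (E * exp (\<bar>t\<bar> * \<bar>blinfun_apply \<phi> w\<bar>))"])
    have "integrable \<mu> (\<lambda>w. u w * (E * exp (\<bar>t\<bar> * \<bar>blinfun_apply \<phi> w\<bar>)))"
      by (intro sq_integrable_mult u all_moments_sq all_moments_cmult all_moments_exp_abs)
    from integrable_abs[OF this] show "integrable \<mu> (\<lambda>w. \<bar>u w\<bar> * (E * exp (\<bar>t\<bar> * \<bar>blinfun_apply \<phi> w\<bar>)))"
      by (simp add: abs_mult E_def)
    show "AE w in \<mu>. (\<lambda>N. u w * (\<Sum>k<N. c k * wiener_hermite k \<phi> w)) \<longlonglongrightarrow> u w * (E * cos (t * blinfun_apply \<phi> w + \<theta>))"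
    proof (intro AE_I2 tendsto_mult tendsto_const)
      fix w
      show "(\<lambda>N. \<Sum>k<N. c k * wiener_hermite k \<phi> w) \<longlonglongrightarrow> E * cos (t * blinfun_apply \<phi> w + \<theta>)"
        using hermite_series_sums[OF gvar_nonneg, of t \<theta> \<phi> "blinfun_apply \<phi> w"]
        unfolding sums_def c_def E_def wiener_hermite_def by (simp add: mult_ac)
    qed
    show "AE w in \<mu>. norm (u w * (\<Sum>k<N. c k * wiener_hermite k \<phi> w)) \<le> \<bar>u w\<bar> * (E * exp (\<bar>t\<bar> * \<bar>blinfun_apply \<phi> w\<bar>))" for N
    proof (rule AE_I2)
      fix w
      have "\<bar>\<Sum>k<N. c k * wiener_hermite k \<phi> w\<bar> \<le> (\<Sum>k<N. \<bar>t\<bar> ^ k * (\<bar>hermite (gvar \<phi>) k (blinfun_apply \<phi> w)\<bar> / fact k))"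
      proof (rule order_trans[OF sum_abs sum_mono])
        fix k
        have "\<bar>c k * wiener_hermite k \<phi> w\<bar> = \<bar>cos (\<theta> + real k * pi / 2)\<bar> * (\<bar>t\<bar> ^ k * (\<bar>hermite (gvar \<phi>) k (blinfun_apply \<phi> w)\<bar> / fact k))"
          by (simp add: c_def wiener_hermite_def abs_mult power_abs)
        also have "\<dots> \<le> 1 * (\<bar>t\<bar> ^ k * (\<bar>hermite (gvar \<phi>) k (blinfun_apply \<phi> w)\<bar> / fact k))"
          by (intro mult_right_mono) auto
        finally show "\<bar>c k * wiener_hermite k \<phi> w\<bar> \<le> \<bar>t\<bar> ^ k * (\<bar>hermite (gvar \<phi>) k (blinfun_apply \<phi> w)\<bar> / fact k)" by simp
      qed
      also have "\<dots> \<le> E * exp (\<bar>t\<bar> * \<bar>blinfun_apply \<phi> w\<bar>)"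
        unfolding E_def by (rule hermite_series_bound[OF gvar_nonneg])
      finally show "norm (u w * (\<Sum>k<N. c k * wiener_hermite k \<phi> w)) \<le> \<bar>u w\<bar> * (E * exp (\<bar>t\<bar> * \<bar>blinfun_apply \<phi> w\<bar>))"
        by (simp add: abs_mult mult_left_mono)
    qed
  qed measurable
  also have "(\<lambda>N. \<integral>w. u w * (\<Sum>k<N. c k * wiener_hermite k \<phi> w) \<partial>\<mu>) = (\<lambda>N. \<Sum>k<N. c k * (\<integral>w. u w * wiener_hermite k \<phi> w \<partial>\<mu>))"
  proof
    fix N
    have "(\<integral>w. u w * (\<Sum>k<N. c k * wiener_hermite k \<phi> w) \<partial>\<mu>) = (\<integral>w. (\<Sum>k<N. c k * (u w * wiener_hermite k \<phi> w)) \<partial>\<mu>)"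
      by (simp add: sum_distrib_left mult_ac)
    thus "(\<integral>w. u w * (\<Sum>k<N. c k * wiener_hermite k \<phi> w) \<partial>\<mu>) = (\<Sum>k<N. c k * (\<integral>w. u w * wiener_hermite k \<phi> w \<partial>\<mu>))"
      using i by (simp add: Bochner_Integration.integral_sum)
  qed
  also have "(\<integral>w. u w * (E * cos (t * blinfun_apply \<phi> w + \<theta>)) \<partial>\<mu>) = E * (\<integral>w. u w * cos (t * blinfun_apply \<phi> w + \<theta>) \<partial>\<mu>)"
    by (simp add: mult.left_commute)
  finally show ?thesis unfolding sums_def c_def E_def by (simp add: mult_ac)
qed

lemma integral_cos_cos:
  "(\<integral>w. cos (blinfun_apply \<psi> w + \<eta>) * cos (t * blinfun_apply \<phi> w + \<theta>) \<partial>\<mu>) =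
    exp (- (gvar \<psi> + t\<^sup>2 * gvar \<phi>) / 2) *
    (cos (\<eta> - \<theta>) * exp (t * inner (rep \<phi>) (rep \<psi>)) + cos (\<eta> + \<theta>) * exp (- t * inner (rep \<phi>) (rep \<psi>))) / 2"
proof -
  have "cos (blinfun_apply \<psi> w + \<eta>) * cos (t * blinfun_apply \<phi> w + \<theta>) =
      (cos (blinfun_apply (\<psi> - t *\<^sub>R \<phi>) w + (\<eta> - \<theta>)) + cos (blinfun_apply (\<psi> + t *\<^sub>R \<phi>) w + (\<eta> + \<theta>))) / 2" for w
    unfolding cos_times_cos by (simp add: blinfun.add_left blinfun.diff_left blinfun.scaleR_left algebra_simps)
  moreover have "integrable \<mu> (\<lambda>w. cos (blinfun_apply \<phi> w + \<theta>))" for \<phi> :: "'w \<Rightarrow>\<^sub>L real" and \<theta>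
    by (rule integrable_const_bound[where B=1]) auto
  ultimately have "(\<integral>w. cos (blinfun_apply \<psi> w + \<eta>) * cos (t * blinfun_apply \<phi> w + \<theta>) \<partial>\<mu>) =
     ((\<integral>w. cos (blinfun_apply (\<psi> - t *\<^sub>R \<phi>) w + (\<eta> - \<theta>)) \<partial>\<mu>) + (\<integral>w. cos (blinfun_apply (\<psi> + t *\<^sub>R \<phi>) w + (\<eta> + \<theta>)) \<partial>\<mu>)) / 2"
    by (simp only: integral_divide_zero Bochner_Integration.integral_add)
  hence "(\<integral>w. cos (blinfun_apply \<psi> w + \<eta>) * cos (t * blinfun_apply \<phi> w + \<theta>) \<partial>\<mu>) =
     (cos (\<eta> - \<theta>) * exp (- gvar (\<psi> - t *\<^sub>R \<phi>) / 2) + cos (\<eta> + \<theta>) * exp (- gvar (\<psi> + t *\<^sub>R \<phi>) / 2)) / 2"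
    by (simp only: integral_cos_mu)
  moreover have "- gvar (\<psi> - t *\<^sub>R \<phi>) / 2 = - (gvar \<psi> + t\<^sup>2 * gvar \<phi>) / 2 + t * inner (rep \<phi>) (rep \<psi>)"
    and "- gvar (\<psi> + t *\<^sub>R \<phi>) / 2 = - (gvar \<psi> + t\<^sup>2 * gvar \<phi>) / 2 + - t * inner (rep \<phi>) (rep \<psi>)"
    unfolding gvar_diff gvar_add gvar_scaleR rep_linear by (simp_all add: inner_commute field_simps)
  ultimately show ?thesis by (simp only: exp_add) (simp add: algebra_simps)
qed

text \<open>
  The integral of \<open>cos (\<psi> + \<eta>) cos (t \<phi> + \<theta>)\<close> is explicit, and by the Hermite series it is a power
  series in \<open>t\<close> whose coefficients contain the integrals in question.
\<close>

lemma integral_hermite_cos: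
  "(\<integral>w. wiener_hermite k \<phi> w * cos (blinfun_apply \<psi> w + \<eta>) \<partial>\<mu>) =
     exp (- gvar \<psi> / 2) * inner (rep \<phi>) (rep \<psi>) ^ k * cos (\<eta> + real k * pi / 2)"
proof -
  \<comment> \<open>This phase makes the cosine factor of the \<open>k\<close>-th coefficient equal to 1.\<close>
  define \<theta> where "\<theta> = - real k * pi / 2"
  define z where "z = inner (rep \<phi>) (rep \<psi>)"
  define a where "a n = cos (\<theta> + real n * pi / 2) * ((\<integral>w. cos (blinfun_apply \<psi> w + \<eta>) * wiener_hermite n \<phi> w \<partial>\<mu>) / fact n)" for n
  define b where "b n = exp (- gvar \<psi> / 2) * (z ^ n / fact n) * (cos (\<eta> - \<theta>) + (-1) ^ n * cos (\<eta> + \<theta>)) / 2" for n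
  define f where "f t = exp (- gvar \<psi> / 2) * (cos (\<eta> - \<theta>) * exp (t * z) + cos (\<eta> + \<theta>) * exp (- t * z)) / 2" for t
  have "all_moments \<mu> (\<lambda>w. cos (blinfun_apply \<psi> w + \<eta>))" by (rule all_moments_bounded[where B=1]) auto
  note ser = hermite_series_integral[OF all_moments_sq[OF this], of _ \<theta> \<phi>]
  have "(\<lambda>n. a n * t ^ n) sums f t" for t
  proof -
    have "exp (t\<^sup>2 * gvar \<phi> / 2) * (\<integral>w. cos (blinfun_apply \<psi> w + \<eta>) * cos (t * blinfun_apply \<phi> w + \<theta>) \<partial>\<mu>) = f t"
      unfolding integral_cos_cos f_def z_def by (simp add: field_simps exp_minus flip: exp_add)
    with ser[of t] show ?thesis unfolding a_def by (simp add: mult_ac)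
  qed
  moreover have "(\<lambda>n. b n * t ^ n) sums f t" for t
  proof -
    have e: "(\<lambda>n. y ^ n / fact n) sums exp y" for y :: real
      using exp_converges[of y] by (simp add: divide_inverse mult.commute)
    have "(\<lambda>n. exp (- gvar \<psi> / 2) * (cos (\<eta> - \<theta>) * ((t * z) ^ n / fact n) + cos (\<eta> + \<theta>) * ((- t * z) ^ n / fact n)) / 2) sums f t"
      unfolding f_def by (intro sums_divide sums_mult sums_add e)
    also have "(\<lambda>n. exp (- gvar \<psi> / 2) * (cos (\<eta> - \<theta>) * ((t * z) ^ n / fact n) + cos (\<eta> + \<theta>) * ((- t * z) ^ n / fact n)) / 2) = (\<lambda>n. b n * t ^ n)"
    proof
      fix n
      have "(- t * z) ^ n = (-1) ^ n * (t ^ n * z ^ n)" by (simp flip: power_mult_distrib)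
      thus "exp (- gvar \<psi> / 2) * (cos (\<eta> - \<theta>) * ((t * z) ^ n / fact n) + cos (\<eta> + \<theta>) * ((- t * z) ^ n / fact n)) / 2 = b n * t ^ n"
        unfolding b_def by (simp add: power_mult_distrib field_simps)
    qed
    finally show ?thesis .
  qed
  ultimately have "a k = b k" by (rule real_powser_unique)
  moreover have "\<eta> + \<theta> = (\<eta> - \<theta>) - real k * pi" by (simp add: \<theta>_def field_simps)
  hence "cos (\<eta> + \<theta>) = (-1) ^ k * cos (\<eta> - \<theta>)" by (simp only: cos_diff cos_npi sin_npi) simp
  hence "b k = exp (- gvar \<psi> / 2) * (z ^ k / fact k) * cos (\<eta> - \<theta>)"
    unfolding b_def by (simp flip: power_add mult_2_right)
  ultimately show ?thesis unfolding a_def by (simp add: z_def \<theta>_def mult_ac)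
qed

text \<open>
  By the preceding formula, the Hermite polynomial of order \<open>k\<close> integrated against
  \<open>exp (t\<^sup>2 gvar \<psi> / 2) cos (t \<psi> + \<theta>)\<close> is a monomial of degree \<open>k\<close> in \<open>t\<close>. The integral in question is
  its coefficient of order \<open>n\<close>, up to a factor.
\<close>

lemma hermite_orthogonal:
  assumes "k \<noteq> n"
  shows "(\<integral>w. wiener_hermite k \<phi> w * wiener_hermite n \<psi> w \<partial>\<mu>) = 0"
proof -
  \<comment> \<open>This phase makes the cosine factor of the \<open>n\<close>-th coefficient equal to 1.\<close>
  define \<theta> where "\<theta> = - real n * pi / 2"
  define z where "z = inner (rep \<phi>) (rep \<psi>)"
  define a where "a m = cos (\<theta> + real m * pi / 2) * ((\<integral>w. wiener_hermite k \<phi> w * wiener_hermite m \<psi> w \<partial>\<mu>) / fact m)" for m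
  define b where "b m = (if m = k then z ^ k * cos (\<theta> + real k * pi / 2) else 0)" for m
  define f where "f t = z ^ k * t ^ k * cos (\<theta> + real k * pi / 2)" for t
  have "(\<lambda>m. a m * t ^ m) sums f t" for t
  proof -
    have "exp (t\<^sup>2 * gvar \<psi> / 2) * (\<integral>w. wiener_hermite k \<phi> w * cos (t * blinfun_apply \<psi> w + \<theta>) \<partial>\<mu>) = f t"
      using integral_hermite_cos[of k \<phi> "t *\<^sub>R \<psi>" \<theta>]
      by (simp add: blinfun.scaleR_left f_def gvar_scaleR rep_linear z_def power_mult_distrib exp_minus)
    with hermite_series_integral[OF all_moments_sq[OF all_moments_hermite[of k \<phi>]], of t \<theta> \<psi>] show ?thesis
      unfolding a_def by (simp add: mult_ac)
  qed
  moreover have "(\<lambda>m. b m * t ^ m) sums f t" for t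
  proof -
    have "(\<lambda>m. b m * t ^ m) = (\<lambda>m. if m = k then z ^ k * cos (\<theta> + real k * pi / 2) * t ^ m else 0)"
      by (auto simp: b_def fun_eq_iff)
    thus ?thesis
      using sums_single[of k "\<lambda>m. z ^ k * cos (\<theta> + real k * pi / 2) * t ^ m"] by (simp add: f_def mult_ac)
  qed
  ultimately have "a n = b n" by (rule real_powser_unique)
  thus ?thesis using assms by (simp add: a_def b_def \<theta>_def)
qed

end

section \<open>Duality between \<open>L\<^sup>p\<close> and functions with moments\<close>

text \<open>
  Young's inequality without constants, by comparing \<open>\<bar>b\<bar>\<close> with \<open>\<bar>a\<bar>\<close> raised to \<open>p - 1\<close>. An even integer
  \<open>2 m\<close> takes the place of the conjugate exponent so that powers of trigonometric polynomials remain
  trigonometric polynomials.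
\<close>

lemma young_powr:
  fixes a b p :: real
  assumes p: "p > 1" and m: "p / (p - 1) \<le> real (2 * m)"
  shows "\<bar>a * b\<bar> \<le> \<bar>a\<bar> powr p + 1 + b ^ (2 * m)"
proof -
  have b0: "0 \<le> b ^ (2 * m)" by simp
  show ?thesis
  proof (cases "\<bar>b\<bar> \<le> \<bar>a\<bar> powr (p - 1)")
    case True
    hence "\<bar>a * b\<bar> \<le> \<bar>a\<bar> * \<bar>a\<bar> powr (p - 1)" by (simp add: abs_mult mult_left_mono)
    also have "\<dots> = \<bar>a\<bar> powr p" by (cases "a = 0") (simp_all add: powr_diff)
    finally show ?thesis using b0 by linarith
  next
    case False
    hence b: "\<bar>b\<bar> > 0" by (metis abs_ge_zero less_eq_real_def linorder_not_le powr_ge_zero order_trans)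
    have "\<bar>a\<bar> = (\<bar>a\<bar> powr (p - 1)) powr (1 / (p - 1))" using p by (simp add: powr_powr)
    also have "\<dots> \<le> \<bar>b\<bar> powr (1 / (p - 1))" using False p by (intro powr_mono2) auto
    finally have "\<bar>a * b\<bar> \<le> \<bar>b\<bar> powr (1 / (p - 1)) * \<bar>b\<bar>" by (simp add: abs_mult mult_right_mono)
    also have "\<dots> = \<bar>b\<bar> powr (1 / (p - 1) + 1)" using b by (simp add: powr_add)
    also have "1 / (p - 1) + 1 = p / (p - 1)" using p by (simp add: field_simps)
    also have "\<bar>b\<bar> powr (p / (p - 1)) \<le> 1 + b ^ (2 * m)"
    proof (cases "\<bar>b\<bar> \<le> 1")
      case True
      hence "\<bar>b\<bar> powr (p / (p - 1)) \<le> 1" using p by (intro powr_le1) auto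
      thus ?thesis using b0 by linarith
    next
      case False
      hence "\<bar>b\<bar> powr (p / (p - 1)) \<le> \<bar>b\<bar> powr real (2 * m)" using m by (intro powr_mono) auto
      also have "\<dots> = \<bar>b\<bar> ^ (2 * m)" using b by (rule powr_realpow)
      also have "\<dots> = b ^ (2 * m)" by (simp add: power_even_abs)
      finally show ?thesis by simp
    qed
    finally have "\<bar>a * b\<bar> \<le> 1 + b ^ (2 * m)" .
    moreover have "0 \<le> \<bar>a\<bar> powr p" by simp
    ultimately show ?thesis by linarith
  qed
qed

lemma Lp_mult_integrable:
  assumes M: "finite_measure M" and p: "p > 1" "p / (p - 1) \<le> real (2 * m)"
    and f: "f \<in> Lp M p" and Y: "Y \<in> borel_measurable M" "integrable M (\<lambda>x. Y x ^ (2 * m))"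
  shows "integrable M (\<lambda>x. f x * Y x)"
    and "(\<integral>x. \<bar>f x * Y x\<bar> \<partial>M) \<le> (\<integral>x. \<bar>f x\<bar> powr p \<partial>M) + measure M (space M) + (\<integral>x. Y x ^ (2 * m) \<partial>M)"
proof -
  interpret finite_measure M by fact
  have f': "f \<in> borel_measurable M" "integrable M (\<lambda>x. \<bar>f x\<bar> powr p)" using f by (auto simp: Lp_def)
  have g: "integrable M (\<lambda>x. \<bar>f x\<bar> powr p + 1 + Y x ^ (2 * m))" using f' Y by simp
  show i: "integrable M (\<lambda>x. f x * Y x)"
  proof (rule Bochner_Integration.integrable_bound[OF g])
    show "AE x in M. norm (f x * Y x) \<le> norm (\<bar>f x\<bar> powr p + 1 + Y x ^ (2 * m))"
      using young_powr[OF p] by (intro AE_I2) (simp add: order_trans[OF _ abs_ge_self])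
  qed (use f' Y in measurable)
  have "(\<integral>x. \<bar>f x * Y x\<bar> \<partial>M) \<le> (\<integral>x. \<bar>f x\<bar> powr p + 1 + Y x ^ (2 * m) \<partial>M)"
    using young_powr[OF p] by (intro integral_mono g integrable_abs i) auto
  also have "\<dots> = (\<integral>x. \<bar>f x\<bar> powr p \<partial>M) + measure M (space M) + (\<integral>x. Y x ^ (2 * m) \<partial>M)"
    using f' Y by simp
  finally show "(\<integral>x. \<bar>f x * Y x\<bar> \<partial>M) \<le> (\<integral>x. \<bar>f x\<bar> powr p \<partial>M) + measure M (space M) + (\<integral>x. Y x ^ (2 * m) \<partial>M)" .
qed

lemma Lp_cmult: "f \<in> Lp M p \<Longrightarrow> (\<lambda>x. c * f x) \<in> Lp M p"
  by (auto simp: Lp_def abs_mult powr_mult)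

lemma Lp_diff:
  assumes "f \<in> Lp M p" "g \<in> Lp M p" "p \<ge> 0"
  shows "(\<lambda>x. f x - g x) \<in> Lp M p"
proof -
  have [measurable]: "f \<in> borel_measurable M" "g \<in> borel_measurable M" using assms by (auto simp: Lp_def)
  have "integrable M (\<lambda>x. \<bar>f x - g x\<bar> powr p)"
  proof (rule Bochner_Integration.integrable_bound)
    show "integrable M (\<lambda>x. 2 powr p * (\<bar>f x\<bar> powr p + \<bar>g x\<bar> powr p))" using assms by (auto simp: Lp_def)
    have "\<bar>a - b\<bar> powr p \<le> 2 powr p * (\<bar>a\<bar> powr p + \<bar>b\<bar> powr p)" for a b :: real
    proof -
      have "\<bar>a - b\<bar> powr p \<le> (2 * max \<bar>a\<bar> \<bar>b\<bar>) powr p" using assms(3) by (intro powr_mono2) auto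
      also have "\<dots> = 2 powr p * max \<bar>a\<bar> \<bar>b\<bar> powr p" by (simp add: powr_mult)
      also have "\<dots> \<le> 2 powr p * (\<bar>a\<bar> powr p + \<bar>b\<bar> powr p)" by (intro mult_left_mono) (auto simp: max_def)
      finally show ?thesis .
    qed
    thus "AE x in M. norm (\<bar>f x - g x\<bar> powr p) \<le> norm (2 powr p * (\<bar>f x\<bar> powr p + \<bar>g x\<bar> powr p))"
      by (intro AE_I2) simp
  qed measurable
  thus ?thesis by (simp add: Lp_def)
qed

text \<open>
  Hoelder's inequality is replaced by Young's inequality with a free scale \<open>\<eta>\<close>: first \<open>k\<close> tends to
  infinity, then \<open>\<eta>\<close> to zero.
\<close>

lemma Lp_converges_integral:
  assumes M: "finite_measure M" and p: "p > 1" "p / (p - 1) \<le> real (2 * m)"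
    and u: "Lp_converges M p u f" and Y: "Y \<in> borel_measurable M" "integrable M (\<lambda>x. Y x ^ (2 * m))"
  shows "(\<lambda>k. \<integral>x. u k x * Y x \<partial>M) \<longlonglongrightarrow> (\<integral>x. f x * Y x \<partial>M)"
proof -
  interpret finite_measure M by fact
  have uf: "\<And>k. u k \<in> Lp M p" "f \<in> Lp M p" "(\<lambda>k. Lp_norm M p (\<lambda>x. u k x - f x)) \<longlonglongrightarrow> 0"
    using u by (auto simp: Lp_converges_def)
  have d: "(\<lambda>x. u k x - f x) \<in> Lp M p" for k using uf p by (intro Lp_diff) auto
  define I where "I k = (\<integral>x. \<bar>u k x - f x\<bar> powr p \<partial>M)" for k
  have "(\<lambda>k. Lp_norm M p (\<lambda>x. u k x - f x) powr p) \<longlonglongrightarrow> 0 powr p"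
    using p by (intro tendsto_powr' uf tendsto_const) (auto simp: Lp_norm_def)
  moreover have "Lp_norm M p (\<lambda>x. u k x - f x) powr p = I k" for k
    unfolding Lp_norm_def I_def[symmetric] using p by (simp add: powr_powr) (simp add: I_def)
  ultimately have I: "I \<longlonglongrightarrow> 0" by simp
  define K where "K = measure M (space M) + (\<integral>x. Y x ^ (2 * m) \<partial>M)"
  have K: "K \<ge> 0" by (simp add: K_def)
  have bd: "\<bar>(\<integral>x. u k x * Y x \<partial>M) - (\<integral>x. f x * Y x \<partial>M)\<bar> \<le> \<eta> * ((1 / \<eta>) powr p * I k + K)" if \<eta>: "\<eta> > 0" for \<eta> k
  proof -
    have "(\<integral>x. u k x * Y x \<partial>M) - (\<integral>x. f x * Y x \<partial>M) = (\<integral>x. (u k x - f x) * Y x \<partial>M)"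
      using Lp_mult_integrable(1)[OF M p uf(1) Y] Lp_mult_integrable(1)[OF M p uf(2) Y]
      by (simp add: left_diff_distrib)
    also have "\<bar>\<dots>\<bar> \<le> (\<integral>x. \<bar>(u k x - f x) * Y x\<bar> \<partial>M)" by (rule integral_abs_bound)
    also have "\<dots> = \<eta> * (\<integral>x. \<bar>(1 / \<eta> * (u k x - f x)) * Y x\<bar> \<partial>M)"
      using \<eta> by (simp add: abs_mult)
    also have "\<dots> \<le> \<eta> * ((\<integral>x. \<bar>1 / \<eta> * (u k x - f x)\<bar> powr p \<partial>M) + measure M (space M) + (\<integral>x. Y x ^ (2 * m) \<partial>M))"
      using \<eta> by (intro mult_left_mono Lp_mult_integrable(2)[OF M p Lp_cmult[OF d] Y]) auto
    also have "(\<integral>x. \<bar>1 / \<eta> * (u k x - f x)\<bar> powr p \<partial>M) = (1 / \<eta>) powr p * I k"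
      using \<eta> unfolding I_def by (simp add: abs_mult powr_mult powr_divide)
    finally show ?thesis by (simp add: K_def add.assoc)
  qed
  show ?thesis
  proof (rule LIMSEQ_I)
    fix e :: real assume e: "e > 0"
    define \<eta> where "\<eta> = e / (2 * (K + 1))"
    have \<eta>: "\<eta> > 0" using e K by (simp add: \<eta>_def)
    have eK: "\<eta> * K < e / 2"
      using e K unfolding \<eta>_def by (simp add: field_simps)
    have "(\<lambda>k. \<eta> * ((1 / \<eta>) powr p * I k + K)) \<longlonglongrightarrow> \<eta> * ((1 / \<eta>) powr p * 0 + K)"
      by (intro tendsto_intros I)
    hence "eventually (\<lambda>k. \<eta> * ((1 / \<eta>) powr p * I k + K) < e) sequentially"
      by (rule order_tendstoD) (use eK e in simp)
    then obtain N where N: "\<And>k. k \<ge> N \<Longrightarrow> \<eta> * ((1 / \<eta>) powr p * I k + K) < e"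
      by (auto simp: eventually_sequentially)
    show "\<exists>N. \<forall>k\<ge>N. norm ((\<integral>x. u k x * Y x \<partial>M) - (\<integral>x. f x * Y x \<partial>M)) < e"
      using bd[OF \<eta>] N by (intro exI[of _ N]) (auto intro: le_less_trans)
  qed
qed

lemma integral_mult_left_commute: "(\<integral>x. u x * (c * v x) \<partial>M) = c * (\<integral>x. u x * v x \<partial>M)" for u v :: "'a \<Rightarrow> real"
  by (subst integral_mult_right_zero[symmetric]) (simp only: mult.left_commute)

lemma exp_gauss_shift: "exp (- g / 2) * exp (t\<^sup>2 * g / 2) = exp (- (1 - t\<^sup>2) * g / 2)" for g t :: real
  by (simp add: algebra_simps diff_divide_distrib flip: exp_add)

section \<open>Chaos expansions\<close>

context abstract_wiener_space
begin

lemma simple_chaos_iff: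
  "S \<in> simple_chaos \<iota> n \<longleftrightarrow> (\<exists>m c \<phi>. S = (\<lambda>w. \<Sum>i<(m::nat). c i * wiener_hermite n (\<phi> i) w))"
  by (simp add: simple_chaos_def wiener_hermite_eq)

lemma simple_chaos_add_hermite:
  assumes "S \<in> simple_chaos \<iota> n"
  shows "(\<lambda>w. S w + a * wiener_hermite n \<psi> w) \<in> simple_chaos \<iota> n"
proof -
  obtain m c \<phi> where S: "S = (\<lambda>w. \<Sum>i<(m::nat). c i * wiener_hermite n (\<phi> i) w)"
    using assms by (auto simp: simple_chaos_iff)
  have "(\<lambda>w. S w + a * wiener_hermite n \<psi> w) = 
      (\<lambda>w. \<Sum>i<Suc m. (c(m := a)) i * wiener_hermite n ((\<phi>(m := \<psi>)) i) w)"
    unfolding S by (auto simp: fun_eq_iff intro!: sum.cong)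
  thus ?thesis unfolding simple_chaos_iff by blast
qed

lemma simple_chaos_zero: "(\<lambda>_. 0) \<in> simple_chaos \<iota> n"
  unfolding simple_chaos_iff by (intro exI[of _ 0]) simp

lemma simple_chaos_hermite: "(\<lambda>w. a * wiener_hermite n \<phi> w) \<in> simple_chaos \<iota> n"
  using simple_chaos_add_hermite[OF simple_chaos_zero, where a=a and n=n and \<psi>=\<phi>] by simp

lemma simple_chaos_induct [consumes 1, case_names zero add]:
  assumes S: "S \<in> simple_chaos \<iota> n" and z: "P (\<lambda>_. 0)"
    and a: "\<And>S a \<phi>. S \<in> simple_chaos \<iota> n \<Longrightarrow> P S \<Longrightarrow> P (\<lambda>w. S w + a * wiener_hermite n \<phi> w)"
  shows "P S"
proof -
  obtain m c \<phi> where S: "S = (\<lambda>w. \<Sum>i<(m::nat). c i * wiener_hermite n (\<phi> i) w)"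
    using S by (auto simp: simple_chaos_iff)
  have "P (\<lambda>w. \<Sum>i<m. c i * wiener_hermite n (\<phi> i) w)"
  proof (induction m)
    case (Suc m)
    have "(\<lambda>w. \<Sum>i<m. c i * wiener_hermite n (\<phi> i) w) \<in> simple_chaos \<iota> n" unfolding simple_chaos_iff by blast
    from a[OF this Suc.IH] show ?case by simp
  qed (simp add: z)
  thus ?thesis by (simp add: S)
qed

lemma simple_chaos_add:
  assumes "S \<in> simple_chaos \<iota> n" "S' \<in> simple_chaos \<iota> n"
  shows "(\<lambda>w. S w + S' w) \<in> simple_chaos \<iota> n"
  using assms(2)
proof (induction rule: simple_chaos_induct)
  case (add S' a \<phi>)
  show ?case using simple_chaos_add_hermite[OF add(2), of a \<phi>] by (simp add: add.assoc)
qed (use assms in simp)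

lemma simple_chaos_cmult:
  assumes "S \<in> simple_chaos \<iota> n"
  shows "(\<lambda>w. c * S w) \<in> simple_chaos \<iota> n"
  using assms
proof (induction rule: simple_chaos_induct)
  case (add S a \<phi>)
  show ?case using simple_chaos_add_hermite[OF add(2), of "c * a" \<phi>] by (simp add: distrib_left mult.assoc)
qed (simp add: simple_chaos_zero)

lemma all_moments_zero: "all_moments \<mu> (\<lambda>_. 0)"
  by (rule all_moments_bounded[where B=0]) auto

lemma all_moments_simple_chaos:
  assumes "S \<in> simple_chaos \<iota> n" shows "all_moments \<mu> S"
  using assms
proof (induction rule: simple_chaos_induct)
  case (add S a \<phi>)
  show ?case by (intro all_moments_add all_moments_cmult all_moments_hermite add(2))
qed (rule all_moments_zero)

lemma integrable_all_moments_mult: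
  "all_moments \<mu> F \<Longrightarrow> all_moments \<mu> G \<Longrightarrow> integrable \<mu> (\<lambda>w. F w * G w)"
  by (intro sq_integrable_mult all_moments_sq)

lemma simple_chaos_orthogonal:
  assumes S: "S \<in> simple_chaos \<iota> n" and S': "S' \<in> simple_chaos \<iota> k" and "n \<noteq> k"
  shows "(\<integral>w. S w * S' w \<partial>\<mu>) = 0"
proof -
  have *: "(\<integral>w. S w * wiener_hermite k \<psi> w \<partial>\<mu>) = 0" for \<psi>
    using S
  proof (induction rule: simple_chaos_induct)
    case (add S a \<phi>)
    have "integrable \<mu> (\<lambda>w. S w * wiener_hermite k \<psi> w)" "integrable \<mu> (\<lambda>w. wiener_hermite n \<phi> w * wiener_hermite k \<psi> w)"
      by (intro integrable_all_moments_mult all_moments_hermite all_moments_simple_chaos[OF add(1)])+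
    thus ?case using add(2) hermite_orthogonal[OF \<open>n \<noteq> k\<close>, of \<phi> \<psi>] by (simp add: distrib_right mult.assoc)
  qed simp
  show ?thesis using S'
  proof (induction rule: simple_chaos_induct)
    case (add S' a \<phi>)
    have "integrable \<mu> (\<lambda>w. S w * S' w)" "integrable \<mu> (\<lambda>w. S w * wiener_hermite k \<phi> w)"
      by (intro integrable_all_moments_mult all_moments_hermite all_moments_simple_chaos[OF add(1)]
         all_moments_simple_chaos[OF S])+
    thus ?case using add(2) *[of \<phi>] by (simp add: distrib_left mult.left_commute)
  qed simp
qed

text \<open>
  Mehler's formula for \<open>\<Gamma>(t)\<close>.
\<close>

definition mehler :: "real \<Rightarrow> ('w \<Rightarrow> real) \<Rightarrow> 'w \<Rightarrow> real" where
  "mehler t a w = (\<integral>w'. a (t *\<^sub>R w + sqrt (1 - t\<^sup>2) *\<^sub>R w') \<partial>\<mu>)"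

lemma mehler_cos:
  assumes "t\<^sup>2 \<le> 1"
  shows "mehler t (\<lambda>w. cos (blinfun_apply \<phi> w + \<theta>)) w =
    exp (- (1 - t\<^sup>2) * gvar \<phi> / 2) * cos (t * blinfun_apply \<phi> w + \<theta>)"
proof -
  have "mehler t (\<lambda>w. cos (blinfun_apply \<phi> w + \<theta>)) w =
      (\<integral>w'. cos (blinfun_apply (sqrt (1 - t\<^sup>2) *\<^sub>R \<phi>) w' + (t * blinfun_apply \<phi> w + \<theta>)) \<partial>\<mu>)"
    by (simp add: mehler_def blinfun.add_right blinfun.scaleR_right blinfun.scaleR_left algebra_simps)
  also have "\<dots> = exp (- (1 - t\<^sup>2) * gvar \<phi> / 2) * cos (t * blinfun_apply \<phi> w + \<theta>)"
    unfolding integral_cos_mu gvar_scaleR using assms by (simp add: algebra_simps)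
  finally show ?thesis .
qed

lemma trig_poly_slice_integrable:
  assumes "T \<in> trig_poly \<Phi>"
  shows "integrable \<mu> (\<lambda>w'. T (a + c *\<^sub>R w'))"
proof -
  obtain B where "\<And>w. \<bar>T w\<bar> \<le> B" using trig_poly_bounded[OF assms] by blast
  moreover have [measurable]: "T \<in> borel_measurable borel" by (rule trig_poly_measurable[OF assms])
  ultimately show ?thesis by (intro integrable_const_bound[where B=B]) auto
qed

lemma mehler_trig_add:
  "T \<in> trig_poly \<Phi> \<Longrightarrow> U \<in> trig_poly \<Phi> \<Longrightarrow> mehler t (\<lambda>w. T w + U w) w = mehler t T w + mehler t U w"
  unfolding mehler_def by (intro Bochner_Integration.integral_add trig_poly_slice_integrable)

lemma mehler_cmult: "mehler t (\<lambda>w. c * T w) w = c * mehler t T w"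
  by (simp add: mehler_def)

lemma mehler_trig_poly:
  assumes T: "T \<in> trig_poly \<Phi>" and "subspace \<Phi>" and t: "t\<^sup>2 \<le> 1"
  shows "mehler t T \<in> trig_poly \<Phi>"
  using T
proof induction
  case (trig_cos \<phi> \<theta>)
  have "mehler t (\<lambda>w. cos (blinfun_apply \<phi> w + \<theta>)) = 
      (\<lambda>w. exp (- (1 - t\<^sup>2) * gvar \<phi> / 2) * cos (blinfun_apply (t *\<^sub>R \<phi>) w + \<theta>))"
    by (rule ext) (simp add: mehler_cos[OF t] blinfun.scaleR_left)
  also have "\<dots> \<in> trig_poly \<Phi>" using trig_cos assms(2) by (intro trig_poly.intros subspace_scale)
  finally show ?case .
next
  case (trig_add T U)
  have "mehler t (\<lambda>w. T w + U w) = (\<lambda>w. mehler t T w + mehler t U w)"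
    by (rule ext) (rule mehler_trig_add[OF trig_add(1,2)])
  thus ?case using trig_add by (simp add: trig_poly.trig_add)
next
  case (trig_scale T c)
  have "mehler t (\<lambda>w. c * T w) = (\<lambda>w. c * mehler t T w)" by (rule ext) (rule mehler_cmult)
  thus ?case using trig_scale by (simp add: trig_poly.trig_scale)
qed

lemma trig_poly_all_moments: "T \<in> trig_poly \<Phi> \<Longrightarrow> all_moments \<mu> T"
  using trig_poly_bounded[of T \<Phi>] trig_poly_measurable[of T \<Phi>] all_moments_bounded[of T]
  by (auto simp: borel_mu)

text \<open>
  The weak form of \<open>\<Gamma>(t) T = (\<Sum>k. t\<^sup>k J\<^sub>k T)\<close>. For a cosine it is the Hermite series at frequency
  \<open>t \<phi>\<close>; the general case is linear combination.
\<close>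

lemma trig_poly_chaos_expansion:
  assumes "T \<in> trig_poly UNIV"
  shows "\<exists>J. (\<forall>k. J k \<in> simple_chaos \<iota> k) \<and>
     (\<forall>u t. sq_integrable u \<longrightarrow> t\<^sup>2 \<le> 1 \<longrightarrow> (\<lambda>k. t ^ k * (\<integral>w. u w * J k w \<partial>\<mu>)) sums (\<integral>w. u w * mehler t T w \<partial>\<mu>))"
  using assms
proof induction
  case (trig_cos \<phi> \<theta>)
  define c where "c k = exp (- gvar \<phi> / 2) * (cos (\<theta> + real k * pi / 2) / fact k)" for k
  show ?case
  proof (intro exI[of _ "\<lambda>k w. c k * wiener_hermite k \<phi> w"] conjI allI impI)
    fix u t assume u: "sq_integrable u" and t: "t\<^sup>2 \<le> (1::real)"
    have "(\<lambda>k. exp (- gvar \<phi> / 2) * (t ^ k * (cos (\<theta> + real k * pi / 2) * ((\<integral>w. u w * wiener_hermite k \<phi> w \<partial>\<mu>) / fact k)))) sums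
        (exp (- gvar \<phi> / 2) * (exp (t\<^sup>2 * gvar \<phi> / 2) * (\<integral>w. u w * cos (t * blinfun_apply \<phi> w + \<theta>) \<partial>\<mu>)))"
      by (intro sums_mult hermite_series_integral u)
    moreover have "(\<integral>w. u w * mehler t (\<lambda>w. cos (blinfun_apply \<phi> w + \<theta>)) w \<partial>\<mu>) =
        exp (- gvar \<phi> / 2) * (exp (t\<^sup>2 * gvar \<phi> / 2) * (\<integral>w. u w * cos (t * blinfun_apply \<phi> w + \<theta>) \<partial>\<mu>))"
      unfolding mehler_cos[OF t] exp_gauss_shift[symmetric] mult.assoc[of "exp _" "exp _"]
      by (simp only: integral_mult_left_commute)
    moreover have "t ^ k * (\<integral>w. u w * (c k * wiener_hermite k \<phi> w) \<partial>\<mu>) =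
        exp (- gvar \<phi> / 2) * (t ^ k * (cos (\<theta> + real k * pi / 2) * ((\<integral>w. u w * wiener_hermite k \<phi> w \<partial>\<mu>) / fact k)))" for k
      unfolding integral_mult_left_commute c_def by simp
    ultimately show "(\<lambda>k. t ^ k * (\<integral>w. u w * (c k * wiener_hermite k \<phi> w) \<partial>\<mu>)) sums
         (\<integral>w. u w * mehler t (\<lambda>w. cos (blinfun_apply \<phi> w + \<theta>)) w \<partial>\<mu>)"
      by (simp only:)
  qed (rule simple_chaos_hermite)
next
  case (trig_add T U)
  then obtain J K where J: "\<And>k. J k \<in> simple_chaos \<iota> k" "\<And>u t. sq_integrable u \<Longrightarrow> t\<^sup>2 \<le> 1 \<Longrightarrow> (\<lambda>k. t ^ k * (\<integral>w. u w * J k w \<partial>\<mu>)) sums (\<integral>w. u w * mehler t T w \<partial>\<mu>)"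
    and K: "\<And>k. K k \<in> simple_chaos \<iota> k" "\<And>u t. sq_integrable u \<Longrightarrow> t\<^sup>2 \<le> 1 \<Longrightarrow> (\<lambda>k. t ^ k * (\<integral>w. u w * K k w \<partial>\<mu>)) sums (\<integral>w. u w * mehler t U w \<partial>\<mu>)"
    by blast
  show ?case
  proof (intro exI[of _ "\<lambda>k w. J k w + K k w"] conjI allI impI)
    fix u t assume u: "sq_integrable u" and t: "t\<^sup>2 \<le> (1::real)"
    have i: "integrable \<mu> (\<lambda>w. u w * J k w)" "integrable \<mu> (\<lambda>w. u w * K k w)" for k
      by (intro sq_integrable_mult u all_moments_sq all_moments_simple_chaos[OF J(1)] all_moments_simple_chaos[OF K(1)])+
    have j: "integrable \<mu> (\<lambda>w. u w * mehler t T w)" "integrable \<mu> (\<lambda>w. u w * mehler t U w)"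
      using mehler_trig_poly[OF trig_add(1) subspace_UNIV t] mehler_trig_poly[OF trig_add(2) subspace_UNIV t]
      by (blast intro: sq_integrable_mult u all_moments_sq trig_poly_all_moments)+
    have "(\<lambda>k. t ^ k * (\<integral>w. u w * J k w \<partial>\<mu>) + t ^ k * (\<integral>w. u w * K k w \<partial>\<mu>)) sums
       ((\<integral>w. u w * mehler t T w \<partial>\<mu>) + (\<integral>w. u w * mehler t U w \<partial>\<mu>))"
      by (intro sums_add J K u t)
    thus "(\<lambda>k. t ^ k * (\<integral>w. u w * (J k w + K k w) \<partial>\<mu>)) sums (\<integral>w. u w * mehler t (\<lambda>w. T w + U w) w \<partial>\<mu>)"
      unfolding mehler_trig_add[OF trig_add(1,2)] using i j by (simp add: distrib_left)
  qed (intro simple_chaos_add J K)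
next
  case (trig_scale T c)
  then obtain J where J: "\<And>k. J k \<in> simple_chaos \<iota> k" "\<And>u t. sq_integrable u \<Longrightarrow> t\<^sup>2 \<le> 1 \<Longrightarrow> (\<lambda>k. t ^ k * (\<integral>w. u w * J k w \<partial>\<mu>)) sums (\<integral>w. u w * mehler t T w \<partial>\<mu>)"
    by blast
  show ?case
  proof (intro exI[of _ "\<lambda>k w. c * J k w"] conjI allI impI)
    fix u t assume u: "sq_integrable u" and t: "t\<^sup>2 \<le> (1::real)"
    show "(\<lambda>k. t ^ k * (\<integral>w. u w * (c * J k w) \<partial>\<mu>)) sums (\<integral>w. u w * mehler t (\<lambda>w. c * T w) w \<partial>\<mu>)"
      unfolding mehler_cmult using sums_mult[OF J(2)[OF u t], of c] by (simp add: mult.left_commute)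
  qed (intro simple_chaos_cmult J)
qed

lemma L2_converges_integral:
  assumes "Lp_converges \<mu> 2 u f" "sq_integrable Y"
  shows "(\<lambda>k. \<integral>w. u k w * Y w \<partial>\<mu>) \<longlonglongrightarrow> (\<integral>w. f w * Y w \<partial>\<mu>)"
  using assms(2) by (intro Lp_converges_integral[where m=1 and p=2] assms(1))
    (auto simp: sq_integrable_def intro: finite_measure_axioms)

lemma hermite_in_wiener_chaos: "wiener_hermite n \<phi> \<in> wiener_chaos \<iota> \<mu> n"
proof -
  have "Lp_converges \<mu> 2 (\<lambda>_. wiener_hermite n \<phi>) (wiener_hermite n \<phi>)"
    using all_moments_sq[OF all_moments_hermite] by (simp add: Lp_converges_def Lp_2_iff Lp_norm_def)
  thus ?thesis unfolding wiener_chaos_def using simple_chaos_hermite[of 1 n \<phi>]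
    by (auto intro!: exI[of _ "\<lambda>_. wiener_hermite n \<phi>"])
qed

lemma wiener_chaos_sq_integrable: "Y \<in> wiener_chaos \<iota> \<mu> n \<Longrightarrow> sq_integrable Y"
  by (auto simp: wiener_chaos_def Lp_converges_def Lp_2_iff)

lemma wiener_chaos_orthogonal_hermite:
  assumes "Y \<in> wiener_chaos \<iota> \<mu> n" "n \<noteq> k"
  shows "(\<integral>w. Y w * wiener_hermite k \<phi> w \<partial>\<mu>) = 0"
proof -
  obtain S where S: "\<And>j. S j \<in> simple_chaos \<iota> n" "Lp_converges \<mu> 2 S Y"
    using assms(1) by (auto simp: wiener_chaos_def)
  have "(\<lambda>j. \<integral>w. S j w * wiener_hermite k \<phi> w \<partial>\<mu>) \<longlonglongrightarrow> (\<integral>w. Y w * wiener_hermite k \<phi> w \<partial>\<mu>)"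
    by (intro L2_converges_integral S all_moments_sq all_moments_hermite)
  moreover have "(\<integral>w. S j w * wiener_hermite k \<phi> w \<partial>\<mu>) = 0" for j
    using simple_chaos_orthogonal[OF S(1) simple_chaos_hermite[of 1 k \<phi>] assms(2)] by simp
  ultimately show ?thesis by (simp add: LIMSEQ_const_iff)
qed

lemma chaos_projectionD:
  assumes "chaos_projection \<iota> \<mu> n u v"
  shows "sq_integrable u" "sq_integrable v" "v \<in> wiener_chaos \<iota> \<mu> n"
    "(\<integral>w. v w * wiener_hermite n \<phi> w \<partial>\<mu>) = (\<integral>w. u w * wiener_hermite n \<phi> w \<partial>\<mu>)"
proof -
  show u: "sq_integrable u" and v: "v \<in> wiener_chaos \<iota> \<mu> n"
    using assms by (auto simp: chaos_projection_def Lp_2_iff)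
  show v2: "sq_integrable v" by (rule wiener_chaos_sq_integrable[OF v])
  have "integrable \<mu> (\<lambda>w. u w * wiener_hermite n \<phi> w)" "integrable \<mu> (\<lambda>w. v w * wiener_hermite n \<phi> w)"
    by (intro sq_integrable_mult u v2 all_moments_sq all_moments_hermite)+
  moreover have "(\<integral>w. (u w - v w) * wiener_hermite n \<phi> w \<partial>\<mu>) = 0"
    using assms hermite_in_wiener_chaos[of n \<phi>] by (auto simp: chaos_projection_def)
  ultimately show "(\<integral>w. v w * wiener_hermite n \<phi> w \<partial>\<mu>) = (\<integral>w. u w * wiener_hermite n \<phi> w \<partial>\<mu>)"
    by (simp add: left_diff_distrib)
qed

text \<open>
  The projection to order \<open>n\<close> integrates to zero against Hermite polynomials of other orders, so one
  term of the series of the cosine survives.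
\<close>

lemma chaos_projection_cos:
  assumes J: "chaos_projection \<iota> \<mu> n u v"
  shows "exp (gvar \<phi> / 2) * (\<integral>w. v w * cos (blinfun_apply \<phi> w + \<theta>) \<partial>\<mu>) =
    cos (\<theta> + real n * pi / 2) * ((\<integral>w. u w * wiener_hermite n \<phi> w \<partial>\<mu>) / fact n)"
proof -
  note D = chaos_projectionD[OF J]
  have "(\<lambda>k. (cos (\<theta> + real k * pi / 2) * ((\<integral>w. v w * wiener_hermite k \<phi> w \<partial>\<mu>) / fact k))) sums
     (exp (gvar \<phi> / 2) * (\<integral>w. v w * cos (blinfun_apply \<phi> w + \<theta>) \<partial>\<mu>))"
    using hermite_series_integral[OF D(2), of 1 \<theta> \<phi>] by simp
  also have "(\<lambda>k. (cos (\<theta> + real k * pi / 2) * ((\<integral>w. v w * wiener_hermite k \<phi> w \<partial>\<mu>) / fact k))) =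
    (\<lambda>k. if k = n then cos (\<theta> + real k * pi / 2) * ((\<integral>w. u w * wiener_hermite k \<phi> w \<partial>\<mu>) / fact k) else 0)"
    using wiener_chaos_orthogonal_hermite[OF D(3)] D(4) by (auto simp: fun_eq_iff)
  finally show ?thesis
    using sums_single[of n "\<lambda>k. cos (\<theta> + real k * pi / 2) * ((\<integral>w. u w * wiener_hermite k \<phi> w \<partial>\<mu>) / fact k)"]
    by (simp add: sums_unique2)
qed

text \<open>
  The surviving terms, weighted by \<open>r\<^sup>n\<close>, are the Hermite series of \<open>cos (r \<phi> + \<theta>)\<close> integrated
  against \<open>u\<close>.
\<close>

lemma second_quantization_cos:
  assumes "second_quantization \<iota> \<mu> r u v"
  shows "(\<integral>w. v w * cos (blinfun_apply \<phi> w + \<theta>) \<partial>\<mu>) =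
    exp (- (1 - r\<^sup>2) * gvar \<phi> / 2) * (\<integral>w. u w * cos (r * blinfun_apply \<phi> w + \<theta>) \<partial>\<mu>)"
proof -
  obtain J where J: "\<And>n. chaos_projection \<iota> \<mu> n u (J n)"
     and lim: "Lp_converges \<mu> 2 (\<lambda>N w. \<Sum>n<N. r ^ n * J n w) v"
    using assms by (auto simp: second_quantization_def)
  note D = chaos_projectionD[OF J]
  have cosm: "all_moments \<mu> (\<lambda>w. cos (blinfun_apply \<phi> w + \<theta>))" by (rule all_moments_bounded[where B=1]) auto
  have i: "integrable \<mu> (\<lambda>w. J n w * cos (blinfun_apply \<phi> w + \<theta>))" for n
    by (intro sq_integrable_mult D all_moments_sq cosm)
  have "(\<lambda>N. \<integral>w. (\<Sum>n<N. r ^ n * J n w) * cos (blinfun_apply \<phi> w + \<theta>) \<partial>\<mu>) \<longlonglongrightarrow> (\<integral>w. v w * cos (blinfun_apply \<phi> w + \<theta>) \<partial>\<mu>)"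
    by (intro L2_converges_integral lim all_moments_sq cosm)
  also have "(\<lambda>N. \<integral>w. (\<Sum>n<N. r ^ n * J n w) * cos (blinfun_apply \<phi> w + \<theta>) \<partial>\<mu>) =
      (\<lambda>N. \<Sum>n<N. r ^ n * (\<integral>w. J n w * cos (blinfun_apply \<phi> w + \<theta>) \<partial>\<mu>))"
    using i by (simp add: sum_distrib_right mult.assoc Bochner_Integration.integral_sum)
  finally have "(\<lambda>n. r ^ n * (\<integral>w. J n w * cos (blinfun_apply \<phi> w + \<theta>) \<partial>\<mu>)) sums (\<integral>w. v w * cos (blinfun_apply \<phi> w + \<theta>) \<partial>\<mu>)"
    by (simp add: sums_def)
  hence "(\<lambda>n. exp (gvar \<phi> / 2) * (r ^ n * (\<integral>w. J n w * cos (blinfun_apply \<phi> w + \<theta>) \<partial>\<mu>))) sums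
     (exp (gvar \<phi> / 2) * (\<integral>w. v w * cos (blinfun_apply \<phi> w + \<theta>) \<partial>\<mu>))" by (rule sums_mult)
  moreover have "exp (gvar \<phi> / 2) * (r ^ n * (\<integral>w. J n w * cos (blinfun_apply \<phi> w + \<theta>) \<partial>\<mu>)) =
      r ^ n * (cos (\<theta> + real n * pi / 2) * ((\<integral>w. u w * wiener_hermite n \<phi> w \<partial>\<mu>) / fact n))" for n
    by (subst mult.left_commute) (simp only: chaos_projection_cos[OF J])
  ultimately have "exp (gvar \<phi> / 2) * (\<integral>w. v w * cos (blinfun_apply \<phi> w + \<theta>) \<partial>\<mu>) =
      exp (r\<^sup>2 * gvar \<phi> / 2) * (\<integral>w. u w * cos (r * blinfun_apply \<phi> w + \<theta>) \<partial>\<mu>)"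
    using hermite_series_integral[OF D(1), of r \<theta> \<phi>] by (simp add: sums_unique2)
  hence "exp (- gvar \<phi> / 2) * (exp (gvar \<phi> / 2) * (\<integral>w. v w * cos (blinfun_apply \<phi> w + \<theta>) \<partial>\<mu>)) =
      exp (- gvar \<phi> / 2) * (exp (r\<^sup>2 * gvar \<phi> / 2) * (\<integral>w. u w * cos (r * blinfun_apply \<phi> w + \<theta>) \<partial>\<mu>))"
    by (simp only:)
  thus ?thesis unfolding exp_gauss_shift[symmetric] mult.assoc by (simp flip: exp_add mult.assoc)
qed

lemma Lp_second_quantization_cos:
  assumes p: "p > 1" and g: "Lp_second_quantization \<iota> \<mu> p r f g"
  shows "(\<integral>w. g w * cos (blinfun_apply \<phi> w + \<theta>) \<partial>\<mu>) =
    exp (- (1 - r\<^sup>2) * gvar \<phi> / 2) * (\<integral>w. f w * cos (r * blinfun_apply \<phi> w + \<theta>) \<partial>\<mu>)"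
proof -
  obtain u v where uv: "\<And>k. second_quantization \<iota> \<mu> r (u k) (v k)" "Lp_converges \<mu> p u f" "Lp_converges \<mu> p v g"
    using g by (auto simp: Lp_second_quantization_def Lp_extension_def)
  obtain m :: nat where m: "p / (p - 1) \<le> real (2 * m)"
    by (metis real_arch_simple[of "p / (p - 1)"] order_trans of_nat_mono mult_2 le_add1)
  have cosm: "all_moments \<mu> (\<lambda>w. cos (c * blinfun_apply \<phi> w + \<theta>))" for c by (rule all_moments_bounded[where B=1]) auto
  note lim = Lp_converges_integral[OF finite_measure_axioms p m _ all_momentsD(1)[OF cosm] all_momentsD(3)[OF cosm]]
  have "(\<lambda>k. exp (- (1 - r\<^sup>2) * gvar \<phi> / 2) * (\<integral>w. u k w * cos (r * blinfun_apply \<phi> w + \<theta>) \<partial>\<mu>)) \<longlonglongrightarrow> 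
      exp (- (1 - r\<^sup>2) * gvar \<phi> / 2) * (\<integral>w. f w * cos (r * blinfun_apply \<phi> w + \<theta>) \<partial>\<mu>)"
    by (intro tendsto_mult tendsto_const lim uv)
  moreover have "(\<lambda>k. \<integral>w. v k w * cos (blinfun_apply \<phi> w + \<theta>) \<partial>\<mu>) \<longlonglongrightarrow> (\<integral>w. g w * cos (blinfun_apply \<phi> w + \<theta>) \<partial>\<mu>)"
    using lim[OF uv(3), of 1] by simp
  ultimately show ?thesis unfolding second_quantization_cos[OF uv(1)] by (rule LIMSEQ_unique[rotated])
qed

text \<open>
  The approximating functions and their projections have the same integrals against Hermite
  polynomials of order \<open>n\<close>; the former converge to \<open>g\<close> and the latter to \<open>0\<close>.
\<close>

lemma Lp_chaos_projection_zero:
  assumes p: "p > 1" and g: "Lp_chaos_projection \<iota> \<mu> p n g (\<lambda>_. 0)"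
    and S: "S \<in> simple_chaos \<iota> n"
  shows "(\<integral>w. g w * S w \<partial>\<mu>) = 0"
proof -
  obtain u v where uv: "\<And>k. chaos_projection \<iota> \<mu> n (u k) (v k)" "Lp_converges \<mu> p u g" "Lp_converges \<mu> p v (\<lambda>_. 0)"
    using g by (auto simp: Lp_chaos_projection_def Lp_extension_def)
  obtain m :: nat where m: "p / (p - 1) \<le> real (2 * m)"
    by (metis real_arch_simple[of "p / (p - 1)"] order_trans of_nat_mono mult_2 le_add1)
  have gp: "g \<in> Lp \<mu> p" using uv(2) by (simp add: Lp_converges_def)
  note lim = Lp_converges_integral[OF finite_measure_axioms p m _ all_momentsD(1)[OF all_moments_hermite] all_momentsD(3)[OF all_moments_hermite]]
  note int = Lp_mult_integrable(1)[OF finite_measure_axioms p m gp all_momentsD(1) all_momentsD(3)]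
  have *: "(\<integral>w. g w * wiener_hermite n \<phi> w \<partial>\<mu>) = 0" for \<phi>
  proof -
    have "(\<lambda>k. \<integral>w. v k w * wiener_hermite n \<phi> w \<partial>\<mu>) \<longlonglongrightarrow> (\<integral>w. 0 * wiener_hermite n \<phi> w \<partial>\<mu>)"
      by (rule lim[OF uv(3)])
    moreover have "(\<lambda>k. \<integral>w. v k w * wiener_hermite n \<phi> w \<partial>\<mu>) \<longlonglongrightarrow> (\<integral>w. g w * wiener_hermite n \<phi> w \<partial>\<mu>)"
      unfolding chaos_projectionD(4)[OF uv(1)] by (rule lim[OF uv(2)])
    ultimately show ?thesis using LIMSEQ_unique by fastforce
  qed
  show ?thesis using S
  proof (induction rule: simple_chaos_induct)
    case (add S a \<phi>)
    have "integrable \<mu> (\<lambda>w. g w * S w)" "integrable \<mu> (\<lambda>w. g w * wiener_hermite n \<phi> w)"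
      using int all_moments_simple_chaos[OF add(1)] all_moments_hermite by blast+
    thus ?case using add(2) * by (simp add: distrib_left mult.left_commute)
  qed simp
qed

end

section \<open>Hypercontractivity on sums of random signs\<close>

text \<open>
  The mean of \<open>F X Y\<close>, where \<open>X\<close> and \<open>Y\<close> are sums of the vectors \<open>e\<close> with fair random signs. The pairs
  of signs belonging to different \<open>e\<close> are independent, and the two signs of a pair have correlation \<open>r\<close>.
  As a recursive finite sum it lends itself to induction over the vectors.
\<close>

fun noisy_sign_mean :: "real \<Rightarrow> 'w::real_vector list \<Rightarrow> ('w \<Rightarrow> 'w \<Rightarrow> real) \<Rightarrow> real" where
  "noisy_sign_mean r [] F = F 0 0"
| "noisy_sign_mean r (e # es) F =
     (1 + r) / 4 * (noisy_sign_mean r es (\<lambda>x y. F (x + e) (y + e)) + noisy_sign_mean r es (\<lambda>x y. F (x - e) (y - e))) +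
     (1 - r) / 4 * (noisy_sign_mean r es (\<lambda>x y. F (x + e) (y - e)) + noisy_sign_mean r es (\<lambda>x y. F (x - e) (y + e)))"

lemma noisy_sign_mean_mono:
  assumes "\<bar>r\<bar> \<le> 1" "\<And>x y. F x y \<le> G x y"
  shows "noisy_sign_mean r es F \<le> noisy_sign_mean r es G"
  using assms(2)
proof (induction es arbitrary: F G)
  case (Cons e es)
  show ?case using assms(1) Cons
    by (auto intro!: add_mono mult_left_mono)
qed simp

lemma noisy_sign_mean_add:
  "noisy_sign_mean r es (\<lambda>x y. F x y + G x y) = noisy_sign_mean r es F + noisy_sign_mean r es G"
  by (induction es arbitrary: F G) (simp_all add: algebra_simps)

lemma noisy_sign_mean_cmult:
  "noisy_sign_mean r es (\<lambda>x y. c * F x y) = c * noisy_sign_mean r es F"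
  by (induction es arbitrary: F) (simp_all add: algebra_simps)

lemma noisy_sign_mean_fst:
  "noisy_sign_mean r (e # es) (\<lambda>x y. a x) =
     (noisy_sign_mean r es (\<lambda>x y. a (x + e)) + noisy_sign_mean r es (\<lambda>x y. a (x - e))) / 2"
  by (simp add: field_simps)

lemma noisy_sign_mean_snd:
  "noisy_sign_mean r (e # es) (\<lambda>x y. b y) =
     (noisy_sign_mean r es (\<lambda>x y. b (y + e)) + noisy_sign_mean r es (\<lambda>x y. b (y - e))) / 2"
  by (simp add: field_simps)

lemma noisy_sign_mean_swap:
  "noisy_sign_mean r es (\<lambda>x y. a x) = noisy_sign_mean r es (\<lambda>x y. a y)"
proof (induction es arbitrary: a)
  case (Cons e es)
  show ?case unfolding noisy_sign_mean_fst noisy_sign_mean_snd using Cons[of "\<lambda>x. a (x + e)"] Cons[of "\<lambda>x. a (x - e)"] by simp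
qed simp

lemma noisy_sign_mean_nonneg:
  "\<bar>r\<bar> \<le> 1 \<Longrightarrow> (\<And>x y. 0 \<le> F x y) \<Longrightarrow> 0 \<le> noisy_sign_mean r es F"
  using noisy_sign_mean_mono[of r "\<lambda>_ _. 0" F es] noisy_sign_mean_cmult[of r es 0 F] by simp

lemma young_power:
  fixes u X :: real
  assumes "u \<ge> 0" "X \<ge> 0"
  shows "real (Suc n) * (u * X ^ n) \<le> u ^ Suc n + real n * X ^ Suc n"
proof (induction n)
  case (Suc n)
  have "0 \<le> (u ^ Suc n - X ^ Suc n) * (u - X)"
  proof (cases "u \<ge> X")
    case True
    thus ?thesis using assms by (intro mult_nonneg_nonneg) (auto intro: power_mono simp del: power_Suc)
  next
    case False
    thus ?thesis using assms by (intro mult_nonpos_nonpos) (auto intro: power_mono simp del: power_Suc)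
  qed
  hence "u * X ^ Suc n + u ^ Suc n * X \<le> u ^ Suc (Suc n) + X ^ Suc (Suc n)" by (simp add: algebra_simps)
  moreover have "real (Suc n) * (u * X ^ n) * X \<le> (u ^ Suc n + real n * X ^ Suc n) * X"
    using Suc assms by (intro mult_right_mono)
  ultimately show ?case by (simp add: algebra_simps)
qed simp

lemma holder_two_point:
  fixes u v X Y :: real
  assumes nn: "u \<ge> 0" "v \<ge> 0" "X \<ge> 0" "Y \<ge> 0"
  shows "(u * X ^ n + v * Y ^ n) / 2 \<le>
    root (Suc n) ((u ^ Suc n + v ^ Suc n) / 2) * root (Suc n) ((X ^ Suc n + Y ^ Suc n) / 2) ^ n"
proof -
  define \<alpha> where "\<alpha> = root (Suc n) ((u ^ Suc n + v ^ Suc n) / 2)"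
  define \<beta> where "\<beta> = root (Suc n) ((X ^ Suc n + Y ^ Suc n) / 2)"
  have pows: "0 \<le> u ^ Suc n" "0 \<le> v ^ Suc n" "0 \<le> X ^ Suc n" "0 \<le> Y ^ Suc n" using nn by (simp_all del: power_Suc)
  have g: "root (Suc n) z ^ Suc n = z" if "0 \<le> z" for z using that by (intro real_root_pow_pos2) auto
  have p: "0 \<le> (u ^ Suc n + v ^ Suc n) / 2" "0 \<le> (X ^ Suc n + Y ^ Suc n) / 2"
    by (intro divide_nonneg_nonneg add_nonneg_nonneg pows; simp)+
  have \<alpha>: "\<alpha> ^ Suc n = (u ^ Suc n + v ^ Suc n) / 2" unfolding \<alpha>_def by (rule g[OF p(1)])
  have \<beta>: "\<beta> ^ Suc n = (X ^ Suc n + Y ^ Suc n) / 2" unfolding \<beta>_def by (rule g[OF p(2)])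
  have ab: "\<alpha> \<ge> 0" "\<beta> \<ge> 0" using p by (simp_all add: \<alpha>_def \<beta>_def del: power_Suc)
  have "(u * X ^ n + v * Y ^ n) / 2 \<le> \<alpha> * \<beta> ^ n"
  proof (cases "\<alpha> = 0 \<or> \<beta> = 0")
    case True
    thus ?thesis
    proof
      assume "\<alpha> = 0"
      hence "u ^ Suc n + v ^ Suc n = 0" using \<alpha> by simp
      hence "u ^ Suc n = 0" "v ^ Suc n = 0" using pows by linarith+
      hence "u = 0" "v = 0" by auto
      thus ?thesis using ab by simp
    next
      assume "\<beta> = 0"
      hence "X ^ Suc n + Y ^ Suc n = 0" using \<beta> by simp
      hence "X ^ Suc n = 0" "Y ^ Suc n = 0" using pows by linarith+
      hence XY: "X = 0" "Y = 0" by auto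
      show ?thesis
      proof (cases n)
        case 0
        thus ?thesis using \<alpha> by simp
      qed (use XY ab in simp)
    qed
  next
    case False
    hence pos: "\<alpha> > 0" "\<beta> > 0" using ab by auto
    have "real (Suc n) * (u / \<alpha> * (X / \<beta>) ^ n) \<le> (u / \<alpha>) ^ Suc n + real n * (X / \<beta>) ^ Suc n"
      and "real (Suc n) * (v / \<alpha> * (Y / \<beta>) ^ n) \<le> (v / \<alpha>) ^ Suc n + real n * (Y / \<beta>) ^ Suc n"
      using nn ab by (intro young_power divide_nonneg_nonneg; simp)+
    hence "real (Suc n) * (u / \<alpha> * (X / \<beta>) ^ n + v / \<alpha> * (Y / \<beta>) ^ n) \<le>
       (u ^ Suc n + v ^ Suc n) / \<alpha> ^ Suc n + real n * ((X ^ Suc n + Y ^ Suc n) / \<beta> ^ Suc n)"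
      by (simp only: power_divide add_divide_distrib distrib_left)
    also have "u ^ Suc n + v ^ Suc n = 2 * \<alpha> ^ Suc n" using \<alpha> by simp
    also have "X ^ Suc n + Y ^ Suc n = 2 * \<beta> ^ Suc n" using \<beta> by simp
    also have "2 * \<alpha> ^ Suc n / \<alpha> ^ Suc n + real n * (2 * \<beta> ^ Suc n / \<beta> ^ Suc n) = real (Suc n) * 2"
      using pos by simp
    finally have "u / \<alpha> * (X / \<beta>) ^ n + v / \<alpha> * (Y / \<beta>) ^ n \<le> 2"
      by (simp only: mult_le_cancel_left_pos of_nat_0_less_iff zero_less_Suc)
    hence "(u / \<alpha> * (X / \<beta>) ^ n + v / \<alpha> * (Y / \<beta>) ^ n) * (\<alpha> * \<beta> ^ n) \<le> 2 * (\<alpha> * \<beta> ^ n)"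
      using ab by (intro mult_right_mono) auto
    moreover have "u / \<alpha> * (X / \<beta>) ^ n * (\<alpha> * \<beta> ^ n) = u * X ^ n" for u X
      using pos by (simp add: power_divide)
    ultimately show ?thesis by (simp add: distrib_right)
  qed
  thus ?thesis by (simp add: \<alpha>_def \<beta>_def)
qed

text \<open>
  The squares of \<open>c + x\<close> and \<open>c - x\<close> have the form \<open>s + y\<close> and \<open>s - y\<close>, and the even and odd parts of
  \<open>(s + y)\<^sup>k\<close> are bounded together by induction on \<open>k\<close>. The factor \<open>1 / (4 m)\<close> is smaller than the
  best possible one, of order \<open>m\<^bsup>-1/2\<^esup>\<close>, and leaves room for these crude bounds.
\<close>

lemma two_point_power_bound:
  fixes c d :: real
  assumes m: "m \<ge> 1"
  defines "x \<equiv> d / (4 * real m)"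
  shows "((c + x) ^ (2 * m) + (c - x) ^ (2 * m)) / 2 \<le> (c\<^sup>2 + d\<^sup>2) ^ m"
proof -
  define s where "s = c\<^sup>2 + x\<^sup>2"
  define y where "y = 2 * c * x"
  define Y where "Y = 4 * x\<^sup>2"
  define S where "S = s + real m * Y"
  have nn: "s \<ge> 0" "Y \<ge> 0" "S \<ge> s" by (simp_all add: s_def Y_def S_def)
  have "s * Y - y\<^sup>2 = 4 * (x\<^sup>2)\<^sup>2"
    unfolding y_def s_def Y_def by (simp add: power_mult_distrib algebra_simps power2_eq_square)
  hence yY: "y\<^sup>2 \<le> s * Y" using zero_le_power2[of "x\<^sup>2"] by linarith
  define u where "u k = ((s + y) ^ k + (s - y) ^ k) / 2" for k
  define v where "v k = y * ((s + y) ^ k - (s - y) ^ k) / 2" for k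
  have uS: "u (Suc k) = s * u k + v k" and vS: "v (Suc k) = s * v k + y\<^sup>2 * u k" for k
    by (simp_all add: u_def v_def field_simps power2_eq_square)
  have "k \<le> m \<Longrightarrow> 0 \<le> u k \<and> u k \<le> S ^ k \<and> v k \<le> real k * Y * S ^ k" for k
  proof (induction k)
    case (Suc k)
    hence IH: "0 \<le> u k" "u k \<le> S ^ k" "v k \<le> real k * Y * S ^ k" by auto
    have S0: "0 \<le> S ^ k" using nn by simp
    have ys: "\<bar>y\<bar> \<le> s"
      unfolding y_def s_def using zero_le_power2[of "\<bar>c\<bar> - \<bar>x\<bar>"] by (simp add: power2_diff abs_mult)
    have "0 \<le> u (Suc k)" unfolding u_def using ys by (simp del: power_Suc)
    moreover have "u (Suc k) \<le> S ^ Suc k"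
    proof -
      have "u (Suc k) \<le> s * S ^ k + real k * Y * S ^ k"
        unfolding uS using IH nn by (intro add_mono mult_left_mono) auto
      also have "\<dots> \<le> s * S ^ k + real m * Y * S ^ k"
        using Suc.prems nn S0 by (intro add_mono mult_right_mono) auto
      also have "\<dots> = S ^ Suc k" by (simp add: S_def algebra_simps)
      finally show ?thesis .
    qed
    moreover have "v (Suc k) \<le> real (Suc k) * Y * S ^ Suc k"
    proof -
      have "v (Suc k) \<le> s * (real k * Y * S ^ k) + (s * Y) * S ^ k"
        unfolding vS using IH nn yY by (intro add_mono mult_left_mono mult_mono) auto
      also have "\<dots> = s * (real (Suc k) * Y * S ^ k)" by (simp add: algebra_simps)
      also have "\<dots> \<le> S * (real (Suc k) * Y * S ^ k)" using nn S0 by (intro mult_right_mono) auto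
      also have "\<dots> = real (Suc k) * Y * S ^ Suc k" by simp
      finally show ?thesis .
    qed
    ultimately show ?case by blast
  qed (simp add: u_def v_def)
  hence "u m \<le> S ^ m" by blast
  also have "S \<le> c\<^sup>2 + d\<^sup>2"
  proof -
    have "x\<^sup>2 + real m * Y = (1 + 4 * real m) * x\<^sup>2" by (simp add: Y_def algebra_simps)
    also have "\<dots> \<le> (16 * (real m)\<^sup>2) * x\<^sup>2"
    proof (rule mult_right_mono)
      have "real m * 1 \<le> real m * real m" using m by (intro mult_left_mono) auto
      thus "1 + 4 * real m \<le> 16 * (real m)\<^sup>2" using m unfolding power2_eq_square by linarith
    qed simp
    also have "\<dots> = d\<^sup>2" using m by (simp add: x_def power_divide power_mult_distrib)
    finally show ?thesis by (simp add: S_def s_def)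
  qed
  hence "S ^ m \<le> (c\<^sup>2 + d\<^sup>2) ^ m" using nn by (intro power_mono) auto
  finally have "u m \<le> (c\<^sup>2 + d\<^sup>2) ^ m" .
  moreover have "(c + x)\<^sup>2 = s + y" "(c - x)\<^sup>2 = s - y"
    by (simp_all add: s_def y_def power2_sum power2_diff)
  ultimately show ?thesis by (simp add: u_def power_mult)
qed

text \<open>
  Averaging the first factor over the noise replaces its values \<open>c + d\<close> and \<open>c - d\<close> by \<open>c + r d\<close> and
  \<open>c - r d\<close>. Hoelder's inequality on two points then leaves the power bound.
\<close>

lemma two_point_hypercontractive:
  fixes A A' B B' :: real
  assumes nn: "A \<ge> 0" "A' \<ge> 0" "B \<ge> 0" "B' \<ge> 0" and m: "m \<ge> 1" and r: "r = 1 / (4 * real m)"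
  shows "(1 + r) / 4 * (A * B ^ (2 * m - 1) + A' * B' ^ (2 * m - 1)) + (1 - r) / 4 * (A * B' ^ (2 * m - 1) + A' * B ^ (2 * m - 1))
     \<le> sqrt ((A\<^sup>2 + A'\<^sup>2) / 2) * root (2 * m) ((B ^ (2 * m) + B' ^ (2 * m)) / 2) ^ (2 * m - 1)"
proof -
  define c where "c = (A + A') / 2"
  define d where "d = (A - A') / 2"
  have q: "Suc (2 * m - 1) = 2 * m" using m by simp
  have r01: "0 \<le> r" "r \<le> 1" using m by (auto simp: r field_simps)
  have uv: "0 \<le> c + r * d" "0 \<le> c - r * d"
  proof -
    have "c + r * d = ((1 + r) * A + (1 - r) * A') / 2" "c - r * d = ((1 - r) * A + (1 + r) * A') / 2"
      by (simp_all add: c_def d_def field_simps)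
    moreover have "0 \<le> (1 + r) * A" "0 \<le> (1 - r) * A'" "0 \<le> (1 - r) * A" "0 \<le> (1 + r) * A'"
      using r01 nn by (intro mult_nonneg_nonneg; simp)+
    ultimately show "0 \<le> c + r * d" "0 \<le> c - r * d" by simp_all
  qed
  have "(1 + r) / 4 * (A * B ^ (2 * m - 1) + A' * B' ^ (2 * m - 1)) + (1 - r) / 4 * (A * B' ^ (2 * m - 1) + A' * B ^ (2 * m - 1))
      = ((c + r * d) * B ^ (2 * m - 1) + (c - r * d) * B' ^ (2 * m - 1)) / 2"
    by (simp add: c_def d_def field_simps)
  also have "\<dots> \<le> root (2 * m) (((c + r * d) ^ (2 * m) + (c - r * d) ^ (2 * m)) / 2) *
      root (2 * m) ((B ^ (2 * m) + B' ^ (2 * m)) / 2) ^ (2 * m - 1)"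
    using holder_two_point[OF uv nn(3,4), of "2 * m - 1"] unfolding q .
  also have "\<dots> \<le> sqrt ((A\<^sup>2 + A'\<^sup>2) / 2) * root (2 * m) ((B ^ (2 * m) + B' ^ (2 * m)) / 2) ^ (2 * m - 1)"
  proof (rule mult_right_mono)
    have cd: "c\<^sup>2 + d\<^sup>2 = (A\<^sup>2 + A'\<^sup>2) / 2" by (simp add: c_def d_def power2_eq_square field_simps)
    have "((c + r * d) ^ (2 * m) + (c - r * d) ^ (2 * m)) / 2 \<le> (c\<^sup>2 + d\<^sup>2) ^ m"
      using two_point_power_bound[OF m, of c d] by (simp add: r)
    also have "\<dots> = sqrt (c\<^sup>2 + d\<^sup>2) ^ (2 * m)" by (simp add: power_mult)
    finally have "root (2 * m) (((c + r * d) ^ (2 * m) + (c - r * d) ^ (2 * m)) / 2) \<le> root (2 * m) (sqrt (c\<^sup>2 + d\<^sup>2) ^ (2 * m))"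
      using m by (intro real_root_le_mono) auto
    also have "\<dots> = sqrt (c\<^sup>2 + d\<^sup>2)" using m by (intro real_root_power_cancel) auto
    finally show "root (2 * m) (((c + r * d) ^ (2 * m) + (c - r * d) ^ (2 * m)) / 2) \<le> sqrt ((A\<^sup>2 + A'\<^sup>2) / 2)"
      by (simp add: cd)
    show "0 \<le> root (2 * m) ((B ^ (2 * m) + B' ^ (2 * m)) / 2) ^ (2 * m - 1)"
      using nn by (intro zero_le_power real_root_ge_zero) auto
  qed
  finally show ?thesis .
qed

text \<open>
  With one pair of signs fixed the induction hypothesis bounds the remaining mean by norms of sections,
  to which the two-point inequality applies. The constant 1 is what makes this iteration free of
  loss in the number of vectors.
\<close>

lemma noisy_sign_hypercontractive:
  assumes m: "m \<ge> 1" and r: "r = 1 / (4 * real m)"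
  shows "noisy_sign_mean r es (\<lambda>x y. \<bar>a x\<bar> * \<bar>b y\<bar> ^ (2 * m - 1)) \<le>
    sqrt (noisy_sign_mean r es (\<lambda>x y. (a x)\<^sup>2)) * root (2 * m) (noisy_sign_mean r es (\<lambda>x y. b y ^ (2 * m))) ^ (2 * m - 1)"
proof (induction es arbitrary: a b)
  case Nil
  have "root (2 * m) (b 0 ^ (2 * m)) = \<bar>b 0\<bar>"
    using real_root_power_cancel[of "2 * m" "\<bar>b 0\<bar>"] m by (simp add: power_even_abs)
  thus ?case by simp
next
  case (Cons e es)
  have r01: "\<bar>r\<bar> \<le> 1" "0 \<le> r" "r \<le> 1" using m by (auto simp: r field_simps)
  let ?E = "noisy_sign_mean r es"
  define A where "A z = sqrt (?E (\<lambda>x y. (a (x + z))\<^sup>2))" for z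
  define B where "B z = root (2 * m) (?E (\<lambda>x y. b (y + z) ^ (2 * m)))" for z
  have b0: "0 \<le> ?E (\<lambda>x y. b (y + z) ^ (2 * m))" for z by (rule noisy_sign_mean_nonneg[OF r01(1)]) simp
  have a0: "0 \<le> ?E (\<lambda>x y. (a (x + z))\<^sup>2)" for z by (rule noisy_sign_mean_nonneg[OF r01(1)]) simp
  have IH: "?E (\<lambda>x y. \<bar>a (x + z)\<bar> * \<bar>b (y + z')\<bar> ^ (2 * m - 1)) \<le> A z * B z' ^ (2 * m - 1)" for z z'
    unfolding A_def B_def by (rule Cons.IH)
  have nn: "A z \<ge> 0" "B z \<ge> 0" for z using a0 b0 by (auto simp: A_def B_def intro: real_root_ge_zero)
  have "noisy_sign_mean r (e # es) (\<lambda>x y. \<bar>a x\<bar> * \<bar>b y\<bar> ^ (2 * m - 1)) \<le>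
     (1 + r) / 4 * (A e * B e ^ (2 * m - 1) + A (- e) * B (- e) ^ (2 * m - 1)) +
     (1 - r) / 4 * (A e * B (- e) ^ (2 * m - 1) + A (- e) * B e ^ (2 * m - 1))"
    using r01 IH[of e e] IH[of "- e" "- e"] IH[of e "- e"] IH[of "- e" e]
    by (auto intro!: add_mono mult_left_mono)
  also have "\<dots> \<le> sqrt (((A e)\<^sup>2 + (A (- e))\<^sup>2) / 2) * root (2 * m) ((B e ^ (2 * m) + B (- e) ^ (2 * m)) / 2) ^ (2 * m - 1)"
    by (intro two_point_hypercontractive nn m r)
  also have "((A e)\<^sup>2 + (A (- e))\<^sup>2) / 2 = noisy_sign_mean r (e # es) (\<lambda>x y. (a x)\<^sup>2)"
    using a0[of e] a0[of "- e"] unfolding noisy_sign_mean_fst A_def by simp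
  also have "(B e ^ (2 * m) + B (- e) ^ (2 * m)) / 2 = noisy_sign_mean r (e # es) (\<lambda>x y. b y ^ (2 * m))"
    using b0[of e] b0[of "- e"] m unfolding noisy_sign_mean_snd B_def by (simp add: real_root_pow_pos2)
  finally show ?case .
qed

lemma noisy_sign_mean_cos:
  "noisy_sign_mean r es (\<lambda>x y. cos (blinfun_apply \<phi> x + blinfun_apply \<psi> y + \<theta>)) =
    cos \<theta> * (\<Prod>e\<leftarrow>es. (1 + r) / 2 * cos (blinfun_apply \<phi> e + blinfun_apply \<psi> e) + (1 - r) / 2 * cos (blinfun_apply \<phi> e - blinfun_apply \<psi> e))"
proof (induction es arbitrary: \<theta>)
  case (Cons e es)
  define p where "p = blinfun_apply \<phi> e + blinfun_apply \<psi> e"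
  define n where "n = blinfun_apply \<phi> e - blinfun_apply \<psi> e"
  define P where "P = (\<Prod>e\<leftarrow>es. (1 + r) / 2 * cos (blinfun_apply \<phi> e + blinfun_apply \<psi> e) + (1 - r) / 2 * cos (blinfun_apply \<phi> e - blinfun_apply \<psi> e))"
  have "noisy_sign_mean r (e # es) (\<lambda>x y. cos (blinfun_apply \<phi> x + blinfun_apply \<psi> y + \<theta>)) =
     (1 + r) / 4 * (noisy_sign_mean r es (\<lambda>x y. cos (blinfun_apply \<phi> x + blinfun_apply \<psi> y + (\<theta> + p)))
        + noisy_sign_mean r es (\<lambda>x y. cos (blinfun_apply \<phi> x + blinfun_apply \<psi> y + (\<theta> - p)))) +
     (1 - r) / 4 * (noisy_sign_mean r es (\<lambda>x y. cos (blinfun_apply \<phi> x + blinfun_apply \<psi> y + (\<theta> + n)))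
        + noisy_sign_mean r es (\<lambda>x y. cos (blinfun_apply \<phi> x + blinfun_apply \<psi> y + (\<theta> - n))))"
    by (simp add: p_def n_def blinfun.add_right blinfun.diff_right algebra_simps)
  also have "\<dots> = cos \<theta> * (((1 + r) / 2 * cos p + (1 - r) / 2 * cos n) * P)"
    unfolding Cons.IH P_def[symmetric] by (simp add: cos_add cos_diff field_simps)
  finally show ?case by (simp add: p_def n_def P_def)
qed simp

text \<open>
  The central limit theorem for a pair of correlated signs, in terms of characteristic functions:
  the \<open>N\<close>-th powers of two numbers in \<open>[-1, 1]\<close> differ by at most \<open>N\<close> times their distance.
\<close>

lemma cos_mean_power_limit:
  fixes r u v :: real
  assumes r: "\<bar>r\<bar> \<le> 1"
  shows "(\<lambda>N. ((1 + r) / 2 * cos (u / sqrt (real N)) + (1 - r) / 2 * cos (v / sqrt (real N))) ^ N)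
     \<longlonglongrightarrow> exp (- (((1 + r) / 2 * u\<^sup>2 + (1 - r) / 2 * v\<^sup>2) / 2))"
proof -
  define c where "c = ((1 + r) / 2 * u\<^sup>2 + (1 - r) / 2 * v\<^sup>2) / 2"
  have c0: "c \<ge> 0" using r by (auto simp: c_def abs_le_iff)
  define z where "z N = (1 + r) / 2 * cos (u / sqrt (real N)) + (1 - r) / 2 * cos (v / sqrt (real N))" for N
  define w where "w N = exp (- c / real N)" for N
  have zle: "\<bar>z N\<bar> \<le> 1" for N
  proof -
    have "\<bar>z N\<bar> \<le> (1 + r) / 2 * \<bar>cos (u / sqrt (real N))\<bar> + (1 - r) / 2 * \<bar>cos (v / sqrt (real N))\<bar>"
      unfolding z_def using r by (intro order_trans[OF abs_triangle_ineq]) (simp add: abs_mult)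
    also have "\<dots> \<le> (1 + r) / 2 * 1 + (1 - r) / 2 * 1" using r by (intro add_mono mult_left_mono) auto
    finally show ?thesis by (simp add: field_simps)
  qed
  have wle: "\<bar>w N\<bar> \<le> 1" for N using c0 by (simp add: w_def)
  have lc: "(\<lambda>N. real N * (cos (u / sqrt (real N)) - 1)) \<longlonglongrightarrow> - u\<^sup>2 / 2" for u
    unfolding power2_eq_square by real_asymp
  have le: "(\<lambda>N. real N * (exp (- c / real N) - 1)) \<longlonglongrightarrow> - c" by real_asymp
  have "(\<lambda>N. (1 + r) / 2 * (real N * (cos (u / sqrt (real N)) - 1)) + (1 - r) / 2 * (real N * (cos (v / sqrt (real N)) - 1))
       - real N * (exp (- c / real N) - 1)) \<longlonglongrightarrow> (1 + r) / 2 * (- u\<^sup>2 / 2) + (1 - r) / 2 * (- v\<^sup>2 / 2) - - c"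
    by (intro tendsto_intros lc le)
  also have "(1 + r) / 2 * (- u\<^sup>2 / 2) + (1 - r) / 2 * (- v\<^sup>2 / 2) - - c = 0" by (simp add: c_def field_simps)
  also have "(\<lambda>N. (1 + r) / 2 * (real N * (cos (u / sqrt (real N)) - 1)) + (1 - r) / 2 * (real N * (cos (v / sqrt (real N)) - 1))
       - real N * (exp (- c / real N) - 1)) = (\<lambda>N. real N * (z N - w N))"
    by (simp add: z_def w_def fun_eq_iff field_simps)
  finally have "(\<lambda>N. real N * (z N - w N)) \<longlonglongrightarrow> 0" .
  hence "(\<lambda>N. \<bar>real N * (z N - w N)\<bar>) \<longlonglongrightarrow> 0" by (rule tendsto_rabs_zero)
  hence "(\<lambda>N. z N ^ N - w N ^ N) \<longlonglongrightarrow> 0"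
  proof (rule Lim_null_comparison[rotated], intro always_eventually allI)
    fix N
    show "norm (z N ^ N - w N ^ N) \<le> \<bar>real N * (z N - w N)\<bar>"
      using norm_power_diff[of "z N" "w N" N] zle[of N] wle[of N] by (simp add: abs_mult)
  qed
  moreover have "(\<lambda>N. w N ^ N) \<longlonglongrightarrow> exp (- c)"
  proof (rule tendsto_eventually)
    show "eventually (\<lambda>N. w N ^ N = exp (- c)) sequentially"
      using eventually_gt_at_top[of 0] by eventually_elim (simp add: w_def flip: exp_of_nat_mult)
  qed
  ultimately have "(\<lambda>N. z N ^ N - w N ^ N + w N ^ N) \<longlonglongrightarrow> 0 + exp (- c)" by (rule tendsto_add)
  thus ?thesis by (simp add: z_def c_def)
qed

lemma finite_parseval:
  fixes K :: "'h::real_inner set"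
  assumes "finite K"
  shows "\<exists>hs. \<forall>u\<in>span K. \<forall>v\<in>span K. inner u v = (\<Sum>h\<leftarrow>hs. inner u h * inner v h)"
proof -
  obtain C where C: "finite C" "span C = span K" "pairwise orthogonal C"
    using basis_orthogonal[OF assms] by auto
  obtain cs where cs: "set cs = C" "distinct cs" using finite_distinct_list[OF C(1)] by blast
  define hs where "hs = map (\<lambda>c. (1 / norm c) *\<^sub>R c) cs"
  have "inner u v = (\<Sum>h\<leftarrow>hs. inner u h * inner v h)" if "u \<in> span K" and v: "v \<in> span K" for u v
  proof -
    have "(\<Sum>h\<leftarrow>hs. inner u h * inner v h) = (\<Sum>c\<in>C. inner u c * inner v c / (norm c)\<^sup>2)"
      unfolding hs_def using cs by (simp add: o_def sum_list_distinct_conv_sum_set power2_eq_square)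
    also have "\<dots> = inner u v"
    proof -
      have "u \<in> span C" using that C by simp
      thus ?thesis
      proof (induction rule: span_induct_alt)
        case base
        show ?case by simp
      next
        case (step a x y)
        have "inner x c = 0" if "c \<in> C" "c \<noteq> x" for c
          using C(3) step that by (auto simp: pairwise_def orthogonal_def)
        hence "(\<Sum>c\<in>C. inner x c * inner v c / (norm c)\<^sup>2) = (\<Sum>c\<in>C. if c = x then inner x x * inner v x / (norm x)\<^sup>2 else 0)"
          by (intro sum.cong) auto
        also have "\<dots> = inner x v"
          using step C(1) by (cases "x = 0") (simp_all add: power2_norm_eq_inner inner_commute)
        finally have x: "(\<Sum>c\<in>C. inner x c * inner v c / (norm c)\<^sup>2) = inner x v" .
        have "(\<Sum>c\<in>C. inner (a *\<^sub>R x + y) c * inner v c / (norm c)\<^sup>2) =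
            a * (\<Sum>c\<in>C. inner x c * inner v c / (norm c)\<^sup>2) + (\<Sum>c\<in>C. inner y c * inner v c / (norm c)\<^sup>2)"
          by (simp add: inner_add_left algebra_simps sum.distrib add_divide_distrib sum_distrib_left)
        thus ?case unfolding x using step by (simp add: inner_add_left)
      qed
    qed
    finally show ?thesis by simp
  qed
  thus ?thesis by blast
qed

section \<open>Rotation invariance and Mehler's formula\<close>

lemma law_eqI:
  fixes M N :: "'w::{real_normed_vector,second_countable_topology} measure"
  assumes M: "finite_measure M" "sets M = sets borel" and N: "finite_measure N" "sets N = sets borel"
    and eq: "\<And>(\<phi> :: 'w \<Rightarrow>\<^sub>L real) \<theta>. (\<integral>w. cos (blinfun_apply \<phi> w + \<theta>) \<partial>M) = (\<integral>w. cos (blinfun_apply \<phi> w + \<theta>) \<partial>N)"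
  shows "M = N"
proof (rule measure_eqI)
  interpret M: finite_measure M by fact
  interpret N: finite_measure N by fact
  fix A assume "A \<in> sets M"
  hence A: "A \<in> sets borel" using M by simp
  have "(\<integral>x. 1 * indicator A x \<partial>M) = (\<integral>x. 1 * indicator A x \<partial>N :: real)"
    by (rule signed_laws_eqI[OF _ _ _ _ _ A]) (use eq M(2) N(2) in \<open>auto intro: measurable_ident_sets\<close>)
  hence "measure M A = measure N A" using A M(2) N(2) by simp
  thus "emeasure M A = emeasure N A" by (simp add: M.emeasure_eq_measure N.emeasure_eq_measure)
qed (use M N in simp)

context abstract_wiener_space
begin

lemma mehler_law:
  assumes t: "t\<^sup>2 \<le> 1"
  shows "distr (\<mu> \<Otimes>\<^sub>M \<mu>) borel (\<lambda>z. t *\<^sub>R fst z + sqrt (1 - t\<^sup>2) *\<^sub>R snd z) = \<mu>" (is "distr _ _ ?f = _")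
proof (rule law_eqI)
  interpret P: pair_prob_space \<mu> \<mu> ..
  interpret D: prob_space "distr (\<mu> \<Otimes>\<^sub>M \<mu>) borel ?f" by (rule P.prob_space_distr) measurable
  show "finite_measure (distr (\<mu> \<Otimes>\<^sub>M \<mu>) borel ?f)" by (rule D.finite_measure_axioms)
  show "(\<integral>w. cos (blinfun_apply \<phi> w + \<theta>) \<partial>distr (\<mu> \<Otimes>\<^sub>M \<mu>) borel ?f) = (\<integral>w. cos (blinfun_apply \<phi> w + \<theta>) \<partial>\<mu>)"
    for \<phi> :: "'w \<Rightarrow>\<^sub>L real" and \<theta>
  proof -
    have "(\<integral>w. cos (blinfun_apply \<phi> w + \<theta>) \<partial>distr (\<mu> \<Otimes>\<^sub>M \<mu>) borel ?f) = 
        (\<integral>z. cos (blinfun_apply \<phi> (?f z) + \<theta>) \<partial>(\<mu> \<Otimes>\<^sub>M \<mu>))"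
      by (subst integral_distr) auto
    also have "\<dots> = (\<integral>w. mehler t (\<lambda>w. cos (blinfun_apply \<phi> w + \<theta>)) w \<partial>\<mu>)"
      unfolding mehler_def
      by (subst P.integral_fst'[symmetric]) (auto intro!: P.integrable_const_bound[where B=1])
    also have "\<dots> = exp (- (1 - t\<^sup>2) * gvar \<phi> / 2) * (\<integral>w. cos (blinfun_apply (t *\<^sub>R \<phi>) w + \<theta>) \<partial>\<mu>)"
      unfolding mehler_cos[OF t] by (simp add: blinfun.scaleR_left)
    also have "\<dots> = cos \<theta> * exp (- gvar \<phi> / 2)"
      unfolding integral_cos_mu gvar_scaleR by (simp add: algebra_simps diff_divide_distrib flip: exp_add)
    finally show ?thesis by (simp add: integral_cos_mu)
  qed
qed (simp_all add: sets_mu finite_measure_axioms)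

lemma mehler_integrable:
  assumes t: "t\<^sup>2 \<le> 1" and F: "integrable \<mu> F"
  shows "integrable (\<mu> \<Otimes>\<^sub>M \<mu>) (\<lambda>z. F (t *\<^sub>R fst z + sqrt (1 - t\<^sup>2) *\<^sub>R snd z))"
    and "AE w in \<mu>. integrable \<mu> (\<lambda>w'. F (t *\<^sub>R w + sqrt (1 - t\<^sup>2) *\<^sub>R w'))"
    and "integrable \<mu> (mehler t F)" and "(\<integral>w. mehler t F w \<partial>\<mu>) = (\<integral>w. F w \<partial>\<mu>)"
proof -
  interpret P: pair_prob_space \<mu> \<mu> ..
  let ?f = "\<lambda>z. t *\<^sub>R fst z + sqrt (1 - t\<^sup>2) *\<^sub>R snd z"
  have [measurable]: "F \<in> borel_measurable borel" using F borel_mu by auto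
  have i: "integrable (distr (\<mu> \<Otimes>\<^sub>M \<mu>) borel ?f) F" unfolding mehler_law[OF t] by (rule F)
  show i: "integrable (\<mu> \<Otimes>\<^sub>M \<mu>) (\<lambda>z. F (?f z))" using i by (subst (asm) integrable_distr_eq) auto
  show "AE w in \<mu>. integrable \<mu> (\<lambda>w'. F (t *\<^sub>R w + sqrt (1 - t\<^sup>2) *\<^sub>R w'))"
    using P.AE_integrable_fst'[OF i] by simp
  show "integrable \<mu> (mehler t F)" using P.integrable_fst'[OF i] unfolding mehler_def by simp
  have "(\<integral>w. F w \<partial>\<mu>) = (\<integral>w. F w \<partial>distr (\<mu> \<Otimes>\<^sub>M \<mu>) borel ?f)" unfolding mehler_law[OF t] ..
  also have "\<dots> = (\<integral>z. F (?f z) \<partial>(\<mu> \<Otimes>\<^sub>M \<mu>))" by (subst integral_distr) auto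
  also have "\<dots> = (\<integral>w. mehler t F w \<partial>\<mu>)" unfolding mehler_def using P.integral_fst'[OF i] by simp
  finally show "(\<integral>w. mehler t F w \<partial>\<mu>) = (\<integral>w. F w \<partial>\<mu>)" ..
qed

lemma mehler_measurable:
  assumes "F \<in> borel_measurable borel"
  shows "mehler t F \<in> borel_measurable borel"
proof -
  note [measurable] = assms
  have "(\<lambda>w. \<integral>w'. F (t *\<^sub>R w + sqrt (1 - t\<^sup>2) *\<^sub>R w') \<partial>\<mu>) \<in> borel_measurable borel"
    by measurable
  thus ?thesis unfolding mehler_def .
qed

section \<open>Hypercontractivity on Wiener space\<close>

text \<open>
  Random signs on these vectors give, for orthonormal \<open>hs\<close> and large \<open>N\<close>, approximately a Gaussian vector
  with independent components along \<open>hs\<close>.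
\<close>

definition sign_steps :: "'h list \<Rightarrow> nat \<Rightarrow> 'w list" where
  "sign_steps hs N = concat (map (\<lambda>h. replicate N ((1 / sqrt (real N)) *\<^sub>R \<iota> h)) hs)"

lemma noisy_sign_limit_cos:
  fixes hs :: "'h list" and r :: real
  assumes hs: "\<And>u v. u \<in> span K \<Longrightarrow> v \<in> span K \<Longrightarrow> inner u v = (\<Sum>h\<leftarrow>hs. inner u h * inner v h)"
    and r: "\<bar>r\<bar> \<le> 1" and K: "rep \<phi> \<in> span K" "rep \<psi> \<in> span K"
  shows "(\<lambda>N. noisy_sign_mean r (sign_steps hs N)
        (\<lambda>x y. cos (blinfun_apply \<phi> x + blinfun_apply \<psi> y + \<theta>)))
     \<longlonglongrightarrow> cos \<theta> * exp (- (gvar \<phi> + gvar \<psi> + 2 * r * inner (rep \<phi>) (rep \<psi>)) / 2)"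
proof -
  define u where "u h = inner (rep \<phi>) h + inner (rep \<psi>) h" for h
  define v where "v h = inner (rep \<phi>) h - inner (rep \<psi>) h" for h
  define g where "g e = (1 + r) / 2 * cos (blinfun_apply \<phi> e + blinfun_apply \<psi> e) + (1 - r) / 2 * cos (blinfun_apply \<phi> e - blinfun_apply \<psi> e)" for e
  define c where "c h = ((1 + r) / 2 * (u h)\<^sup>2 + (1 - r) / 2 * (v h)\<^sup>2) / 2" for h
  have g: "g ((1 / sqrt (real N)) *\<^sub>R \<iota> h) = (1 + r) / 2 * cos (u h / sqrt (real N)) + (1 - r) / 2 * cos (v h / sqrt (real N))" for N h
    by (simp add: g_def u_def v_def blinfun.scaleR_right rep_apply add_divide_distrib diff_divide_distrib)
  have lim: "(\<lambda>N. \<Prod>e\<leftarrow>sign_steps hs N. g e) \<longlonglongrightarrow> exp (- (\<Sum>h\<leftarrow>hs. c h))" for hs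
  proof (induction hs)
    case (Cons h hs)
    have "(\<lambda>N. g ((1 / sqrt (real N)) *\<^sub>R \<iota> h) ^ N) \<longlonglongrightarrow> exp (- c h)"
      unfolding g c_def by (rule cos_mean_power_limit[OF r])
    from tendsto_mult[OF this Cons.IH] show ?case by (simp add: sign_steps_def prod_list_replicate flip: exp_add)
  qed (simp add: sign_steps_def)
  have "c h = (inner (rep \<phi>) h * inner (rep \<phi>) h + inner (rep \<psi>) h * inner (rep \<psi>) h + 2 * r * (inner (rep \<phi>) h * inner (rep \<psi>) h)) / 2" for h
    by (simp add: c_def u_def v_def power2_eq_square field_simps)
  hence "(\<Sum>h\<leftarrow>hs. c h) = ((\<Sum>h\<leftarrow>hs. inner (rep \<phi>) h * inner (rep \<phi>) h) + (\<Sum>h\<leftarrow>hs. inner (rep \<psi>) h * inner (rep \<psi>) h) + 2 * r * (\<Sum>h\<leftarrow>hs. inner (rep \<phi>) h * inner (rep \<psi>) h)) / 2"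
    by (induction hs) (simp_all add: field_simps)
  also have "\<dots> = (gvar \<phi> + gvar \<psi> + 2 * r * inner (rep \<phi>) (rep \<psi>)) / 2"
    using hs[OF K(1) K(1)] hs[OF K(2) K(2)] hs[OF K] by (simp add: gvar_def power2_norm_eq_inner)
  finally have "(\<lambda>N. \<Prod>e\<leftarrow>sign_steps hs N. g e)
      \<longlonglongrightarrow> exp (- (gvar \<phi> + gvar \<psi> + 2 * r * inner (rep \<phi>) (rep \<psi>)) / 2)"
    using lim[of hs] by (simp only: minus_divide_left)
  thus ?thesis unfolding noisy_sign_mean_cos g_def by (rule tendsto_mult[OF tendsto_const])
qed

text \<open>
  Both sides are bilinear in \<open>T\<close> and \<open>U\<close>, and for two cosines both are determined by the covariances of
  the frequencies. Parseval's identity for \<open>hs\<close> is assumed on a finite-dimensional span that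
  contains the representatives of all frequencies involved.
\<close>

lemma noisy_sign_limit:
  fixes hs :: "'h list" and r :: real
  assumes hs: "\<And>u v. u \<in> span K \<Longrightarrow> v \<in> span K \<Longrightarrow> inner u v = (\<Sum>h\<leftarrow>hs. inner u h * inner v h)"
    and r: "\<bar>r\<bar> \<le> 1" and T: "T \<in> trig_poly {\<phi>. rep \<phi> \<in> span K}" and U: "U \<in> trig_poly {\<phi>. rep \<phi> \<in> span K}"
  shows "(\<lambda>N. noisy_sign_mean r (sign_steps hs N) (\<lambda>x y. T x * U y))
     \<longlonglongrightarrow> (\<integral>w. mehler r T w * U w \<partial>\<mu>)"
  using T
proof induction
  case (trig_cos \<phi> \<theta>)
  hence \<phi>: "rep \<phi> \<in> span K" by simp
  have r2: "r\<^sup>2 \<le> 1" using r by (simp add: abs_square_le_1)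
  let ?E = "\<lambda>N. noisy_sign_mean r (sign_steps hs N)"
  have mo: "all_moments \<mu> (mehler r (\<lambda>w. cos (blinfun_apply \<phi> w + \<theta>)))"
    by (rule trig_poly_all_moments[OF mehler_trig_poly[OF trig_poly.trig_cos subspace_UNIV r2]]) simp
  show ?case using U
  proof induction
    case (trig_cos \<psi> \<eta>)
    hence \<psi>: "rep \<psi> \<in> span K" by simp
    hence \<psi>': "rep (- \<psi>) \<in> span K" using rep_linear(3)[of "-1" \<psi>] by (simp add: span_neg)
    have gm: "gvar (- \<psi>) = gvar \<psi>" and im: "inner (rep \<phi>) (rep (- \<psi>)) = - inner (rep \<phi>) (rep \<psi>)"
      using gvar_scaleR[of "-1" \<psi>] rep_linear(3)[of "-1" \<psi>] by simp_all
    define z where "z = inner (rep \<phi>) (rep \<psi>)"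
    have "cos (blinfun_apply \<phi> x + \<theta>) * cos (blinfun_apply \<psi> y + \<eta>) =
      (1/2) * cos (blinfun_apply \<phi> x + blinfun_apply (- \<psi>) y + (\<theta> - \<eta>)) + (1/2) * cos (blinfun_apply \<phi> x + blinfun_apply \<psi> y + (\<theta> + \<eta>))" for x y
      unfolding cos_times_cos by (simp add: blinfun.minus_left algebra_simps add_divide_distrib)
    hence "?E N (\<lambda>x y. cos (blinfun_apply \<phi> x + \<theta>) * cos (blinfun_apply \<psi> y + \<eta>)) = 
       (1/2) * ?E N (\<lambda>x y. cos (blinfun_apply \<phi> x + blinfun_apply (- \<psi>) y + (\<theta> - \<eta>))) +
       (1/2) * ?E N (\<lambda>x y. cos (blinfun_apply \<phi> x + blinfun_apply \<psi> y + (\<theta> + \<eta>)))" for N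
      by (simp only: noisy_sign_mean_add noisy_sign_mean_cmult)
    moreover have "(\<lambda>N. (1/2) * ?E N (\<lambda>x y. cos (blinfun_apply \<phi> x + blinfun_apply (- \<psi>) y + (\<theta> - \<eta>))) +
       (1/2) * ?E N (\<lambda>x y. cos (blinfun_apply \<phi> x + blinfun_apply \<psi> y + (\<theta> + \<eta>)))) \<longlonglongrightarrow> 
       (1/2) * (cos (\<theta> - \<eta>) * exp (- (gvar \<phi> + gvar (- \<psi>) + 2 * r * inner (rep \<phi>) (rep (- \<psi>))) / 2)) + 
       (1/2) * (cos (\<theta> + \<eta>) * exp (- (gvar \<phi> + gvar \<psi> + 2 * r * inner (rep \<phi>) (rep \<psi>)) / 2))"
      by (intro tendsto_add tendsto_mult tendsto_const noisy_sign_limit_cos[OF hs r]) (use \<phi> \<psi> \<psi>' in auto)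
    ultimately have "(\<lambda>N. ?E N (\<lambda>x y. cos (blinfun_apply \<phi> x + \<theta>) * cos (blinfun_apply \<psi> y + \<eta>))) \<longlonglongrightarrow>
       (1/2) * (cos (\<theta> - \<eta>) * exp (- (gvar \<phi> + gvar (- \<psi>) + 2 * r * inner (rep \<phi>) (rep (- \<psi>))) / 2)) + 
       (1/2) * (cos (\<theta> + \<eta>) * exp (- (gvar \<phi> + gvar \<psi> + 2 * r * inner (rep \<phi>) (rep \<psi>)) / 2))"
      by (simp only:)
    also have "(1/2) * (cos (\<theta> - \<eta>) * exp (- (gvar \<phi> + gvar (- \<psi>) + 2 * r * inner (rep \<phi>) (rep (- \<psi>))) / 2)) + 
       (1/2) * (cos (\<theta> + \<eta>) * exp (- (gvar \<phi> + gvar \<psi> + 2 * r * inner (rep \<phi>) (rep \<psi>)) / 2)) =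
       (cos (\<theta> - \<eta>) * exp (- (gvar \<phi> + gvar \<psi>) / 2 + r * z) + cos (\<theta> + \<eta>) * exp (- (gvar \<phi> + gvar \<psi>) / 2 + - r * z)) / 2"
      unfolding gm im z_def[symmetric] by (simp add: field_simps)
    also have "(cos (\<theta> - \<eta>) * exp (- (gvar \<phi> + gvar \<psi>) / 2 + r * z) + cos (\<theta> + \<eta>) * exp (- (gvar \<phi> + gvar \<psi>) / 2 + - r * z)) / 2 =
        exp (- (gvar \<phi> + gvar \<psi>) / 2) * (cos (\<eta> - \<theta>) * exp (r * z) + cos (\<eta> + \<theta>) * exp (- r * z)) / 2"
    proof -
      have "cos (\<theta> - \<eta>) = cos (\<eta> - \<theta>)" using cos_minus[of "\<eta> - \<theta>"] by simp
      thus ?thesis unfolding exp_add by (simp add: algebra_simps)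
    qed
    also have "\<dots> = exp (- (1 - r\<^sup>2) * gvar \<phi> / 2) * (\<integral>w. cos (blinfun_apply \<psi> w + \<eta>) * cos (r * blinfun_apply \<phi> w + \<theta>) \<partial>\<mu>)"
    proof -
      have "- (gvar \<phi> + gvar \<psi>) / 2 = - (1 - r\<^sup>2) * gvar \<phi> / 2 + - (gvar \<psi> + r\<^sup>2 * gvar \<phi>) / 2" by (simp add: field_simps)
      thus ?thesis unfolding integral_cos_cos z_def[symmetric] by (simp only: exp_add)
    qed
    also have "\<dots> = (\<integral>w. mehler r (\<lambda>w. cos (blinfun_apply \<phi> w + \<theta>)) w * cos (blinfun_apply \<psi> w + \<eta>) \<partial>\<mu>)"
      unfolding mehler_cos[OF r2] integral_mult_left_commute[symmetric] by (simp only: mult.commute)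
    finally show ?case .
  next
    case (trig_add T U)
    have "?E N (\<lambda>x y. cos (blinfun_apply \<phi> x + \<theta>) * (T y + U y)) =
      ?E N (\<lambda>x y. cos (blinfun_apply \<phi> x + \<theta>) * T y) + ?E N (\<lambda>x y. cos (blinfun_apply \<phi> x + \<theta>) * U y)" for N
      by (simp add: distrib_left noisy_sign_mean_add)
    moreover have "(\<integral>w. mehler r (\<lambda>w. cos (blinfun_apply \<phi> w + \<theta>)) w * (T w + U w) \<partial>\<mu>) =
       (\<integral>w. mehler r (\<lambda>w. cos (blinfun_apply \<phi> w + \<theta>)) w * T w \<partial>\<mu>) + (\<integral>w. mehler r (\<lambda>w. cos (blinfun_apply \<phi> w + \<theta>)) w * U w \<partial>\<mu>)"
      using integrable_all_moments_mult[OF mo trig_poly_all_moments[OF trig_add(1)]]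
        integrable_all_moments_mult[OF mo trig_poly_all_moments[OF trig_add(2)]]
      by (simp add: distrib_left)
    ultimately show ?case using tendsto_add[OF trig_add.IH] by simp
  next
    case (trig_scale U c)
    have "?E N (\<lambda>x y. cos (blinfun_apply \<phi> x + \<theta>) * (c * U y)) =
      c * ?E N (\<lambda>x y. cos (blinfun_apply \<phi> x + \<theta>) * U y)" for N
      by (subst noisy_sign_mean_cmult[symmetric]) (simp only: mult.left_commute)
    thus ?case using tendsto_mult_left[OF trig_scale.IH, of c] by (simp only: integral_mult_left_commute)
  qed
next
  case (trig_add T T')
  have r2: "r\<^sup>2 \<le> 1" using r by (simp add: abs_square_le_1)
  have mo: "all_moments \<mu> (mehler r T)" if "T \<in> trig_poly {\<phi>. rep \<phi> \<in> span K}" for T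
    by (rule trig_poly_all_moments[OF mehler_trig_poly[OF trig_poly_mono[OF that] subspace_UNIV r2]]) simp
  let ?E = "\<lambda>N. noisy_sign_mean r (sign_steps hs N)"
  have "?E N (\<lambda>x y. (T x + T' x) * U y) = ?E N (\<lambda>x y. T x * U y) + ?E N (\<lambda>x y. T' x * U y)" for N
    by (simp add: distrib_right noisy_sign_mean_add)
  moreover have "(\<integral>w. mehler r (\<lambda>w. T w + T' w) w * U w \<partial>\<mu>) = (\<integral>w. mehler r T w * U w \<partial>\<mu>) + (\<integral>w. mehler r T' w * U w \<partial>\<mu>)"
    using integrable_all_moments_mult[OF mo[OF trig_add(1)] trig_poly_all_moments[OF U]]
      integrable_all_moments_mult[OF mo[OF trig_add(2)] trig_poly_all_moments[OF U]]
    by (simp add: distrib_right mehler_trig_add[OF trig_add(1,2)])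
  ultimately show ?case using tendsto_add[OF trig_add.IH] by simp
next
  case (trig_scale T c)
  let ?E = "\<lambda>N. noisy_sign_mean r (sign_steps hs N)"
  have "?E N (\<lambda>x y. (c * T x) * U y) = c * ?E N (\<lambda>x y. T x * U y)" for N
    by (subst noisy_sign_mean_cmult[symmetric]) (simp only: mult.assoc)
  moreover have "(\<integral>w. mehler r (\<lambda>w. c * T w) w * U w \<partial>\<mu>) = c * (\<integral>w. mehler r T w * U w \<partial>\<mu>)"
    by (simp add: mehler_cmult mult.assoc)
  ultimately show ?case using tendsto_mult_left[OF trig_scale.IH, of c] by simp
qed

text \<open>
  For \<open>b = mehler r T\<close> the discrete inequality, with \<open>T\<close> as first and \<open>b\<close> as second factor, becomes in the limit
  \<open>\<parallel>b\<parallel>\<^bsub>2m\<^esub>\<^bsup>2m\<^esup> \<le> \<parallel>T\<parallel>\<^sub>2 \<parallel>b\<parallel>\<^bsub>2m\<^esub>\<^bsup>2m-1\<^esup>\<close>.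
\<close>

lemma trig_poly_hypercontractive:
  assumes T: "T \<in> trig_poly UNIV" and m: "m \<ge> 1" and r: "r = 1 / (4 * real m)"
  shows "(\<integral>w. (mehler r T w) ^ (2 * m) \<partial>\<mu>) \<le> (\<integral>w. (T w)\<^sup>2 \<partial>\<mu>) ^ m"
proof -
  have r1: "\<bar>r\<bar> \<le> 1" using m by (auto simp: r field_simps)
  hence r2: "r\<^sup>2 \<le> 1" by (simp add: abs_square_le_1)
  obtain \<Psi> where \<Psi>: "finite \<Psi>" "T \<in> trig_poly \<Psi>" using trig_poly_finite_support[OF T] by blast
  define K where "K = rep ` \<Psi>"
  define \<Phi> where "\<Phi> = {\<phi>. rep \<phi> \<in> span K}"
  have \<Phi>: "subspace \<Phi>"
    by (auto simp: \<Phi>_def subspace_def rep_linear span_zero span_add span_scale)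
  obtain hs where hs: "\<And>u v. u \<in> span K \<Longrightarrow> v \<in> span K \<Longrightarrow> inner u v = (\<Sum>h\<leftarrow>hs. inner u h * inner v h)"
    using finite_parseval[of K] \<Psi>(1) by (auto simp: K_def)
  have T': "T \<in> trig_poly \<Phi>"
    by (rule trig_poly_mono[OF \<Psi>(2)]) (auto simp: \<Phi>_def K_def intro: span_base)
  define b where "b = mehler r T"
  have b: "b \<in> trig_poly \<Phi>" unfolding b_def by (rule mehler_trig_poly[OF T' \<Phi> r2])
  let ?E = "\<lambda>N. noisy_sign_mean r (sign_steps hs N)"
  have lim: "(\<lambda>N. ?E N (\<lambda>x y. F x * G y)) \<longlonglongrightarrow> (\<integral>w. mehler r F w * G w \<partial>\<mu>)"
    if "F \<in> trig_poly \<Phi>" "G \<in> trig_poly \<Phi>" for F G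
    using noisy_sign_limit[OF hs r1] that unfolding \<Phi>_def by blast
  have q: "Suc (2 * m - 1) = 2 * m" using m by simp
  have one: "(\<lambda>_. 1) \<in> trig_poly \<Phi>" by (rule trig_poly_const[OF subspace_0[OF \<Phi>]])
  have m1: "mehler r (\<lambda>_. 1) w = 1" for w using prob_space by (simp add: mehler_def)
  have l1: "(\<lambda>N. ?E N (\<lambda>x y. T x * b y ^ (2 * m - 1))) \<longlonglongrightarrow> (\<integral>w. b w * b w ^ (2 * m - 1) \<partial>\<mu>)"
    unfolding b_def by (intro lim T' trig_poly_power[OF _ \<Phi>] b[unfolded b_def])
  have l2: "(\<lambda>N. ?E N (\<lambda>x y. (F y))) \<longlonglongrightarrow> (\<integral>w. F w \<partial>\<mu>)" if "F \<in> trig_poly \<Phi>" for F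
    using lim[OF one that] by (simp add: m1)
  have l3: "(\<lambda>N. ?E N (\<lambda>x y. (T x)\<^sup>2)) \<longlonglongrightarrow> (\<integral>w. (T w)\<^sup>2 \<partial>\<mu>)"
    unfolding noisy_sign_mean_swap[of _ _ "\<lambda>x. (T x)\<^sup>2"] by (intro l2 trig_poly_power T' \<Phi>)
  have l4: "(\<lambda>N. ?E N (\<lambda>x y. b y ^ (2 * m))) \<longlonglongrightarrow> (\<integral>w. b w ^ (2 * m) \<partial>\<mu>)"
    by (intro l2 trig_poly_power b \<Phi>)
  define X where "X = (\<integral>w. b w ^ (2 * m) \<partial>\<mu>)"
  define S where "S = (\<integral>w. (T w)\<^sup>2 \<partial>\<mu>)"
  have X0: "X \<ge> 0" by (simp add: X_def)
  have bq: "b w * b w ^ (2 * m - 1) = b w ^ (2 * m)" for w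
    by (subst q[symmetric]) simp
  have "X \<le> sqrt S * root (2 * m) X ^ (2 * m - 1)"
    unfolding X_def S_def
  proof (rule LIMSEQ_le[OF l1[unfolded bq]])
    show "(\<lambda>N. sqrt (?E N (\<lambda>x y. (T x)\<^sup>2)) * root (2 * m) (?E N (\<lambda>x y. b y ^ (2 * m))) ^ (2 * m - 1)) \<longlonglongrightarrow>
       sqrt (\<integral>w. (T w)\<^sup>2 \<partial>\<mu>) * root (2 * m) (\<integral>w. b w ^ (2 * m) \<partial>\<mu>) ^ (2 * m - 1)"
      by (intro tendsto_intros l3 l4)
    show "\<exists>N0. \<forall>N\<ge>N0. ?E N (\<lambda>x y. T x * b y ^ (2 * m - 1)) \<le>
       sqrt (?E N (\<lambda>x y. (T x)\<^sup>2)) * root (2 * m) (?E N (\<lambda>x y. b y ^ (2 * m))) ^ (2 * m - 1)"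
    proof (intro exI allI impI)
      fix N
      have "T x * b y ^ (2 * m - 1) \<le> \<bar>T x\<bar> * \<bar>b y\<bar> ^ (2 * m - 1)" for x y
        by (metis abs_ge_self abs_mult power_abs)
      hence "?E N (\<lambda>x y. T x * b y ^ (2 * m - 1)) \<le> ?E N (\<lambda>x y. \<bar>T x\<bar> * \<bar>b y\<bar> ^ (2 * m - 1))"
        by (rule noisy_sign_mean_mono[OF r1])
      also have "\<dots> \<le> sqrt (?E N (\<lambda>x y. (T x)\<^sup>2)) * root (2 * m) (?E N (\<lambda>x y. b y ^ (2 * m))) ^ (2 * m - 1)"
        by (rule noisy_sign_hypercontractive[OF m r])
      finally show "?E N (\<lambda>x y. T x * b y ^ (2 * m - 1)) \<le>
       sqrt (?E N (\<lambda>x y. (T x)\<^sup>2)) * root (2 * m) (?E N (\<lambda>x y. b y ^ (2 * m))) ^ (2 * m - 1)" .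
    qed
  qed
  define \<rho> where "\<rho> = root (2 * m) X"
  have \<rho>: "\<rho> \<ge> 0" "X = \<rho> ^ (2 * m)" using X0 m by (auto simp: \<rho>_def real_root_pow_pos2)
  have S0: "S \<ge> 0" by (simp add: S_def)
  have "\<rho> \<le> sqrt S"
  proof (cases "\<rho> = 0")
    case False
    have "\<rho> * \<rho> ^ (2 * m - 1) \<le> sqrt S * \<rho> ^ (2 * m - 1)"
      using \<open>X \<le> sqrt S * root (2 * m) X ^ (2 * m - 1)\<close> \<rho>(2) q unfolding \<rho>_def[symmetric]
      by (metis power_Suc)
    thus ?thesis using False \<rho>(1) by simp
  qed (use S0 in simp)
  hence "\<rho> ^ (2 * m) \<le> sqrt S ^ (2 * m)" using \<rho>(1) by (intro power_mono)
  also have "\<dots> = S ^ m" using S0 by (simp add: power_mult)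
  finally show ?thesis unfolding \<rho>(2)[symmetric] X_def S_def b_def .
qed

text \<open>
  Dominated limits of trigonometric polynomials. They include the functionals \<open>\<phi>\<close>, as limits of
  \<open>n sin (\<phi> / n)\<close>, and hence the polynomials in the chaoses, to which hypercontractivity has to be
  extended.
\<close>

definition trig_limit :: "('w \<Rightarrow> real) \<Rightarrow> bool" where
  "trig_limit F \<longleftrightarrow> (\<exists>T D. (\<forall>n. T n \<in> trig_poly UNIV) \<and> all_moments \<mu> D \<and> (\<forall>n w. \<bar>T n w\<bar> \<le> D w) \<and>
     (\<forall>w. (\<lambda>n. T n w) \<longlonglongrightarrow> F w))"

lemma trig_limitE:
  assumes "trig_limit F"
  obtains T D where "\<And>n. T n \<in> trig_poly UNIV" "all_moments \<mu> D" "\<And>n w. \<bar>T n w\<bar> \<le> D w"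
    "\<And>w. (\<lambda>n::nat. T n w) \<longlonglongrightarrow> F w"
  using assms unfolding trig_limit_def by metis

lemma trig_limitI:
  assumes "\<And>n::nat. T n \<in> trig_poly UNIV" "all_moments \<mu> D" "\<And>n w. \<bar>T n w\<bar> \<le> D w"
    "\<And>w. (\<lambda>n. T n w) \<longlonglongrightarrow> F w"
  shows "trig_limit F"
  unfolding trig_limit_def using assms by blast

lemma all_moments_abs: "all_moments \<mu> F \<Longrightarrow> all_moments \<mu> (\<lambda>w. \<bar>F w\<bar>)"
  by (rule all_moments_bound[of \<mu> F]) (auto dest: all_momentsD(1))

lemma trig_limit_poly:
  assumes "T \<in> trig_poly UNIV"
  shows "trig_limit T"
  by (rule trig_limitI[OF _ all_moments_abs[OF trig_poly_all_moments[OF assms]]]) (use assms in auto)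

lemma trig_limit_add:
  assumes "trig_limit F" "trig_limit G"
  shows "trig_limit (\<lambda>w. F w + G w)"
proof -
  obtain T D where T: "\<And>n. T n \<in> trig_poly UNIV" "all_moments \<mu> D" "\<And>n w. \<bar>T n w\<bar> \<le> D w"
    "\<And>w. (\<lambda>n::nat. T n w) \<longlonglongrightarrow> F w" using trig_limitE[OF assms(1)] by blast
  obtain U E where U: "\<And>n. U n \<in> trig_poly UNIV" "all_moments \<mu> E" "\<And>n w. \<bar>U n w\<bar> \<le> E w"
    "\<And>w. (\<lambda>n::nat. U n w) \<longlonglongrightarrow> G w" using trig_limitE[OF assms(2)] by blast
  show ?thesis
  proof (rule trig_limitI)
    show "(\<lambda>w. T n w + U n w) \<in> trig_poly UNIV" for n by (rule trig_add[OF T(1) U(1)])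
    show "all_moments \<mu> (\<lambda>w. D w + E w)" by (rule all_moments_add[OF T(2) U(2)])
    show "\<bar>T n w + U n w\<bar> \<le> D w + E w" for n w using T(3)[of n w] U(3)[of n w] by linarith
    show "(\<lambda>n. T n w + U n w) \<longlonglongrightarrow> F w + G w" for w by (rule tendsto_add[OF T(4) U(4)])
  qed
qed

lemma trig_limit_mult:
  assumes "trig_limit F" "trig_limit G"
  shows "trig_limit (\<lambda>w. F w * G w)"
proof -
  obtain T D where T: "\<And>n. T n \<in> trig_poly UNIV" "all_moments \<mu> D" "\<And>n w. \<bar>T n w\<bar> \<le> D w"
    "\<And>w. (\<lambda>n::nat. T n w) \<longlonglongrightarrow> F w" using trig_limitE[OF assms(1)] by blast
  obtain U E where U: "\<And>n. U n \<in> trig_poly UNIV" "all_moments \<mu> E" "\<And>n w. \<bar>U n w\<bar> \<le> E w"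
    "\<And>w. (\<lambda>n::nat. U n w) \<longlonglongrightarrow> G w" using trig_limitE[OF assms(2)] by blast
  show ?thesis
  proof (rule trig_limitI)
    show "(\<lambda>w. T n w * U n w) \<in> trig_poly UNIV" for n by (rule trig_poly_mult[OF T(1) U(1) subspace_UNIV])
    show "all_moments \<mu> (\<lambda>w. D w * E w)" by (rule all_moments_mult[OF T(2) U(2)])
    show "\<bar>T n w * U n w\<bar> \<le> D w * E w" for n w
      unfolding abs_mult using T(3)[of n w] U(3)[of n w] by (intro mult_mono) auto
    show "(\<lambda>n. T n w * U n w) \<longlonglongrightarrow> F w * G w" for w by (rule tendsto_mult[OF T(4) U(4)])
  qed
qed

lemma trig_limit_const: "trig_limit (\<lambda>_. c)"
  by (intro trig_limit_poly trig_poly_const) simp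

lemma trig_limit_cmult: "trig_limit F \<Longrightarrow> trig_limit (\<lambda>w. c * F w)"
  by (rule trig_limit_mult[OF trig_limit_const])

lemma trig_limit_functional: "trig_limit (blinfun_apply \<phi>)"
proof (rule trig_limitI)
  show "(\<lambda>w. real (Suc n) * sin (blinfun_apply ((1 / real (Suc n)) *\<^sub>R \<phi>) w)) \<in> trig_poly UNIV" for n
    by (intro trig_scale trig_poly_sin) simp
  show "all_moments \<mu> (\<lambda>w. \<bar>blinfun_apply \<phi> w\<bar>)" by (rule all_moments_abs[OF all_moments_functional])
  show "\<bar>real (Suc n) * sin (blinfun_apply ((1 / real (Suc n)) *\<^sub>R \<phi>) w)\<bar> \<le> \<bar>blinfun_apply \<phi> w\<bar>" for n w
  proof -
    have "\<bar>sin (blinfun_apply \<phi> w / real (Suc n))\<bar> \<le> \<bar>blinfun_apply \<phi> w / real (Suc n)\<bar>"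
      by (rule abs_sin_x_le_abs_x)
    hence "real (Suc n) * \<bar>sin (blinfun_apply \<phi> w / real (Suc n))\<bar> \<le> real (Suc n) * \<bar>blinfun_apply \<phi> w / real (Suc n)\<bar>"
      by (intro mult_left_mono) auto
    thus ?thesis by (simp add: blinfun.scaleR_left abs_mult del: of_nat_Suc)
  qed
  show "(\<lambda>n. real (Suc n) * sin (blinfun_apply ((1 / real (Suc n)) *\<^sub>R \<phi>) w)) \<longlonglongrightarrow> blinfun_apply \<phi> w" for w
    unfolding blinfun.scaleR_left real_scaleR_def by real_asymp
qed

lemma trig_limit_hermite: "trig_limit (wiener_hermite n \<phi>)"
proof -
  have "trig_limit (\<lambda>w. hermite s n (blinfun_apply \<phi> w))" for s
  proof (induction n rule: less_induct)
    case (less n)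
    consider "n = 0" | "n = 1" | k where "n = Suc (Suc k)" by (metis One_nat_def not0_implies_Suc)
    thus ?case
    proof cases
      case (3 k)
      have "trig_limit (\<lambda>w. blinfun_apply \<phi> w * hermite s (Suc k) (blinfun_apply \<phi> w)
          + (- (real (Suc k) * s)) * hermite s k (blinfun_apply \<phi> w))"
        using 3 by (intro trig_limit_add trig_limit_mult trig_limit_cmult trig_limit_functional less) auto
      thus ?thesis unfolding 3 hermite.simps by simp
    next
      case 1
      thus ?thesis by (simp add: trig_limit_const)
    next
      case 2
      thus ?thesis using trig_limit_functional by simp
    qed
  qed
  thus ?thesis unfolding wiener_hermite_def .
qed

lemma trig_limit_simple_chaos:
  assumes "S \<in> simple_chaos \<iota> n" shows "trig_limit S"
  using assms
proof (induction rule: simple_chaos_induct)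
  case (add S a \<phi>)
  show ?case by (intro trig_limit_add trig_limit_cmult trig_limit_hermite add(2))
qed (rule trig_limit_const)

lemma trig_limit_all_moments:
  assumes "trig_limit F" shows "all_moments \<mu> F"
proof -
  obtain T D where T: "\<And>n. T n \<in> trig_poly UNIV" "all_moments \<mu> D" "\<And>n w. \<bar>T n w\<bar> \<le> D w"
    "\<And>w. (\<lambda>n::nat. T n w) \<longlonglongrightarrow> F w" using trig_limitE[OF assms] by blast
  show ?thesis
  proof (rule all_moments_bound[OF T(2)])
    show "F \<in> borel_measurable \<mu>"
      by (rule borel_measurable_LIMSEQ_real[OF T(4)]) (simp add: borel_mu trig_poly_measurable[OF T(1)])
    show "\<bar>F w\<bar> \<le> \<bar>D w\<bar>" for w
      by (rule LIMSEQ_le_const2[OF tendsto_rabs[OF T(4)]]) (use T(3) order_trans abs_ge_self in blast)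
  qed
qed

text \<open>
  Fatou's lemma on the left, dominated convergence on the right.
\<close>

lemma trig_limit_hypercontractive:
  assumes F: "trig_limit F" and m: "m \<ge> 1" and r: "r = 1 / (4 * real m)"
  shows "integrable \<mu> (\<lambda>w. mehler r F w ^ (2 * m))"
    and "(\<integral>w. mehler r F w ^ (2 * m) \<partial>\<mu>) \<le> (\<integral>w. (F w)\<^sup>2 \<partial>\<mu>) ^ m"
proof -
  obtain T D where T: "\<And>n. T n \<in> trig_poly UNIV" "all_moments \<mu> D" "\<And>n w. \<bar>T n w\<bar> \<le> D w"
    "\<And>w. (\<lambda>n::nat. T n w) \<longlonglongrightarrow> F w" using trig_limitE[OF F] by blast
  have r1: "\<bar>r\<bar> \<le> 1" using m by (auto simp: r field_simps)
  hence r2: "r\<^sup>2 \<le> 1" by (simp add: abs_square_le_1)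
  have Tm [measurable]: "T n \<in> borel_measurable borel" for n by (rule trig_poly_measurable[OF T(1)])
  have Fm [measurable]: "F \<in> borel_measurable borel"
    using all_momentsD(1)[OF trig_limit_all_moments[OF F]] by (simp add: borel_mu)
  have [measurable]: "mehler r F \<in> borel_measurable borel" "mehler r (T n) \<in> borel_measurable borel" for n
    by (intro mehler_measurable Tm Fm)+
  have lim: "AE w in \<mu>. (\<lambda>n. mehler r (T n) w) \<longlonglongrightarrow> mehler r F w"
    using mehler_integrable(2)[OF r2 all_momentsD(4)[OF T(2)]]
  proof eventually_elim
    case (elim w)
    show ?case unfolding mehler_def
      by (rule integral_dominated_convergence[OF _ _ elim]) (use T in auto)
  qed
  have "(\<lambda>n. \<integral>w. (T n w)\<^sup>2 \<partial>\<mu>) \<longlonglongrightarrow> (\<integral>w. (F w)\<^sup>2 \<partial>\<mu>)"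
  proof (rule integral_dominated_convergence[OF _ _ all_momentsD(3)[OF T(2), of 2]])
    show "AE w in \<mu>. norm ((T n w)\<^sup>2) \<le> (D w)\<^sup>2" for n
      using power_mono[OF T(3) abs_ge_zero, of _ _ 2] by simp
  qed (use T(4) in \<open>auto intro!: tendsto_intros\<close>)
  hence limS: "(\<lambda>n. ennreal ((\<integral>w. (T n w)\<^sup>2 \<partial>\<mu>) ^ m)) \<longlonglongrightarrow> ennreal ((\<integral>w. (F w)\<^sup>2 \<partial>\<mu>) ^ m)"
    by (intro tendsto_ennrealI tendsto_power)
  have "(\<integral>\<^sup>+ w. ennreal (mehler r F w ^ (2 * m)) \<partial>\<mu>) = (\<integral>\<^sup>+ w. liminf (\<lambda>n. ennreal (mehler r (T n) w ^ (2 * m))) \<partial>\<mu>)"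
  proof (rule nn_integral_cong_AE)
    show "AE w in \<mu>. ennreal (mehler r F w ^ (2 * m)) = liminf (\<lambda>n. ennreal (mehler r (T n) w ^ (2 * m)))"
      using lim
    proof eventually_elim
      case (elim w)
      show ?case
        by (rule lim_imp_Liminf[symmetric]) (auto intro!: tendsto_ennrealI tendsto_power elim)
    qed
  qed
  also have "\<dots> \<le> liminf (\<lambda>n. \<integral>\<^sup>+ w. ennreal (mehler r (T n) w ^ (2 * m)) \<partial>\<mu>)"
    by (rule nn_integral_liminf) measurable
  also have "\<dots> \<le> liminf (\<lambda>n. ennreal ((\<integral>w. (T n w)\<^sup>2 \<partial>\<mu>) ^ m))"
  proof (rule Liminf_mono, intro always_eventually allI)
    fix n
    have "(\<integral>\<^sup>+ w. ennreal (mehler r (T n) w ^ (2 * m)) \<partial>\<mu>) = ennreal (\<integral>w. mehler r (T n) w ^ (2 * m) \<partial>\<mu>)"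
      by (rule nn_integral_eq_integral)
         (auto intro!: all_momentsD(3) trig_poly_all_moments mehler_trig_poly[OF T(1) subspace_UNIV r2])
    also have "\<dots> \<le> ennreal ((\<integral>w. (T n w)\<^sup>2 \<partial>\<mu>) ^ m)"
      by (intro ennreal_leI trig_poly_hypercontractive T m r)
    finally show "(\<integral>\<^sup>+ w. ennreal (mehler r (T n) w ^ (2 * m)) \<partial>\<mu>) \<le> ennreal ((\<integral>w. (T n w)\<^sup>2 \<partial>\<mu>) ^ m)" .
  qed
  also have "\<dots> = ennreal ((\<integral>w. (F w)\<^sup>2 \<partial>\<mu>) ^ m)" by (rule lim_imp_Liminf[OF _ limS]) simp
  finally have fin: "(\<integral>\<^sup>+ w. ennreal (mehler r F w ^ (2 * m)) \<partial>\<mu>) \<le> ennreal ((\<integral>w. (F w)\<^sup>2 \<partial>\<mu>) ^ m)" .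
  show i: "integrable \<mu> (\<lambda>w. mehler r F w ^ (2 * m))"
    by (rule integrableI_nonneg) (auto intro: le_less_trans[OF fin])
  have "ennreal (\<integral>w. mehler r F w ^ (2 * m) \<partial>\<mu>) \<le> ennreal ((\<integral>w. (F w)\<^sup>2 \<partial>\<mu>) ^ m)"
    using fin by (subst (asm) nn_integral_eq_integral[OF i]) auto
  thus "(\<integral>w. mehler r F w ^ (2 * m) \<partial>\<mu>) \<le> (\<integral>w. (F w)\<^sup>2 \<partial>\<mu>) ^ m" by simp
qed

section \<open>Smoothing functions orthogonal to the low chaoses\<close>

text \<open>
  With \<open>N k\<close> the squared norm of \<open>J k\<close>, the squared norm of \<open>T\<close> is \<open>\<Sum>k. N k\<close> and that of \<open>R\<close> is the
  sum of \<open>\<rho>\<^bsup>2k\<^esup> N k\<close> over \<open>k \<ge> d\<close>. Both follow by testing the expansion against the \<open>J k\<close> and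
  then against \<open>T\<close> and \<open>R\<close>.
\<close>

lemma chaos_remainder_bound:
  fixes d :: nat
  assumes J: "\<And>k. J k \<in> simple_chaos \<iota> k"
    and ex: "\<And>u t. sq_integrable u \<Longrightarrow> t\<^sup>2 \<le> 1 \<Longrightarrow> (\<lambda>k. t ^ k * (\<integral>w. u w * J k w \<partial>\<mu>)) sums (\<integral>w. u w * mehler t T w \<partial>\<mu>)"
    and T: "T \<in> trig_poly UNIV" and \<rho>: "0 \<le> \<rho>" "\<rho> \<le> 1"
  defines "R \<equiv> \<lambda>w. mehler \<rho> T w - (\<Sum>k<d. \<rho> ^ k * J k w)"
  shows "(\<integral>w. (R w)\<^sup>2 \<partial>\<mu>) \<le> (\<rho> ^ d)\<^sup>2 * (\<integral>w. (T w)\<^sup>2 \<partial>\<mu>)"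
proof -
  define N where "N k = (\<integral>w. (J k w)\<^sup>2 \<partial>\<mu>)" for k
  have r2: "\<rho>\<^sup>2 \<le> 1" using \<rho> by (simp add: abs_square_le_1)
  have Jm: "all_moments \<mu> (J k)" for k by (rule all_moments_simple_chaos[OF J])
  have Mm: "all_moments \<mu> (mehler \<rho> T)" by (rule trig_poly_all_moments[OF mehler_trig_poly[OF T subspace_UNIV r2]])
  have Tm: "all_moments \<mu> T" by (rule trig_poly_all_moments[OF T])
  have orth: "(\<integral>w. J k w * J l w \<partial>\<mu>) = (if k = l then N k else 0)" for k l
    using simple_chaos_orthogonal[OF J J, of k l] by (auto simp: N_def power2_eq_square)
  have single: "(\<integral>w. J k w * mehler t T w \<partial>\<mu>) = t ^ k * N k" if "t\<^sup>2 \<le> 1" for t k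
  proof -
    have "(\<lambda>l. t ^ l * (\<integral>w. J k w * J l w \<partial>\<mu>)) = (\<lambda>l. if l = k then t ^ l * N l else 0)"
      by (auto simp: orth)
    thus ?thesis using ex[OF all_moments_sq[OF Jm] that, of k] sums_single[of k "\<lambda>l. t ^ l * N l"]
      by (simp add: sums_unique2)
  qed
  have m1: "mehler 1 T w = T w" for w using prob_space by (simp add: mehler_def)
  have "(\<lambda>k. N k) sums (\<integral>w. (T w)\<^sup>2 \<partial>\<mu>)"
  proof -
    have "(\<integral>w. T w * J k w \<partial>\<mu>) = N k" for k using single[of 1 k] by (simp add: m1 mult.commute)
    thus ?thesis using ex[OF all_moments_sq[OF Tm], of 1] by (simp add: m1 power2_eq_square)
  qed
  hence sT: "(\<lambda>k. (\<rho> ^ d)\<^sup>2 * N k) sums ((\<rho> ^ d)\<^sup>2 * (\<integral>w. (T w)\<^sup>2 \<partial>\<mu>))" by (rule sums_mult)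
  have summ: "all_moments \<mu> (\<lambda>w. \<Sum>k<n. \<rho> ^ k * J k w)" for n
  proof (induction n)
    case (Suc n)
    show ?case using all_moments_add[OF Suc.IH all_moments_cmult[OF Jm]] by simp
  qed (simp add: all_moments_zero)
  have Rm: "all_moments \<mu> R"
    unfolding R_def using all_moments_add[OF Mm all_moments_cmult[OF summ, of "-1" d]] by simp
  have RJ: "(\<integral>w. R w * J k w \<partial>\<mu>) = (if k < d then 0 else \<rho> ^ k * N k)" for k
  proof -
    have i: "integrable \<mu> (\<lambda>w. mehler \<rho> T w * J k w)" "integrable \<mu> (\<lambda>w. J l w * J k w)" for l
      by (intro integrable_all_moments_mult Mm Jm)+
    have "(\<integral>w. R w * J k w \<partial>\<mu>) = (\<integral>w. mehler \<rho> T w * J k w - (\<Sum>l<d. \<rho> ^ l * (J l w * J k w)) \<partial>\<mu>)"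
      by (simp add: R_def left_diff_distrib sum_distrib_right mult.assoc)
    also have "\<dots> = \<rho> ^ k * N k - (\<Sum>l<d. \<rho> ^ l * (if l = k then N l else 0))"
      using i single[OF r2, of k] by (simp add: orth mult.commute)
    also have "(\<Sum>l<d. \<rho> ^ l * (if l = k then N l else 0)) = (if k < d then \<rho> ^ k * N k else 0)"
      by (simp add: if_distrib[of "\<lambda>x. _ * x"] cong: if_cong)
    finally show ?thesis by simp
  qed
  have "(\<lambda>k. \<rho> ^ k * (if k < d then 0 else \<rho> ^ k * N k)) sums (\<integral>w. R w * mehler \<rho> T w \<partial>\<mu>)"
    using ex[OF all_moments_sq[OF Rm] r2] by (simp only: RJ)
  moreover have "(\<integral>w. R w * mehler \<rho> T w \<partial>\<mu>) = (\<integral>w. (R w)\<^sup>2 \<partial>\<mu>)"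
  proof -
    have i: "integrable \<mu> (\<lambda>w. (R w)\<^sup>2)" "integrable \<mu> (\<lambda>w. R w * J l w)" for l
      by (intro all_momentsD(3) Rm, intro integrable_all_moments_mult Rm Jm)
    have "R w * mehler \<rho> T w = (R w)\<^sup>2 + (\<Sum>l<d. \<rho> ^ l * (R w * J l w))" for w
    proof -
      have "mehler \<rho> T w = R w + (\<Sum>l<d. \<rho> ^ l * J l w)" by (simp add: R_def)
      thus ?thesis by (simp only: distrib_left power2_eq_square sum_distrib_left mult.left_commute)
    qed
    hence "(\<integral>w. R w * mehler \<rho> T w \<partial>\<mu>) = (\<integral>w. (R w)\<^sup>2 \<partial>\<mu>) + (\<Sum>l<d. \<rho> ^ l * (\<integral>w. R w * J l w \<partial>\<mu>))"
      using i by simp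
    thus ?thesis by (simp add: RJ)
  qed
  ultimately have sR: "(\<lambda>k. \<rho> ^ k * (if k < d then 0 else \<rho> ^ k * N k)) sums (\<integral>w. (R w)\<^sup>2 \<partial>\<mu>)" by simp
  show ?thesis
  proof (rule sums_le[OF _ sR sT])
    fix k
    have N0: "N k \<ge> 0" by (simp add: N_def)
    show "\<rho> ^ k * (if k < d then 0 else \<rho> ^ k * N k) \<le> (\<rho> ^ d)\<^sup>2 * N k"
    proof (cases "k < d")
      case False
      hence "\<rho> ^ k \<le> \<rho> ^ d" using \<rho> by (intro power_decreasing) auto
      hence "(\<rho> ^ k)\<^sup>2 \<le> (\<rho> ^ d)\<^sup>2" using \<rho> by (intro power_mono) auto
      thus ?thesis using False N0 by (simp add: power2_eq_square mult_right_mono flip: mult.assoc)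
    qed (use N0 in simp)
  qed
qed

lemma mehler_mehler_trig:
  assumes "T \<in> trig_poly UNIV" and s: "s\<^sup>2 \<le> 1" and t: "t\<^sup>2 \<le> 1"
  shows "mehler s (mehler t T) w = mehler (s * t) T w"
  using assms(1)
proof induction
  case (trig_cos \<phi> \<theta>)
  have st: "(s * t)\<^sup>2 \<le> 1" using mult_mono[OF s t] by (simp add: power_mult_distrib)
  have "mehler t (\<lambda>w. cos (blinfun_apply \<phi> w + \<theta>)) = (\<lambda>w. exp (- (1 - t\<^sup>2) * gvar \<phi> / 2) * cos (blinfun_apply (t *\<^sub>R \<phi>) w + \<theta>))"
    by (rule ext) (simp add: mehler_cos[OF t] blinfun.scaleR_left)
  hence "mehler s (mehler t (\<lambda>w. cos (blinfun_apply \<phi> w + \<theta>))) w =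
     exp (- (1 - t\<^sup>2) * gvar \<phi> / 2) * (exp (- (1 - s\<^sup>2) * gvar (t *\<^sub>R \<phi>) / 2) * cos (s * blinfun_apply (t *\<^sub>R \<phi>) w + \<theta>))"
    by (simp only: mehler_cmult mehler_cos[OF s])
  also have "\<dots> = exp (- (1 - (s * t)\<^sup>2) * gvar \<phi> / 2) * cos (s * t * blinfun_apply \<phi> w + \<theta>)"
  proof -
    have "- (1 - t\<^sup>2) * gvar \<phi> / 2 + - (1 - s\<^sup>2) * gvar (t *\<^sub>R \<phi>) / 2 = - (1 - (s * t)\<^sup>2) * gvar \<phi> / 2"
      unfolding gvar_scaleR by (simp add: field_simps power_mult_distrib)
    thus ?thesis by (simp add: blinfun.scaleR_left mult.assoc flip: exp_add)
  qed
  finally show ?case unfolding mehler_cos[OF st] .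
next
  case (trig_add T U)
  have "mehler t (\<lambda>w. T w + U w) = (\<lambda>w. mehler t T w + mehler t U w)"
    by (rule ext) (rule mehler_trig_add[OF trig_add(1,2)])
  thus ?case
    using mehler_trig_add[OF mehler_trig_poly[OF trig_add(1) subspace_UNIV t] mehler_trig_poly[OF trig_add(2) subspace_UNIV t]]
      mehler_trig_add[OF trig_add(1,2)] trig_add.IH by simp
next
  case (trig_scale T c)
  have "mehler t (\<lambda>w. c * T w) = (\<lambda>w. c * mehler t T w)" by (rule ext) (rule mehler_cmult)
  thus ?case using trig_scale.IH by (simp add: mehler_cmult)
qed

lemma gaussian_moments: "(\<integral>w. blinfun_apply \<phi> w \<partial>\<mu>) = 0" "(\<integral>w. (blinfun_apply \<phi> w)\<^sup>2 \<partial>\<mu>) = gvar \<phi>"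
proof -
  have "(\<integral>w. wiener_hermite 1 \<phi> w * wiener_hermite 0 \<phi> w \<partial>\<mu>) = 0" by (rule hermite_orthogonal) simp
  thus "(\<integral>w. blinfun_apply \<phi> w \<partial>\<mu>) = 0" by (simp add: wiener_hermite_def)
  have "(\<integral>w. wiener_hermite 2 \<phi> w * wiener_hermite 0 \<phi> w \<partial>\<mu>) = 0" by (rule hermite_orthogonal) simp
  hence "(\<integral>w. (blinfun_apply \<phi> w)\<^sup>2 - gvar \<phi> \<partial>\<mu>) = 0"
    by (simp add: wiener_hermite_def numeral_2_eq_2 power2_eq_square)
  thus "(\<integral>w. (blinfun_apply \<phi> w)\<^sup>2 \<partial>\<mu>) = gvar \<phi>"
    using all_momentsD(3)[OF all_moments_functional, of \<phi> 2] prob_space by simp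
qed

text \<open>
  The orders 0, 1 and 2 are those removed from \<open>T\<close> in the final estimate; for them the first two moments
  of a functional are enough.
\<close>

lemma mehler_hermite:
  assumes t: "t\<^sup>2 \<le> 1" and n: "n < 3"
  shows "mehler t (wiener_hermite n \<phi>) w = t ^ n * wiener_hermite n \<phi> w"
proof -
  define s where "s = sqrt (1 - t\<^sup>2)"
  have s2: "s\<^sup>2 = 1 - t\<^sup>2" using t by (simp add: s_def)
  have i: "integrable \<mu> (blinfun_apply \<phi>)" "integrable \<mu> (\<lambda>w. (blinfun_apply \<phi> w)\<^sup>2)"
    using all_momentsD(3,4)[OF all_moments_functional] by auto
  consider "n = 0" | "n = 1" | "n = 2" using n by linarith
  thus ?thesis
  proof cases
    case 1
    thus ?thesis using prob_space by (simp add: mehler_def wiener_hermite_def)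
  next
    case 2
    have "mehler t (wiener_hermite 1 \<phi>) w = (\<integral>w'. t * blinfun_apply \<phi> w + s * blinfun_apply \<phi> w' \<partial>\<mu>)"
      by (simp add: mehler_def wiener_hermite_def s_def blinfun.add_right blinfun.scaleR_right)
    also have "\<dots> = t * blinfun_apply \<phi> w" using i prob_space by (simp add: gaussian_moments)
    finally show ?thesis using 2 by (simp add: wiener_hermite_def)
  next
    case 3
    have h2: "wiener_hermite 2 \<phi> w = (blinfun_apply \<phi> w)\<^sup>2 - gvar \<phi>" for w
      by (simp add: wiener_hermite_def numeral_2_eq_2 power2_eq_square)
    have "mehler t (wiener_hermite 2 \<phi>) w = (\<integral>w'. (t * blinfun_apply \<phi> w)\<^sup>2 - gvar \<phi> +
        (2 * t * s * blinfun_apply \<phi> w) * blinfun_apply \<phi> w' + s\<^sup>2 * (blinfun_apply \<phi> w')\<^sup>2 \<partial>\<mu>)"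
      unfolding mehler_def h2 s_def[symmetric]
      by (intro Bochner_Integration.integral_cong refl)
         (simp add: blinfun.add_right blinfun.scaleR_right power2_eq_square algebra_simps)
    also have "\<dots> = (t * blinfun_apply \<phi> w)\<^sup>2 - gvar \<phi> + s\<^sup>2 * gvar \<phi>"
      using i prob_space by (simp add: gaussian_moments)
    also have "\<dots> = t\<^sup>2 * wiener_hermite 2 \<phi> w"
      unfolding h2 s2 by (simp add: algebra_simps power_mult_distrib)
    finally show ?thesis using 3 by simp
  qed
qed

lemma mehler_add_AE:
  assumes t: "t\<^sup>2 \<le> 1" and "integrable \<mu> F" "integrable \<mu> G"
  shows "AE w in \<mu>. mehler t (\<lambda>w. F w + G w) w = mehler t F w + mehler t G w"
  using mehler_integrable(2)[OF t assms(2)] mehler_integrable(2)[OF t assms(3)]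
  by eventually_elim (simp add: mehler_def)

lemma mehler_simple_chaos:
  assumes t: "t\<^sup>2 \<le> 1" and n: "n < 3" and S: "S \<in> simple_chaos \<iota> n"
  shows "AE w in \<mu>. mehler t S w = t ^ n * S w"
  using S
proof (induction rule: simple_chaos_induct)
  case zero
  show ?case by (simp add: mehler_def)
next
  case (add S a \<phi>)
  have "AE w in \<mu>. mehler t (\<lambda>w. S w + a * wiener_hermite n \<phi> w) w = mehler t S w + mehler t (\<lambda>w. a * wiener_hermite n \<phi> w) w"
    by (intro mehler_add_AE t all_momentsD(4) all_moments_simple_chaos[OF add(1)] all_moments_cmult all_moments_hermite)
  thus ?case using add(2)
  proof eventually_elim
    case (elim w)
    thus ?case by (simp add: mehler_cmult mehler_hermite[OF t n] algebra_simps)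
  qed
qed

lemma low_chaos_sum:
  fixes d :: nat
  assumes t: "t\<^sup>2 \<le> 1" and J: "\<And>k. J k \<in> simple_chaos \<iota> k" and d: "d \<le> 3"
  shows "all_moments \<mu> (\<lambda>w. \<Sum>k<d. c k * J k w)" and "trig_limit (\<lambda>w. \<Sum>k<d. c k * J k w)"
    and "AE w in \<mu>. mehler t (\<lambda>w. \<Sum>k<d. c k * J k w) w = (\<Sum>k<d. c k * t ^ k * J k w)"
proof -
  have "all_moments \<mu> (\<lambda>w. \<Sum>k<d. c k * J k w) \<and> trig_limit (\<lambda>w. \<Sum>k<d. c k * J k w) \<and>
    (AE w in \<mu>. mehler t (\<lambda>w. \<Sum>k<d. c k * J k w) w = (\<Sum>k<d. c k * t ^ k * J k w))"
    using d
  proof (induction d)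
    case 0
    show ?case by (simp add: all_moments_zero trig_limit_const mehler_def)
  next
    case (Suc d)
    have IH: "all_moments \<mu> (\<lambda>w. \<Sum>k<d. c k * J k w)" "trig_limit (\<lambda>w. \<Sum>k<d. c k * J k w)"
      "AE w in \<mu>. mehler t (\<lambda>w. \<Sum>k<d. c k * J k w) w = (\<Sum>k<d. c k * t ^ k * J k w)"
      using Suc by auto
    have Jm: "all_moments \<mu> (\<lambda>w. c d * J d w)" by (intro all_moments_cmult all_moments_simple_chaos[OF J])
    have "AE w in \<mu>. mehler t (\<lambda>w. (\<Sum>k<d. c k * J k w) + c d * J d w) w = 
        mehler t (\<lambda>w. \<Sum>k<d. c k * J k w) w + mehler t (\<lambda>w. c d * J d w) w"
      by (intro mehler_add_AE t all_momentsD(4)[OF IH(1)] all_momentsD(4)[OF Jm])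
    moreover have "AE w in \<mu>. mehler t (J d) w = t ^ d * J d w"
      using Suc.prems by (intro mehler_simple_chaos t J) auto
    ultimately have "AE w in \<mu>. mehler t (\<lambda>w. \<Sum>k<Suc d. c k * J k w) w = (\<Sum>k<Suc d. c k * t ^ k * J k w)"
      using IH(3) by eventually_elim (simp add: mehler_cmult mult.assoc)
    thus ?case
      using all_moments_add[OF IH(1) Jm] trig_limit_add[OF IH(2) trig_limit_cmult[OF trig_limit_simple_chaos[OF J]]]
      by simp
  qed
  thus "all_moments \<mu> (\<lambda>w. \<Sum>k<d. c k * J k w)" "trig_limit (\<lambda>w. \<Sum>k<d. c k * J k w)"
    "AE w in \<mu>. mehler t (\<lambda>w. \<Sum>k<d. c k * J k w) w = (\<Sum>k<d. c k * t ^ k * J k w)"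
    by blast+
qed

text \<open>
  With \<open>r = r0 \<rho>\<close> and \<open>r0 = 1 / (4 m)\<close>, apply \<open>\<Gamma>(\<rho>)\<close> first: removing the orders 0, 1, 2 from \<open>\<Gamma>(\<rho>) T\<close> leaves a
  function \<open>R\<close> whose \<open>L\<^sup>2\<close> norm is at most \<open>\<rho>\<^sup>3\<close> times that of \<open>T\<close>. Then \<open>\<Gamma>(r0)\<close> maps \<open>R\<close> to \<open>L\<^bsup>2m\<^esup>\<close>, which is
  in duality with \<open>L\<^sup>p\<close>, and keeps the removed part within the chaoses orthogonal to \<open>G\<close>.
\<close>

lemma smoothing_bound_trig:
  assumes p: "p > 1" "p / (p - 1) \<le> real (2 * m)" and m: "m \<ge> 1" and G: "G \<in> Lp \<mu> p"
    and orth: "\<And>n S. n < 3 \<Longrightarrow> S \<in> simple_chaos \<iota> n \<Longrightarrow> (\<integral>w. G w * S w \<partial>\<mu>) = 0"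
    and T: "T \<in> trig_poly UNIV" and r: "0 \<le> r" "4 * real m * r \<le> 1"
  shows "\<bar>\<integral>w. G w * mehler r T w \<partial>\<mu>\<bar> \<le>
    ((\<integral>w. \<bar>G w\<bar> powr p \<partial>\<mu>) + 2) * ((4 * real m * r) ^ 3 * sqrt (\<integral>w. (T w)\<^sup>2 \<partial>\<mu>))"
proof -
  define r0 where "r0 = 1 / (4 * real m)"
  define \<rho> where "\<rho> = 4 * real m * r"
  have \<rho>: "0 \<le> \<rho>" "\<rho> \<le> 1" using r by (auto simp: \<rho>_def)
  have r\<rho>: "r = r0 * \<rho>" using m by (simp add: r0_def \<rho>_def)
  have r0: "0 \<le> r0" "r0 \<le> 1" using m by (auto simp: r0_def field_simps)
  have sq: "r0\<^sup>2 \<le> 1" "\<rho>\<^sup>2 \<le> 1" using r0 \<rho> by (simp_all add: abs_square_le_1)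
  have "r \<le> 1" unfolding r\<rho> using mult_mono[OF r0(2) \<rho>(2)] \<rho> by simp
  hence sqr: "r\<^sup>2 \<le> 1" using r by (simp add: abs_square_le_1)
  obtain J where J: "\<And>k. J k \<in> simple_chaos \<iota> k"
    and ex: "\<And>u t. sq_integrable u \<Longrightarrow> t\<^sup>2 \<le> 1 \<Longrightarrow> (\<lambda>k. t ^ k * (\<integral>w. u w * J k w \<partial>\<mu>)) sums (\<integral>w. u w * mehler t T w \<partial>\<mu>)"
    using trig_poly_chaos_expansion[OF T] by metis
  define S where "S w = (\<Sum>k<3. \<rho> ^ k * J k w)" for w
  define R where "R w = mehler \<rho> T w - S w" for w
  define Y where "Y = mehler r0 R"
  define I where "I = (\<integral>w. (T w)\<^sup>2 \<partial>\<mu>)"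
  define \<kappa> where "\<kappa> = \<rho> ^ 3 * sqrt I"
  define K where "K = (\<integral>w. \<bar>G w\<bar> powr p \<partial>\<mu>)"
  have I0: "I \<ge> 0" and K0: "K \<ge> 0" by (auto simp: I_def K_def)
  have \<kappa>0: "\<kappa> \<ge> 0" using \<rho> I0 by (simp add: \<kappa>_def)
  have sumS: "all_moments \<mu> S" "trig_limit S" "AE w in \<mu>. mehler r0 S w = (\<Sum>k<3. \<rho> ^ k * r0 ^ k * J k w)"
    unfolding S_def by (rule low_chaos_sum[OF sq(1) J order_refl])+
  have mT: "mehler \<rho> T \<in> trig_poly UNIV" by (rule mehler_trig_poly[OF T subspace_UNIV sq(2)])
  have R: "trig_limit R"
    unfolding R_def using trig_limit_add[OF trig_limit_poly[OF mT] trig_limit_cmult[OF sumS(2), of "-1"]] by simp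
  have R2: "(\<integral>w. (R w)\<^sup>2 \<partial>\<mu>) \<le> \<kappa>\<^sup>2"
    using chaos_remainder_bound[OF J ex T \<rho>, of 3] I0
    by (simp add: R_def S_def \<kappa>_def power_mult_distrib I_def)
  have Yi: "integrable \<mu> (\<lambda>w. Y w ^ (2 * m))" and Y2: "(\<integral>w. Y w ^ (2 * m) \<partial>\<mu>) \<le> (\<integral>w. (R w)\<^sup>2 \<partial>\<mu>) ^ m"
    unfolding Y_def by (rule trig_limit_hypercontractive[OF R m r0_def])+
  have "(\<integral>w. (R w)\<^sup>2 \<partial>\<mu>) ^ m \<le> (\<kappa>\<^sup>2) ^ m" by (intro power_mono R2) simp
  hence Y\<kappa>: "(\<integral>w. Y w ^ (2 * m) \<partial>\<mu>) \<le> \<kappa> ^ (2 * m)" using Y2 by (simp add: power_mult)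
  have Ym: "Y \<in> borel_measurable \<mu>"
    unfolding Y_def borel_mu using all_momentsD(1)[OF trig_limit_all_moments[OF R]]
    by (intro mehler_measurable) (simp add: borel_mu)
  have Gm [measurable]: "G \<in> borel_measurable \<mu>" using G by (simp add: Lp_def)
  note Lpm = Lp_mult_integrable[OF finite_measure_axioms p G]
  have mrT: "all_moments \<mu> (mehler r T)"
    by (rule trig_poly_all_moments[OF mehler_trig_poly[OF T subspace_UNIV sqr]])
  have Jm: "all_moments \<mu> (J k)" for k by (rule all_moments_simple_chaos[OF J])
  have "AE w in \<mu>. mehler r0 (\<lambda>w. R w + S w) w = mehler r0 R w + mehler r0 S w"
    by (intro mehler_add_AE sq all_momentsD(4)[OF trig_limit_all_moments[OF R]] all_momentsD(4)[OF sumS(1)])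
  moreover have RS: "mehler r0 (\<lambda>w. R w + S w) w = mehler r T w" for w
    using mehler_mehler_trig[OF T sq] by (simp add: R_def r\<rho>)
  ultimately have "AE w in \<mu>. mehler r T w = Y w + mehler r0 S w" by (simp only: Y_def RS)
  hence YAE: "AE w in \<mu>. Y w = mehler r T w - (\<Sum>k<3. r ^ k * J k w)"
    using sumS(3) by eventually_elim (simp add: r\<rho> power_mult_distrib mult.commute)
  have "(\<integral>w. G w * Y w \<partial>\<mu>) = (\<integral>w. G w * mehler r T w - (\<Sum>k<3. r ^ k * (G w * J k w)) \<partial>\<mu>)"
  proof (rule integral_cong_AE)
    show "AE w in \<mu>. G w * Y w = G w * mehler r T w - (\<Sum>k<3. r ^ k * (G w * J k w))"
      using YAE by eventually_elim (simp add: right_diff_distrib sum_distrib_left mult.left_commute)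
    show "(\<lambda>w. G w * Y w) \<in> borel_measurable \<mu>" using Ym by measurable
    show "(\<lambda>w. G w * mehler r T w - (\<Sum>k<3. r ^ k * (G w * J k w))) \<in> borel_measurable \<mu>"
      using all_momentsD(1)[OF mrT] all_momentsD(1)[OF Jm] by measurable
  qed
  also have "\<dots> = (\<integral>w. G w * mehler r T w \<partial>\<mu>) - (\<Sum>k<3. r ^ k * (\<integral>w. G w * J k w \<partial>\<mu>))"
    using Lpm(1)[OF all_momentsD(1)[OF mrT] all_momentsD(3)[OF mrT]]
      Lpm(1)[OF all_momentsD(1)[OF Jm] all_momentsD(3)[OF Jm]] by simp
  also have "\<dots> = (\<integral>w. G w * mehler r T w \<partial>\<mu>)" using orth J by simp
  finally have GY: "(\<integral>w. G w * mehler r T w \<partial>\<mu>) = (\<integral>w. G w * Y w \<partial>\<mu>)" ..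
  \<comment> \<open>Scaling by \<open>\<eta>\<close> instead of \<open>\<kappa>\<close> avoids a division by zero when \<open>\<kappa> = 0\<close>.\<close>
  have bd: "\<bar>\<integral>w. G w * Y w \<partial>\<mu>\<bar> \<le> \<eta> * (K + 2)" if \<eta>: "\<eta> > 0" "\<eta> \<ge> \<kappa>" for \<eta>
  proof -
    have yi: "integrable \<mu> (\<lambda>w. (Y w / \<eta>) ^ (2 * m))" using Yi by (simp add: power_divide)
    have "\<bar>\<integral>w. G w * Y w \<partial>\<mu>\<bar> \<le> (\<integral>w. \<bar>G w * Y w\<bar> \<partial>\<mu>)" by (rule integral_abs_bound)
    also have "\<dots> = \<eta> * (\<integral>w. \<bar>G w * (Y w / \<eta>)\<bar> \<partial>\<mu>)" using \<eta> by (simp add: abs_mult)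
    also have "\<dots> \<le> \<eta> * (K + 1 + (\<integral>w. (Y w / \<eta>) ^ (2 * m) \<partial>\<mu>))"
      using Lpm(2)[OF _ yi] Ym \<eta> prob_space unfolding K_def by (intro mult_left_mono) auto
    also have "(\<integral>w. (Y w / \<eta>) ^ (2 * m) \<partial>\<mu>) = (\<integral>w. Y w ^ (2 * m) \<partial>\<mu>) / \<eta> ^ (2 * m)" by (simp add: power_divide)
    also have "\<dots> \<le> 1"
    proof -
      have "\<kappa> ^ (2 * m) \<le> \<eta> ^ (2 * m)" using \<kappa>0 \<eta> by (intro power_mono) auto
      thus ?thesis using Y\<kappa> \<eta> by simp
    qed
    finally show ?thesis using \<eta> by (simp add: add.commute)
  qed
  have "\<bar>\<integral>w. G w * Y w \<partial>\<mu>\<bar> \<le> \<kappa> * (K + 2)"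
  proof (rule field_le_epsilon)
    fix e :: real assume e: "e > 0"
    have "\<bar>\<integral>w. G w * Y w \<partial>\<mu>\<bar> \<le> (\<kappa> + e / (K + 2)) * (K + 2)" using e K0 \<kappa>0 by (intro bd) (auto simp: add_nonneg_pos)
    also have "\<dots> = \<kappa> * (K + 2) + e" using K0 by (simp add: distrib_right)
    finally show "\<bar>\<integral>w. G w * Y w \<partial>\<mu>\<bar> \<le> \<kappa> * (K + 2) + e" .
  qed
  thus ?thesis unfolding GY K_def \<kappa>_def \<rho>_def I_def by (simp add: mult.commute)
qed

lemma mehler_indicator_bounded:
  assumes "A \<in> sets borel"
  shows "0 \<le> mehler r (indicator A) w" "mehler r (indicator A) w \<le> 1"
proof -
  note [measurable] = assms
  show "0 \<le> mehler r (indicator A) w" unfolding mehler_def by simp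
  have "mehler r (indicator A) w \<le> (\<integral>w'. 1 \<partial>\<mu>)"
    unfolding mehler_def
    by (rule integral_mono) (auto intro!: integrable_const_bound[where B=1] simp: indicator_def)
  thus "mehler r (indicator A) w \<le> 1" using prob_space by simp
qed

lemma integrable_pair_fst:
  assumes "integrable \<mu> (G :: 'w \<Rightarrow> real)"
  shows "integrable (\<mu> \<Otimes>\<^sub>M \<mu>) (\<lambda>z. G (fst z))"
proof -
  have "distr (\<mu> \<Otimes>\<^sub>M \<mu>) \<mu> fst = \<mu>" by (rule distr_pair_fst)
  hence "integrable (distr (\<mu> \<Otimes>\<^sub>M \<mu>) \<mu> fst) G" using assms by simp
  thus ?thesis by (subst (asm) integrable_distr_eq) (use assms in auto)
qed

lemma mehler_pairing:
  assumes G: "integrable \<mu> G" and h: "h \<in> borel_measurable borel" "\<And>w. \<bar>h w\<bar> \<le> B"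
  shows "integrable (\<mu> \<Otimes>\<^sub>M \<mu>) (\<lambda>z. G (fst z) * h (r *\<^sub>R fst z + sqrt (1 - r\<^sup>2) *\<^sub>R snd z))"
    and "(\<integral>w. G w * mehler r h w \<partial>\<mu>) = (\<integral>z. G (fst z) * h (r *\<^sub>R fst z + sqrt (1 - r\<^sup>2) *\<^sub>R snd z) \<partial>(\<mu> \<Otimes>\<^sub>M \<mu>))"
    and "integrable \<mu> (\<lambda>w. G w * mehler r h w)"
proof -
  interpret P: pair_prob_space \<mu> \<mu> ..
  note [measurable] = h(1)
  show i: "integrable (\<mu> \<Otimes>\<^sub>M \<mu>) (\<lambda>z. G (fst z) * h (r *\<^sub>R fst z + sqrt (1 - r\<^sup>2) *\<^sub>R snd z))"
    by (rule integrable_mult_bounded[OF integrable_pair_fst[OF G] _ h(2)]) measurable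
  show "(\<integral>w. G w * mehler r h w \<partial>\<mu>) = (\<integral>z. G (fst z) * h (r *\<^sub>R fst z + sqrt (1 - r\<^sup>2) *\<^sub>R snd z) \<partial>(\<mu> \<Otimes>\<^sub>M \<mu>))"
    unfolding P.integral_fst'[OF i, symmetric] by (simp add: mehler_def)
  show "integrable \<mu> (\<lambda>w. G w * mehler r h w)"
    using P.integrable_fst'[OF i] by (simp add: mehler_def)
qed

text \<open>
  The measure \<open>M\<close> in the proof dominates both \<open>\<mu>\<close> and the image of \<open>\<bar>G\<bar> \<mu> \<otimes> \<mu>\<close> under
  \<open>(w, w') \<mapsto> r w + \<surd>(1 - r\<^sup>2) w'\<close>. Approximation in \<open>L\<^sup>2(M)\<close> thus controls the norm of \<open>T\<close> and the
  integral against \<open>G\<close> at the same time.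
\<close>

lemma smoothing_approx:
  assumes G: "integrable \<mu> G" and A: "A \<in> sets borel" and r: "r\<^sup>2 \<le> 1" and e: "e > 0"
  shows "\<exists>T\<in>trig_poly UNIV. (\<integral>w. (T w)\<^sup>2 \<partial>\<mu>) \<le> 4 \<and>
    \<bar>(\<integral>w. G w * mehler r (indicator A) w \<partial>\<mu>) - (\<integral>w. G w * mehler r T w \<partial>\<mu>)\<bar> \<le> e"
proof -
  interpret P: pair_prob_space \<mu> \<mu> ..
  note [measurable] = A
  have Gm [measurable]: "G \<in> borel_measurable \<mu>" using G by auto
  define f where "f z = r *\<^sub>R fst z + sqrt (1 - r\<^sup>2) *\<^sub>R snd z" for z :: "'w \<times> 'w"
  have fm [measurable]: "f \<in> borel_measurable (\<mu> \<Otimes>\<^sub>M \<mu>)" unfolding f_def by measurable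
  define D where "D z = 1 + \<bar>G (fst z)\<bar>" for z :: "'w \<times> 'w"
  have D0: "D z \<ge> 0" for z by (simp add: D_def)
  have Di: "integrable (\<mu> \<Otimes>\<^sub>M \<mu>) D" unfolding D_def using integrable_pair_fst[OF G] by simp
  have Dm [measurable]: "D \<in> borel_measurable (\<mu> \<Otimes>\<^sub>M \<mu>)" using Di by auto
  define M where "M = distr (density (\<mu> \<Otimes>\<^sub>M \<mu>) (\<lambda>z. ennreal (D z))) borel f"
  have fin: "finite_measure M"
  proof
    have "emeasure M (space M) = (\<integral>\<^sup>+ z. ennreal (D z) \<partial>(\<mu> \<Otimes>\<^sub>M \<mu>))"
      unfolding M_def by (subst emeasure_distr) (auto simp: emeasure_density intro!: nn_integral_cong)
    also have "\<dots> = ennreal (\<integral>z. D z \<partial>(\<mu> \<Otimes>\<^sub>M \<mu>))" using Di D0 by (intro nn_integral_eq_integral) auto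
    finally show "emeasure M (space M) \<noteq> \<infinity>" by simp
  qed
  then interpret M: finite_measure M .
  have sM: "sets M = sets borel" by (simp add: M_def)
  have intM: "(\<integral>w. h w \<partial>M) = (\<integral>z. D z * h (f z) \<partial>(\<mu> \<Otimes>\<^sub>M \<mu>))" if [measurable]: "h \<in> borel_measurable borel" for h :: "'w \<Rightarrow> real"
  proof -
    have "(\<integral>w. h w \<partial>M) = (\<integral>z. h (f z) \<partial>density (\<mu> \<Otimes>\<^sub>M \<mu>) (\<lambda>z. ennreal (D z)))"
      unfolding M_def by (subst integral_distr) auto
    also have "\<dots> = (\<integral>z. D z * h (f z) \<partial>(\<mu> \<Otimes>\<^sub>M \<mu>))" using D0 by (subst integral_density) auto
    finally show ?thesis .
  qed
  define \<delta> where "\<delta> = e / (2 * (measure M (space M) + 1))"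
  have \<delta>: "\<delta> > 0" using e by (simp add: \<delta>_def add_nonneg_pos)
  have \<delta>M: "\<delta> * measure M (space M) \<le> e / 2"
  proof -
    have "\<delta> * measure M (space M) \<le> \<delta> * (measure M (space M) + 1)" using \<delta> by (intro mult_left_mono) auto
    also have "\<dots> = e / 2"
    proof -
      have "e / (2 * x) * x = e / 2" if "x \<noteq> 0" for x :: real using that by simp
      moreover have "measure M (space M) + 1 \<noteq> 0" using measure_nonneg[of M "space M"] by linarith
      ultimately show ?thesis unfolding \<delta>_def by blast
    qed
    finally show ?thesis .
  qed
  obtain T where T: "T \<in> trig_poly UNIV" and TA: "(\<integral>w. (T w - indicator A w)\<^sup>2 \<partial>M) < min 1 (\<delta> * e / 2)"
    using indicator_trig_approx[OF fin sM A, of "min 1 (\<delta> * e / 2)"] \<delta> e by auto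
  define X where "X w = T w - indicator A w" for w
  obtain B where B: "\<And>w. \<bar>T w\<bar> \<le> B" using trig_poly_bounded[OF T] by blast
  have Tm [measurable]: "T \<in> borel_measurable borel" by (rule trig_poly_measurable[OF T])
  have Xm [measurable]: "X \<in> borel_measurable borel" unfolding X_def by measurable
  have XB: "\<bar>X w\<bar> \<le> B + 1" for w using B[of w] by (auto simp: X_def indicator_def)
  have X2B: "\<bar>(X w)\<^sup>2\<bar> \<le> (B + 1)\<^sup>2" for w using power_mono[OF XB abs_ge_zero, of w 2] by simp
  have X2M: "(\<integral>w. (X w)\<^sup>2 \<partial>M) \<le> 1" "(\<integral>w. (X w)\<^sup>2 \<partial>M) \<le> \<delta> * e / 2" using TA by (auto simp: X_def)
  have iM: "integrable M (\<lambda>w. (X w)\<^sup>2)"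
    using X2B by (intro M.integrable_const_bound[where B="(B + 1)\<^sup>2"]) (auto simp: measurable_cong_sets[OF sM refl])
  have iX: "integrable \<mu> (\<lambda>w. (X w)\<^sup>2)" using X2B by (intro integrable_const_bound[where B="(B + 1)\<^sup>2"]) auto
  have iDX: "integrable (\<mu> \<Otimes>\<^sub>M \<mu>) (\<lambda>z. D z * h (f z))" if "h \<in> borel_measurable borel" "\<And>w. \<bar>h w\<bar> \<le> C" for h C
    by (rule integrable_mult_bounded[OF Di _ that(2)]) (use that in measurable)
  have "(\<integral>w. (X w)\<^sup>2 \<partial>\<mu>) = (\<integral>z. (X (f z))\<^sup>2 \<partial>(\<mu> \<Otimes>\<^sub>M \<mu>))"
    by (subst mehler_law[OF r, symmetric]) (subst integral_distr; simp add: f_def)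
  also have "\<dots> \<le> (\<integral>z. D z * (X (f z))\<^sup>2 \<partial>(\<mu> \<Otimes>\<^sub>M \<mu>))"
  proof (rule integral_mono)
    show "integrable (\<mu> \<Otimes>\<^sub>M \<mu>) (\<lambda>z. (X (f z))\<^sup>2)"
      using X2B by (intro P.integrable_const_bound[where B="(B + 1)\<^sup>2"]) auto
    show "integrable (\<mu> \<Otimes>\<^sub>M \<mu>) (\<lambda>z. D z * (X (f z))\<^sup>2)" by (rule iDX[OF _ X2B]) measurable
    show "(X (f z))\<^sup>2 \<le> D z * (X (f z))\<^sup>2" for z
      using mult_right_mono[of 1 "D z" "(X (f z))\<^sup>2"] by (simp add: D_def)
  qed
  also have "\<dots> \<le> 1" using X2M(1) by (subst (asm) intM) auto
  finally have X1: "(\<integral>w. (X w)\<^sup>2 \<partial>\<mu>) \<le> 1" .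
  have "(\<integral>w. (T w)\<^sup>2 \<partial>\<mu>) \<le> (\<integral>w. 2 + 2 * (X w)\<^sup>2 \<partial>\<mu>)"
  proof (rule integral_mono)
    show "integrable \<mu> (\<lambda>w. (T w)\<^sup>2)" by (rule all_momentsD(3)[OF trig_poly_all_moments[OF T]])
    show "integrable \<mu> (\<lambda>w. 2 + 2 * (X w)\<^sup>2)" using iX by simp
    fix w
    have "(a + b)\<^sup>2 \<le> 2 * a\<^sup>2 + 2 * b\<^sup>2" for a b :: real
      using zero_le_power2[of "a - b"] by (simp add: power2_sum power2_diff)
    from this[of "indicator A w" "X w"] have "(T w)\<^sup>2 \<le> 2 * (indicator A w)\<^sup>2 + 2 * (X w)\<^sup>2" by (simp add: X_def)
    moreover have "(indicator A w)\<^sup>2 \<le> (1 :: real)" by (cases "w \<in> A") auto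
    ultimately show "(T w)\<^sup>2 \<le> 2 + 2 * (X w)\<^sup>2" by linarith
  qed
  also have "\<dots> \<le> 4" using X1 iX prob_space by simp
  finally have T4: "(\<integral>w. (T w)\<^sup>2 \<partial>\<mu>) \<le> 4" .
  note pT = mehler_pairing[OF G Tm B, of r] and pA = mehler_pairing[OF G borel_measurable_indicator[OF A], of 1 r]
  have pA: "integrable (\<mu> \<Otimes>\<^sub>M \<mu>) (\<lambda>z. G (fst z) * indicator A (f z))"
    "(\<integral>w. G w * mehler r (indicator A) w \<partial>\<mu>) = (\<integral>z. G (fst z) * indicator A (f z) \<partial>(\<mu> \<Otimes>\<^sub>M \<mu>))"
    unfolding f_def by (rule pA; simp add: indicator_def)+
  have pT: "integrable (\<mu> \<Otimes>\<^sub>M \<mu>) (\<lambda>z. G (fst z) * T (f z))"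
    "(\<integral>w. G w * mehler r T w \<partial>\<mu>) = (\<integral>z. G (fst z) * T (f z) \<partial>(\<mu> \<Otimes>\<^sub>M \<mu>))"
    unfolding f_def by (rule pT)+
  have "(\<integral>w. G w * mehler r (indicator A) w \<partial>\<mu>) - (\<integral>w. G w * mehler r T w \<partial>\<mu>) =
     - (\<integral>z. G (fst z) * X (f z) \<partial>(\<mu> \<Otimes>\<^sub>M \<mu>))"
    using pA pT by (simp add: X_def right_diff_distrib)
  also have "\<bar>\<dots>\<bar> \<le> (\<integral>z. \<bar>G (fst z) * X (f z)\<bar> \<partial>(\<mu> \<Otimes>\<^sub>M \<mu>))" using integral_abs_bound by simp
  also have "\<dots> \<le> (\<integral>z. D z * (\<delta> + (X (f z))\<^sup>2 / \<delta>) \<partial>(\<mu> \<Otimes>\<^sub>M \<mu>))"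
  proof (rule integral_mono)
    show "integrable (\<mu> \<Otimes>\<^sub>M \<mu>) (\<lambda>z. \<bar>G (fst z) * X (f z)\<bar>)"
      by (intro integrable_abs integrable_mult_bounded[OF integrable_pair_fst[OF G] _ XB]) measurable
    show "integrable (\<mu> \<Otimes>\<^sub>M \<mu>) (\<lambda>z. D z * (\<delta> + (X (f z))\<^sup>2 / \<delta>))"
    proof (rule iDX)
      show "\<bar>\<delta> + (X w)\<^sup>2 / \<delta>\<bar> \<le> \<delta> + (B + 1)\<^sup>2 / \<delta>" for w
        using X2B[of w] \<delta> by (simp add: divide_right_mono)
    qed measurable
    fix z
    have "\<bar>x\<bar> \<le> \<delta> + x\<^sup>2 / \<delta>" for x :: real
    proof (cases "\<bar>x\<bar> \<le> \<delta>")
      case False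
      hence "\<bar>x\<bar> * \<delta> \<le> \<bar>x\<bar> * \<bar>x\<bar>" by (intro mult_left_mono) auto
      hence "\<bar>x\<bar> \<le> x\<^sup>2 / \<delta>" using \<delta> by (simp add: field_simps power2_eq_square flip: abs_mult)
      thus ?thesis using \<delta> by simp
    qed (use \<delta> in \<open>simp add: add_increasing2\<close>)
    thus "\<bar>G (fst z) * X (f z)\<bar> \<le> D z * (\<delta> + (X (f z))\<^sup>2 / \<delta>)"
      unfolding abs_mult using D0 by (intro mult_mono) (auto simp: D_def)
  qed
  also have "\<dots> = (\<integral>w. \<delta> + (X w)\<^sup>2 / \<delta> \<partial>M)" by (subst intM) auto
  also have "\<dots> = \<delta> * measure M (space M) + (\<integral>w. (X w)\<^sup>2 \<partial>M) / \<delta>" using iM by simp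
  also have "\<dots> \<le> e / 2 + (\<delta> * e / 2) / \<delta>" using X2M(2) \<delta> \<delta>M by (intro add_mono divide_right_mono) auto
  also have "\<dots> = e" using \<delta> by simp
  finally show ?thesis using T T4 by blast
qed

text \<open>
  For \<open>r > 1 / (4 m)\<close> the trivial bound by the \<open>L\<^sup>1\<close> norm of \<open>G\<close> is already of order \<open>r\<^sup>3\<close>.
\<close>

lemma smoothing_bound:
  assumes p: "p > 1" and G: "G \<in> Lp \<mu> p"
    and orth: "\<And>n S. n < 3 \<Longrightarrow> S \<in> simple_chaos \<iota> n \<Longrightarrow> (\<integral>w. G w * S w \<partial>\<mu>) = 0"
  shows "\<exists>C\<ge>0. \<forall>r A. 0 \<le> r \<longrightarrow> r \<le> 1 \<longrightarrow> A \<in> sets borel \<longrightarrow>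
    \<bar>\<integral>w. G w * mehler r (indicator A) w \<partial>\<mu>\<bar> \<le> C * r ^ 3"
proof -
  obtain m0 :: nat where m0: "p / (p - 1) \<le> real m0" using real_arch_simple by blast
  define m where "m = Suc m0"
  have m: "m \<ge> 1" "p / (p - 1) \<le> real (2 * m)" using m0 by (auto simp: m_def)
  have Gi: "integrable \<mu> G"
    using Lp_mult_integrable(1)[OF finite_measure_axioms p m(2) G, of "\<lambda>_. 1"] by simp
  define K where "K = (\<integral>w. \<bar>G w\<bar> powr p \<partial>\<mu>) + 2"
  define L where "L = (\<integral>w. \<bar>G w\<bar> \<partial>\<mu>)"
  define C where "C = (2 * K + L) * (4 * real m) ^ 3"
  have K0: "K \<ge> 0" "L \<ge> 0" by (auto simp: K_def L_def intro: add_nonneg_nonneg)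
  show ?thesis
  proof (intro exI[of _ C] conjI allI impI)
    show "C \<ge> 0" using K0 by (simp add: C_def)
    fix r :: real and A :: "'w set" assume r: "0 \<le> r" "r \<le> 1" and A: "A \<in> sets borel"
    have sqr: "r\<^sup>2 \<le> 1" using r by (simp add: abs_square_le_1)
    have r3: "C * r ^ 3 = (2 * K + L) * (4 * real m * r) ^ 3" by (simp add: C_def power_mult_distrib)
    show "\<bar>\<integral>w. G w * mehler r (indicator A) w \<partial>\<mu>\<bar> \<le> C * r ^ 3"
    proof (cases "4 * real m * r \<le> 1")
      case True
      have "\<bar>\<integral>w. G w * mehler r (indicator A) w \<partial>\<mu>\<bar> \<le> 2 * K * (4 * real m * r) ^ 3"
      proof (rule field_le_epsilon)
        fix e :: real assume e: "e > 0"
        obtain T where T: "T \<in> trig_poly UNIV" "(\<integral>w. (T w)\<^sup>2 \<partial>\<mu>) \<le> 4"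
          "\<bar>(\<integral>w. G w * mehler r (indicator A) w \<partial>\<mu>) - (\<integral>w. G w * mehler r T w \<partial>\<mu>)\<bar> \<le> e"
          using smoothing_approx[OF Gi A sqr e] by blast
        have "\<bar>\<integral>w. G w * mehler r T w \<partial>\<mu>\<bar> \<le> K * ((4 * real m * r) ^ 3 * sqrt (\<integral>w. (T w)\<^sup>2 \<partial>\<mu>))"
          unfolding K_def by (rule smoothing_bound_trig[OF p m(2) m(1) G orth T(1) r(1) True])
        also have "\<dots> \<le> K * ((4 * real m * r) ^ 3 * sqrt 4)"
          using K0 r T(2) by (intro mult_left_mono real_sqrt_le_mono) auto
        finally show "\<bar>\<integral>w. G w * mehler r (indicator A) w \<partial>\<mu>\<bar> \<le> 2 * K * (4 * real m * r) ^ 3 + e"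
          using T(3) by simp
      qed
      also have "\<dots> \<le> (2 * K + L) * (4 * real m * r) ^ 3" using K0 r by (intro mult_right_mono) auto
      finally show ?thesis unfolding r3 .
    next
      case False
      note [measurable] = A
      have mi: "mehler r (indicator A) \<in> borel_measurable \<mu>"
        unfolding borel_mu by (intro mehler_measurable) measurable
      have mb: "\<bar>mehler r (indicator A) w\<bar> \<le> 1" for w using mehler_indicator_bounded[OF A, of r w] by simp
      have "\<bar>\<integral>w. G w * mehler r (indicator A) w \<partial>\<mu>\<bar> \<le> (\<integral>w. \<bar>G w * mehler r (indicator A) w\<bar> \<partial>\<mu>)"
        by (rule integral_abs_bound)
      also have "\<dots> \<le> L"
        unfolding L_def
      proof (rule integral_mono)
        show "integrable \<mu> (\<lambda>w. \<bar>G w * mehler r (indicator A) w\<bar>)"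
          by (intro integrable_abs integrable_mult_bounded[OF Gi mi mb])
        show "\<bar>G w * mehler r (indicator A) w\<bar> \<le> \<bar>G w\<bar>" for w
          unfolding abs_mult using mult_left_mono[OF mb[of w], of "\<bar>G w\<bar>"] by simp
      qed (use Gi in simp)
      also have "L \<le> (2 * K + L) * (4 * real m * r) ^ 3"
      proof -
        have "1 \<le> (4 * real m * r) ^ 3" using False by (intro one_le_power) auto
        from mult_left_mono[OF this, of "2 * K + L"] show ?thesis using K0 by simp
      qed
      finally show ?thesis unfolding r3 .
    qed
  qed
qed

section \<open>The density and its Ornstein-Uhlenbeck representation\<close>

text \<open>
  The cosine integrals of \<open>g\<close> determine its integrals over Borel sets, and Mehler's formula gives the
  same cosine integrals.
\<close>

lemma second_quantization_indicator:
  assumes p: "p > 1" and \<alpha>: "0 \<le> \<alpha>" "\<alpha> \<le> 1" and f: "f \<in> Lp \<mu> p"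
    and g: "Lp_second_quantization \<iota> \<mu> p (sqrt \<alpha>) f g" and A: "A \<in> sets borel"
  shows "integrable \<mu> f" "integrable \<mu> g"
    "(\<integral>w. g w * indicator A w \<partial>\<mu>) = (\<integral>w. f w * mehler (sqrt \<alpha>) (indicator A) w \<partial>\<mu>)"
proof -
  interpret P: pair_prob_space \<mu> \<mu> ..
  obtain m0 :: nat where m0: "p / (p - 1) \<le> real m0" using real_arch_simple by blast
  hence m: "p / (p - 1) \<le> real (2 * m0)" by simp
  have gp: "g \<in> Lp \<mu> p" using g by (auto simp: Lp_second_quantization_def Lp_extension_def Lp_converges_def)
  show fi: "integrable \<mu> f" and gi: "integrable \<mu> g"
    using Lp_mult_integrable(1)[OF finite_measure_axioms p m f, of "\<lambda>_. 1"]
      Lp_mult_integrable(1)[OF finite_measure_axioms p m gp, of "\<lambda>_. 1"] by simp_all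
  define r where "r = sqrt \<alpha>"
  have r: "r\<^sup>2 \<le> 1" using \<alpha> by (simp add: r_def)
  define h where "h z = r *\<^sub>R fst z + sqrt (1 - r\<^sup>2) *\<^sub>R snd z" for z :: "'w \<times> 'w"
  have hm [measurable]: "h \<in> borel_measurable (\<mu> \<Otimes>\<^sub>M \<mu>)" unfolding h_def by measurable
  have "(\<integral>w. g w * indicator A w \<partial>\<mu>) = (\<integral>z. f (fst z) * indicator A (h z) \<partial>(\<mu> \<Otimes>\<^sub>M \<mu>))"
  proof (rule signed_laws_eqI[OF gi integrable_pair_fst[OF fi] _ hm _ A])
    show "(\<integral>w. g w * cos (blinfun_apply \<phi> w + \<theta>) \<partial>\<mu>) = (\<integral>z. f (fst z) * cos (blinfun_apply \<phi> (h z) + \<theta>) \<partial>(\<mu> \<Otimes>\<^sub>M \<mu>))"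
      for \<phi> \<theta>
    proof -
      have "(\<integral>z. f (fst z) * cos (blinfun_apply \<phi> (h z) + \<theta>) \<partial>(\<mu> \<Otimes>\<^sub>M \<mu>)) = (\<integral>w. f w * mehler r (\<lambda>w. cos (blinfun_apply \<phi> w + \<theta>)) w \<partial>\<mu>)"
        unfolding h_def by (rule mehler_pairing(2)[OF fi, symmetric, where B=1]) auto
      also have "\<dots> = exp (- (1 - r\<^sup>2) * gvar \<phi> / 2) * (\<integral>w. f w * cos (r * blinfun_apply \<phi> w + \<theta>) \<partial>\<mu>)"
        unfolding mehler_cos[OF r] by (rule integral_mult_left_commute)
      also have "\<dots> = (\<integral>w. g w * cos (blinfun_apply \<phi> w + \<theta>) \<partial>\<mu>)"
        unfolding r_def by (rule Lp_second_quantization_cos[OF p g, symmetric])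
      finally show ?thesis ..
    qed
  qed (simp add: borel_mu)
  also have "\<dots> = (\<integral>w. f w * mehler r (indicator A) w \<partial>\<mu>)"
    unfolding h_def using A by (intro mehler_pairing(2)[OF fi, symmetric, where B=1]) (auto simp: indicator_def)
  finally show "(\<integral>w. g w * indicator A w \<partial>\<mu>) = (\<integral>w. f w * mehler (sqrt \<alpha>) (indicator A) w \<partial>\<mu>)"
    by (simp add: r_def)
qed

text \<open>
  Positivity is not visible from the graph closure, as the approximating functions may change sign. It
  comes from Mehler's formula, tested on the set where \<open>g\<close> is negative.
\<close>

lemma second_quantization_nonneg:
  assumes p: "p > 1" and \<alpha>: "0 \<le> \<alpha>" "\<alpha> \<le> 1" and f: "f \<in> Lp \<mu> p" "AE w in \<mu>. 0 \<le> f w"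
    and g: "Lp_second_quantization \<iota> \<mu> p (sqrt \<alpha>) f g"
  shows "AE w in \<mu>. 0 \<le> g w"
proof -
  have gm [measurable]: "g \<in> borel_measurable borel"
    using g by (auto simp: Lp_second_quantization_def Lp_extension_def Lp_converges_def Lp_def borel_mu)
  define A where "A = {w. g w < 0}"
  have A: "A \<in> sets borel" unfolding A_def by measurable
  note sq = second_quantization_indicator[OF p \<alpha> f(1) g A]
  have "0 \<le> (\<integral>w. f w * mehler (sqrt \<alpha>) (indicator A) w \<partial>\<mu>)"
    using f(2) by (intro integral_nonneg_AE) (auto simp: mehler_indicator_bounded[OF A])
  hence "0 \<le> (\<integral>w. g w * indicator A w \<partial>\<mu>)" using sq by simp
  moreover have neg: "0 \<le> - (g w * indicator A w)" for w by (simp add: A_def indicator_def)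
  moreover have i: "integrable \<mu> (\<lambda>w. - (g w * indicator A w))"
    using A by (intro Bochner_Integration.integrable_minus integrable_mult_bounded[OF sq(2), where B=1]) (auto simp: borel_mu indicator_def)
  moreover have "0 \<le> (\<integral>w. - (g w * indicator A w) \<partial>\<mu>)" using neg by (intro integral_nonneg_AE) auto
  ultimately have "(\<integral>w. - (g w * indicator A w) \<partial>\<mu>) = 0" by simp
  hence "AE w in \<mu>. - (g w * indicator A w) = 0"
    using integral_nonneg_eq_0_iff_AE[OF i] neg by simp
  thus ?thesis by eventually_elim (auto simp: A_def indicator_def split: if_splits)
qed

end

section \<open>Laws of sums\<close>

definition borel_prob :: "'w::topological_space measure \<Rightarrow> bool" where
  "borel_prob M \<longleftrightarrow> prob_space M \<and> sets M = sets borel"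

definition charf :: "'w::real_normed_vector measure \<Rightarrow> ('w \<Rightarrow>\<^sub>L real) \<Rightarrow> complex" where
  "charf M \<phi> = (\<integral>w. iexp (blinfun_apply \<phi> w) \<partial>M)"

definition law_sum :: "'w::real_normed_vector measure \<Rightarrow> 'w measure \<Rightarrow> 'w measure" where
  "law_sum M N = distr (M \<Otimes>\<^sub>M N) borel (\<lambda>z. fst z + snd z)"

definition law_scale :: "real \<Rightarrow> 'w::real_normed_vector measure \<Rightarrow> 'w measure" where
  "law_scale c M = distr M borel (\<lambda>w. c *\<^sub>R w)"

primrec law_power :: "'w::real_normed_vector measure \<Rightarrow> nat \<Rightarrow> 'w measure" where
  "law_power M 0 = return borel 0"
| "law_power M (Suc n) = law_sum M (law_power M n)"

lemma borel_probD: 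
  assumes "borel_prob M"
  shows "prob_space M" "sets M = sets borel" "space M = UNIV" "finite_measure M" "borel_measurable M = borel_measurable borel"
  using assms sets_eq_imp_space_eq[of M borel] measurable_cong_sets[of M borel]
  by (auto simp: borel_prob_def prob_space.finite_measure)

lemma law_sum_measurable:
  fixes M N :: "'w::{real_normed_vector,second_countable_topology} measure"
  assumes "borel_prob M" "borel_prob N"
  shows "(\<lambda>z. fst z + snd z) \<in> borel_measurable (M \<Otimes>\<^sub>M N)"
proof -
  note [measurable_cong] = borel_probD(2)[OF assms(1)] borel_probD(2)[OF assms(2)]
  show ?thesis by measurable
qed

lemma borel_prob_law_sum:
  fixes M N :: "'w::{real_normed_vector,second_countable_topology} measure"
  assumes "borel_prob M" "borel_prob N"
  shows "borel_prob (law_sum M N)"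
proof -
  interpret M: prob_space M by (rule borel_probD(1)[OF assms(1)])
  interpret N: prob_space N by (rule borel_probD(1)[OF assms(2)])
  interpret P: pair_prob_space M N ..
  show ?thesis unfolding borel_prob_def law_sum_def
    using P.prob_space_distr[OF law_sum_measurable[OF assms]] by simp
qed

lemma borel_prob_law_scale:
  fixes M :: "'w::{real_normed_vector,second_countable_topology} measure"
  assumes "borel_prob M"
  shows "borel_prob (law_scale c M)"
proof -
  interpret M: prob_space M by (rule borel_probD(1)[OF assms])
  note [measurable_cong] = borel_probD(2)[OF assms]
  have "prob_space (distr M borel (\<lambda>w. c *\<^sub>R w))" by (rule M.prob_space_distr) measurable
  thus ?thesis unfolding borel_prob_def law_scale_def by simp
qed

lemma borel_prob_law_power:
  fixes M :: "'w::{real_normed_vector,second_countable_topology} measure"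
  assumes "borel_prob M"
  shows "borel_prob (law_power M n)"
  by (induction n) (auto simp: borel_prob_def[of "return _ _"] prob_space_return intro: borel_prob_law_sum assms)

lemma integral_law_sum:
  fixes M N :: "'w::{real_normed_vector,second_countable_topology} measure"
    and h :: "'w \<Rightarrow> 'b::{banach,second_countable_topology}"
  assumes MN: "borel_prob M" "borel_prob N" and h: "h \<in> borel_measurable borel" "\<And>w. norm (h w) \<le> B"
  shows "(\<integral>w. h w \<partial>law_sum M N) = (\<integral>x. (\<integral>y. h (x + y) \<partial>N) \<partial>M)"
proof -
  interpret M: prob_space M by (rule borel_probD(1)[OF MN(1)])
  interpret N: prob_space N by (rule borel_probD(1)[OF MN(2)])
  interpret P: pair_prob_space M N ..
  note [measurable] = law_sum_measurable[OF MN] h(1)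
  have "(\<integral>w. h w \<partial>law_sum M N) = (\<integral>z. h (fst z + snd z) \<partial>(M \<Otimes>\<^sub>M N))"
    unfolding law_sum_def by (subst integral_distr) auto
  also have "\<dots> = (\<integral>x. (\<integral>y. h (x + y) \<partial>N) \<partial>M)"
    by (subst P.integral_fst'[symmetric]) (auto intro!: P.integrable_const_bound[where B=B] h(2))
  finally show ?thesis .
qed

lemma integral_law_scale:
  fixes M :: "'w::{real_normed_vector,second_countable_topology} measure"
    and h :: "'w \<Rightarrow> 'b::{banach,second_countable_topology}"
  assumes M: "borel_prob M" and h: "h \<in> borel_measurable borel"
  shows "(\<integral>w. h w \<partial>law_scale c M) = (\<integral>w. h (c *\<^sub>R w) \<partial>M)"
proof -
  note [measurable_cong] = borel_probD(2)[OF M]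
  note [measurable] = h
  show ?thesis unfolding law_scale_def by (subst integral_distr) auto
qed

lemma measure_eq_integral_indicator:
  assumes "borel_prob M" "A \<in> sets borel"
  shows "measure M A = (\<integral>w. indicator A w \<partial>M)"
  using assms borel_probD[OF assms(1)] by simp

lemma iexp_blinfun_measurable: "(\<lambda>w. iexp (blinfun_apply \<phi> w)) \<in> borel_measurable borel"
  for \<phi> :: "'w::real_normed_vector \<Rightarrow>\<^sub>L real"
  by measurable

lemma charf_law_sum:
  fixes M N :: "'w::{real_normed_vector,second_countable_topology} measure"
  assumes MN: "borel_prob M" "borel_prob N"
  shows "charf (law_sum M N) \<phi> = charf M \<phi> * charf N \<phi>"
proof -
  have "charf (law_sum M N) \<phi> = (\<integral>x. (\<integral>y. iexp (blinfun_apply \<phi> (x + y)) \<partial>N) \<partial>M)"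
    unfolding charf_def by (rule integral_law_sum[OF MN iexp_blinfun_measurable, where B=1]) simp
  also have "\<dots> = (\<integral>x. (\<integral>y. iexp (blinfun_apply \<phi> x) * iexp (blinfun_apply \<phi> y) \<partial>N) \<partial>M)"
    by (simp add: blinfun.add_right distrib_left exp_add)
  also have "\<dots> = charf M \<phi> * charf N \<phi>" by (simp add: charf_def)
  finally show ?thesis .
qed

lemma charf_law_scale:
  fixes M :: "'w::{real_normed_vector,second_countable_topology} measure"
  assumes M: "borel_prob M"
  shows "charf (law_scale c M) \<phi> = charf M (c *\<^sub>R \<phi>)"
  unfolding charf_def integral_law_scale[OF M iexp_blinfun_measurable]
  by (simp add: blinfun.scaleR_right blinfun.scaleR_left)

lemma charf_law_power:
  fixes M :: "'w::{real_normed_vector,second_countable_topology} measure"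
  assumes M: "borel_prob M"
  shows "charf (law_power M n) \<phi> = charf M \<phi> ^ n"
proof (induction n)
  case 0
  show ?case unfolding charf_def by (simp add: integral_return)
next
  case (Suc n)
  thus ?case by (simp add: charf_law_sum[OF M borel_prob_law_power[OF M]])
qed

lemma charf_eqI:
  fixes M N :: "'w::{real_normed_vector,second_countable_topology} measure"
  assumes M: "borel_prob M" and N: "borel_prob N" and eq: "\<And>\<phi>. charf M \<phi> = charf N \<phi>"
  shows "M = N"
proof (rule law_eqI[OF borel_probD(4)[OF M] borel_probD(2)[OF M] borel_probD(4)[OF N] borel_probD(2)[OF N]])
  fix \<phi> :: "'w \<Rightarrow>\<^sub>L real" and \<theta> :: real
  have "(\<integral>w. cos (blinfun_apply \<phi> w + \<theta>) \<partial>Q) = Re (cis \<theta> * charf Q \<phi>)" if Q: "borel_prob Q" for Q :: "'w measure"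
  proof -
    interpret Q: prob_space Q by (rule borel_probD(1)[OF Q])
    have i: "integrable Q (\<lambda>w. iexp (blinfun_apply \<phi> w))"
      by (rule Q.integrable_const_bound[where B=1]) (auto simp: borel_probD(5)[OF Q])
    have "(\<integral>w. cos (blinfun_apply \<phi> w + \<theta>) \<partial>Q) = (\<integral>w. Re (cis \<theta> * iexp (blinfun_apply \<phi> w)) \<partial>Q)"
      by (intro Bochner_Integration.integral_cong refl) (simp add: cis_mult add.commute flip: cis_conv_exp)
    also have "\<dots> = Re (cis \<theta> * charf Q \<phi>)" using i by (simp add: charf_def)
    finally show ?thesis .
  qed
  thus "(\<integral>w. cos (blinfun_apply \<phi> w + \<theta>) \<partial>M) = (\<integral>w. cos (blinfun_apply \<phi> w + \<theta>) \<partial>N)"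
    using M N eq by simp
qed

text \<open>
  Conditioning on the common independent summand, the two measures of \<open>B\<close> are averages over its
  translates. This is how \<open>V\<close> drops out of the replacement argument.
\<close>

lemma measure_law_sum_diff:
  fixes V Q Q' :: "'w::{real_normed_vector,second_countable_topology} measure"
  assumes V: "borel_prob V" and Q: "borel_prob Q" "borel_prob Q'"
    and le: "\<And>B. B \<in> sets borel \<Longrightarrow> \<bar>measure Q B - measure Q' B\<bar> \<le> \<epsilon>" and B: "B \<in> sets borel"
  shows "\<bar>measure (law_sum V Q) B - measure (law_sum V Q') B\<bar> \<le> \<epsilon>"
proof -
  interpret V: prob_space V by (rule borel_probD(1)[OF V])
  define Bs where "Bs x = (\<lambda>y. x + y) -` B" for x
  have Bs: "Bs x \<in> sets borel" for x
    unfolding Bs_def using measurable_sets_borel[of "\<lambda>y. x + y" borel B] B by simp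
  have eq: "measure (law_sum V R) B = (\<integral>x. measure R (Bs x) \<partial>V)"
    and i: "integrable V (\<lambda>x. measure R (Bs x))" if R: "borel_prob R" for R
  proof -
    interpret R: prob_space R by (rule borel_probD(1)[OF R])
    interpret P: pair_prob_space V R ..
    have ind: "(\<integral>y. indicator B (x + y) \<partial>R) = measure R (Bs x)" for x
    proof -
      have "(\<lambda>y. indicator B (x + y) :: real) = indicator (Bs x)" by (auto simp: Bs_def indicator_def)
      thus ?thesis using measure_eq_integral_indicator[OF R Bs, of x] by simp
    qed
    have "measure (law_sum V R) B = (\<integral>w. indicator B w \<partial>law_sum V R)"
      by (rule measure_eq_integral_indicator[OF borel_prob_law_sum[OF V R] B])
    also have "\<dots> = (\<integral>x. (\<integral>y. indicator B (x + y) \<partial>R) \<partial>V)"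
      using B by (intro integral_law_sum[OF V R, where B=1]) (auto simp: indicator_def)
    finally show "measure (law_sum V R) B = (\<integral>x. measure R (Bs x) \<partial>V)" unfolding ind .
    note [measurable] = law_sum_measurable[OF V R] B
    have "integrable (V \<Otimes>\<^sub>M R) (\<lambda>z. indicator B (fst z + snd z) :: real)"
      by (rule P.integrable_const_bound[where B=1]) (auto simp: indicator_def)
    from P.integrable_fst'[OF this] show "integrable V (\<lambda>x. measure R (Bs x))" by (simp add: ind)
  qed
  have "\<bar>measure (law_sum V Q) B - measure (law_sum V Q') B\<bar> = \<bar>\<integral>x. measure Q (Bs x) - measure Q' (Bs x) \<partial>V\<bar>"
    using i[OF Q(1)] i[OF Q(2)] by (simp add: eq[OF Q(1)] eq[OF Q(2)])
  also have "\<dots> \<le> (\<integral>x. \<bar>measure Q (Bs x) - measure Q' (Bs x)\<bar> \<partial>V)" by (rule integral_abs_bound)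
  also have "\<dots> \<le> (\<integral>x. \<epsilon> \<partial>V)"
    using i[OF Q(1)] i[OF Q(2)] le[OF Bs] by (intro integral_mono) auto
  also have "\<dots> = \<epsilon>" using V.prob_space by simp
  finally show ?thesis .
qed

lemma absolutely_continuous_law_sum:
  fixes M N M' N' :: "'w::{real_normed_vector,second_countable_topology} measure"
  assumes MN: "borel_prob M" "borel_prob N" "borel_prob M'" "borel_prob N'"
    and ac: "absolutely_continuous M M'" "absolutely_continuous N N'"
  shows "absolutely_continuous (law_sum M N) (law_sum M' N')"
  unfolding absolutely_continuous_def
proof
  fix A assume A: "A \<in> null_sets (law_sum M N)"
  hence Ab [measurable]: "A \<in> sets borel" using borel_probD(2)[OF borel_prob_law_sum[OF MN(1,2)]] by auto
  define As where "As x = (\<lambda>y. x + y) -` A" for x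
  have As: "As x \<in> sets borel" for x
    unfolding As_def using measurable_sets_borel[of "\<lambda>y. x + y" borel A] Ab by simp
  have em: "emeasure (law_sum V R) A = (\<integral>\<^sup>+ x. emeasure R (As x) \<partial>V)"
    and mm: "(\<lambda>x. emeasure R (As x)) \<in> borel_measurable V" if V: "borel_prob V" and R: "borel_prob R" for V R
  proof -
    interpret R: prob_space R by (rule borel_probD(1)[OF R])
    note [measurable] = law_sum_measurable[OF V R]
    note [measurable_cong] = borel_probD(2)[OF V] borel_probD(2)[OF R]
    have ind: "(\<integral>\<^sup>+ y. indicator A (x + y) \<partial>R) = emeasure R (As x)" for x
    proof -
      have "(\<lambda>y. indicator A (x + y) :: ennreal) = indicator (As x)" by (auto simp: As_def indicator_def)
      thus ?thesis using As[of x] borel_probD(2)[OF R] by simp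
    qed
    have "emeasure (law_sum V R) A = (\<integral>\<^sup>+ z. indicator A z \<partial>law_sum V R)"
      using borel_probD(2)[OF borel_prob_law_sum[OF V R]] by simp
    also have "\<dots> = (\<integral>\<^sup>+ z. indicator A (fst z + snd z) \<partial>(V \<Otimes>\<^sub>M R))"
      unfolding law_sum_def by (subst nn_integral_distr) auto
    also have "\<dots> = (\<integral>\<^sup>+ x. \<integral>\<^sup>+ y. indicator A (x + y) \<partial>R \<partial>V)"
      by (subst R.nn_integral_fst[symmetric]) auto
    finally show "emeasure (law_sum V R) A = (\<integral>\<^sup>+ x. emeasure R (As x) \<partial>V)" unfolding ind .
    have "(\<lambda>x. \<integral>\<^sup>+ y. indicator A (x + y) \<partial>R) \<in> borel_measurable V" by measurable
    thus "(\<lambda>x. emeasure R (As x)) \<in> borel_measurable V" unfolding ind .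
  qed
  have "(\<integral>\<^sup>+ x. emeasure N (As x) \<partial>M) = 0" using A em[OF MN(1,2)] by auto
  hence "AE x in M. emeasure N (As x) = 0" by (simp add: nn_integral_0_iff_AE mm MN)
  hence "AE x in M'. emeasure N (As x) = 0"
    by (rule absolutely_continuous_AE[OF _ ac(1), rotated]) (simp add: borel_probD(2) MN)
  moreover have "emeasure N' (As x) = 0" if "emeasure N (As x) = 0" for x
  proof -
    have "As x \<in> null_sets N" using that As borel_probD(2)[OF MN(2)] by auto
    thus ?thesis using ac(2) by (auto simp: absolutely_continuous_def)
  qed
  ultimately have "AE x in M'. emeasure N' (As x) = 0" by auto
  hence "(\<integral>\<^sup>+ x. emeasure N' (As x) \<partial>M') = 0" by (simp add: nn_integral_0_iff_AE mm MN)
  hence "emeasure (law_sum M' N') A = 0" by (simp add: em MN)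
  thus "A \<in> null_sets (law_sum M' N')"
    using Ab borel_probD(2)[OF borel_prob_law_sum[OF MN(3,4)]] by auto
qed

lemma absolutely_continuous_law_power:
  fixes M M' :: "'w::{real_normed_vector,second_countable_topology} measure"
  assumes "borel_prob M" "borel_prob M'" "absolutely_continuous M M'"
  shows "absolutely_continuous (law_power M n) (law_power M' n)"
proof (induction n)
  case 0
  show ?case by (simp add: absolutely_continuous_def)
next
  case (Suc n)
  show ?case unfolding law_power.simps
    by (intro absolutely_continuous_law_sum assms borel_prob_law_power Suc)
qed

lemma absolutely_continuous_law_scale:
  fixes M M' :: "'w::{real_normed_vector,second_countable_topology} measure"
  assumes M: "borel_prob M" "borel_prob M'" and ac: "absolutely_continuous M M'"
  shows "absolutely_continuous (law_scale c M) (law_scale c M')"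
  unfolding absolutely_continuous_def
proof
  fix A assume A: "A \<in> null_sets (law_scale c M)"
  hence Ab: "A \<in> sets borel" by (auto simp: law_scale_def)
  have em: "emeasure (law_scale c V) A = emeasure V ((\<lambda>w. c *\<^sub>R w) -` A)" if V: "borel_prob V" for V
  proof -
    note [measurable_cong] = borel_probD(2)[OF V]
    show ?thesis unfolding law_scale_def using Ab borel_probD(3)[OF V] by (subst emeasure_distr) auto
  qed
  have "(\<lambda>w. c *\<^sub>R w) -` A \<in> sets borel"
    using measurable_sets_borel[of "\<lambda>w. c *\<^sub>R w" borel A] Ab by simp
  hence "(\<lambda>w. c *\<^sub>R w) -` A \<in> null_sets M"
    using null_setsD1[OF A] em[OF M(1)] borel_probD(2)[OF M(1)] by (intro null_setsI) simp_all
  hence "(\<lambda>w. c *\<^sub>R w) -` A \<in> null_sets M'" using ac by (auto simp: absolutely_continuous_def)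
  hence "emeasure (law_scale c M') A = 0" using em[OF M(2)] by (simp add: null_setsD1)
  thus "A \<in> null_sets (law_scale c M')" using Ab by (intro null_setsI) (simp_all add: law_scale_def)
qed

section \<open>The rate of convergence in total variation\<close>

context abstract_wiener_space
begin

lemma borel_prob_mu: "borel_prob \<mu>"
  unfolding borel_prob_def using sets_mu prob_space_axioms by simp

lemma charf_mu': "charf \<mu> \<phi> = of_real (exp (- gvar \<phi> / 2))"
  unfolding charf_def by (rule charf_mu)

lemma law_power_mu:
  assumes "n \<ge> 1"
  shows "law_scale (1 / sqrt (real n)) (law_power \<mu> n) = \<mu>"
proof (rule charf_eqI)
  show "borel_prob (law_scale (1 / sqrt (real n)) (law_power \<mu> n))"
    by (intro borel_prob_law_scale borel_prob_law_power borel_prob_mu)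
  fix \<phi> :: "'w \<Rightarrow>\<^sub>L real"
  have "charf (law_scale (1 / sqrt (real n)) (law_power \<mu> n)) \<phi> = of_real (exp (real n * (- gvar ((1 / sqrt (real n)) *\<^sub>R \<phi>) / 2)))"
    unfolding charf_law_scale[OF borel_prob_law_power[OF borel_prob_mu]] charf_law_power[OF borel_prob_mu] charf_mu'
    by (simp only: exp_of_nat_mult of_real_power)
  also have "real n * (- gvar ((1 / sqrt (real n)) *\<^sub>R \<phi>) / 2) = - gvar \<phi> / 2"
    using assms by (simp add: gvar_scaleR power_divide)
  finally show "charf (law_scale (1 / sqrt (real n)) (law_power \<mu> n)) \<phi> = charf \<mu> \<phi>" by (simp add: charf_mu')
qed (rule borel_prob_mu)

text \<open>
  For \<open>\<tau>\<^sup>2 = 1 + \<sigma>\<^sup>2\<close> and \<open>r = 1 / \<tau>\<close>, the sum \<open>y + \<sigma> z\<close> equals \<open>\<tau> (r y + \<surd>(1 - r\<^sup>2) z)\<close>. Integrating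
  out the Gaussian \<open>z\<close> thus turns the indicator of \<open>B\<close> into \<open>\<Gamma>(r)\<close> applied to the indicator of \<open>\<tau>\<^sup>-\<^sup>1 B\<close>.
\<close>

lemma smoothed_law_diff:
  assumes g: "integrable \<mu> g" "AE w in \<mu>. 0 \<le> g w" and l: "lam = density \<mu> (\<lambda>w. ennreal (g w))" "borel_prob lam"
    and C: "\<And>r A. 0 \<le> r \<Longrightarrow> r \<le> 1 \<Longrightarrow> A \<in> sets borel \<Longrightarrow> \<bar>\<integral>w. (g w - 1) * mehler r (indicator A) w \<partial>\<mu>\<bar> \<le> C * r ^ 3"
    and s: "\<sigma> \<ge> 0" and B: "B \<in> sets borel"
  shows "\<bar>measure (law_sum lam (law_scale \<sigma> \<mu>)) B - measure (law_sum \<mu> (law_scale \<sigma> \<mu>)) B\<bar> \<le> C * (1 / sqrt (1 + \<sigma>\<^sup>2)) ^ 3"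
proof -
  define \<tau> where "\<tau> = sqrt (1 + \<sigma>\<^sup>2)"
  have \<tau>: "\<tau> > 0" "\<tau>\<^sup>2 = 1 + \<sigma>\<^sup>2" "\<tau> \<ge> 1" by (auto simp: \<tau>_def add_pos_nonneg)
  define r where "r = 1 / \<tau>"
  have r: "0 \<le> r" "r \<le> 1" using \<tau> by (auto simp: r_def)
  have "1 - r\<^sup>2 = (\<tau>\<^sup>2 - 1) / \<tau>\<^sup>2" using \<tau>(1) by (simp add: r_def power_divide diff_divide_distrib)
  also have "\<dots> = (\<sigma> / \<tau>)\<^sup>2" unfolding power_divide using \<tau>(2) by simp
  finally have "1 - r\<^sup>2 = (\<sigma> / \<tau>)\<^sup>2" .
  hence rs: "sqrt (1 - r\<^sup>2) = \<sigma> / \<tau>" using s \<tau> by simp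
  define A where "A = (\<lambda>w. \<tau> *\<^sub>R w) -` B"
  have A: "A \<in> sets borel" unfolding A_def using measurable_sets_borel[of "\<lambda>w. \<tau> *\<^sub>R w" borel B] B by simp
  note [measurable] = A B
  have inner: "(\<integral>z. indicator B (y + z) \<partial>law_scale \<sigma> \<mu>) = mehler r (indicator A) y" for y
  proof -
    have "(\<integral>z. indicator B (y + z) \<partial>law_scale \<sigma> \<mu>) = (\<integral>z. indicator B (y + \<sigma> *\<^sub>R z) \<partial>\<mu> :: real)"
      by (rule integral_law_scale[OF borel_prob_mu]) measurable
    also have "\<dots> = mehler r (indicator A) y"
      unfolding mehler_def rs using \<tau> by (simp add: A_def indicator_def r_def scaleR_add_right)
    finally show ?thesis .
  qed
  have mm: "mehler r (indicator A) \<in> borel_measurable borel" by (intro mehler_measurable) measurable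
  have mb: "\<bar>mehler r (indicator A) w\<bar> \<le> 1" for w using mehler_indicator_bounded[OF A, of r w] by simp
  have eq: "measure (law_sum Q (law_scale \<sigma> \<mu>)) B = (\<integral>w. mehler r (indicator A) w \<partial>Q)" if Q: "borel_prob Q" for Q
  proof -
    have "measure (law_sum Q (law_scale \<sigma> \<mu>)) B = (\<integral>w. indicator B w \<partial>law_sum Q (law_scale \<sigma> \<mu>))"
      by (intro measure_eq_integral_indicator borel_prob_law_sum Q borel_prob_law_scale borel_prob_mu B)
    also have "\<dots> = (\<integral>y. (\<integral>z. indicator B (y + z) \<partial>law_scale \<sigma> \<mu>) \<partial>Q)"
      by (rule integral_law_sum[OF Q borel_prob_law_scale[OF borel_prob_mu], where B=1]) (auto simp: indicator_def)
    finally show ?thesis unfolding inner .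
  qed
  have gm: "g \<in> borel_measurable \<mu>" using g(1) by auto
  have "(\<integral>w. mehler r (indicator A) w \<partial>lam) = (\<integral>w. g w * mehler r (indicator A) w \<partial>\<mu>)"
    unfolding l(1) using mm g(2) gm by (subst integral_density) (auto simp: borel_mu)
  moreover have "integrable \<mu> (\<lambda>w. g w * mehler r (indicator A) w)"
    using mm mb by (intro integrable_mult_bounded[OF g(1)]) (auto simp: borel_mu)
  moreover have "integrable \<mu> (mehler r (indicator A))"
    using mm mb by (intro integrable_const_bound[where B=1]) (auto simp: borel_mu)
  ultimately have "measure (law_sum lam (law_scale \<sigma> \<mu>)) B - measure (law_sum \<mu> (law_scale \<sigma> \<mu>)) B =
      (\<integral>w. (g w - 1) * mehler r (indicator A) w \<partial>\<mu>)"
    unfolding eq[OF l(2)] eq[OF borel_prob_mu] by (simp add: left_diff_distrib)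
  thus ?thesis using C[OF r A] by (simp add: r_def \<tau>_def)
qed

text \<open>
  Lindeberg's replacement argument. \<open>S k\<close> is the law of a sum of \<open>k\<close> variables of law \<open>lam\<close> and \<open>n - k\<close> of law \<open>\<mu>\<close>.
  Each of the \<open>n - 1\<close> summands that \<open>S k\<close> and \<open>S (Suc k)\<close> have in common contains a Gaussian
  part of variance \<open>1 - \<alpha>\<close>. Together these parts form \<open>law_scale \<sigma> \<mu>\<close>, and \<open>V\<close> is the law of the rest.
\<close>

lemma law_power_total_variation:
  assumes g: "integrable \<mu> g" "AE w in \<mu>. 0 \<le> g w" and l: "lam = density \<mu> (\<lambda>w. ennreal (g w))" "borel_prob lam"
    and C: "\<And>r A. 0 \<le> r \<Longrightarrow> r \<le> 1 \<Longrightarrow> A \<in> sets borel \<Longrightarrow> \<bar>\<integral>w. (g w - 1) * mehler r (indicator A) w \<partial>\<mu>\<bar> \<le> C * r ^ 3"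
    and \<alpha>: "0 < \<alpha>" "\<alpha> < 1" and \<nu>: "borel_prob \<nu>"
    and ch: "\<And>\<phi>. charf lam \<phi> = of_real (exp (- (1 - \<alpha>) * gvar \<phi> / 2)) * charf \<nu> (sqrt \<alpha> *\<^sub>R \<phi>)"
    and n: "n \<ge> 1" and B: "B \<in> sets borel"
  shows "\<bar>measure (law_power lam n) B - measure (law_power \<mu> n) B\<bar> \<le>
     real n * (C * (1 / sqrt (1 + (1 - \<alpha>) * real (n - 1))) ^ 3)"
proof -
  define \<epsilon> where "\<epsilon> = C * (1 / sqrt (1 + (1 - \<alpha>) * real (n - 1))) ^ 3"
  define \<sigma> where "\<sigma> = sqrt ((1 - \<alpha>) * real (n - 1))"
  have \<sigma>: "\<sigma> \<ge> 0" "\<sigma>\<^sup>2 = (1 - \<alpha>) * real (n - 1)" using \<alpha> by (auto simp: \<sigma>_def)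
  define S where "S k = law_sum (law_power lam k) (law_power \<mu> (n - k))" for k
  note bp = borel_prob_law_sum borel_prob_law_power borel_prob_law_scale borel_prob_mu l(2) \<nu>
  have step: "\<bar>measure (S (Suc k)) B - measure (S k) B\<bar> \<le> \<epsilon>" if k: "k < n" for k
  proof -
    define V where "V = law_sum (law_power (law_scale (sqrt \<alpha>) \<nu>) k) (law_power (law_scale (sqrt \<alpha>) \<mu>) (n - 1 - k))"
    have V: "borel_prob V" unfolding V_def by (intro bp)
    have cm: "charf \<mu> \<phi> = of_real (exp (- (1 - \<alpha>) * gvar \<phi> / 2)) * charf \<mu> (sqrt \<alpha> *\<^sub>R \<phi>)" for \<phi>
    proof -
      have "- gvar \<phi> / 2 = - (1 - \<alpha>) * gvar \<phi> / 2 + - gvar (sqrt \<alpha> *\<^sub>R \<phi>) / 2"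
        using \<alpha> by (simp add: gvar_scaleR field_simps)
      thus ?thesis unfolding charf_mu' by (simp only: exp_add of_real_mult)
    qed
    have cs: "charf (law_scale \<sigma> \<mu>) \<phi> = of_real (exp (- (1 - \<alpha>) * gvar \<phi> / 2)) ^ (n - 1)" for \<phi>
    proof -
      have "- gvar (\<sigma> *\<^sub>R \<phi>) / 2 = real (n - 1) * (- (1 - \<alpha>) * gvar \<phi> / 2)"
        unfolding gvar_scaleR \<sigma>(2) by (simp add: algebra_simps)
      thus ?thesis unfolding charf_law_scale[OF borel_prob_mu] charf_mu' by (simp only: exp_of_nat_mult of_real_power)
    qed
    have n1: "n - 1 = k + (n - 1 - k)" "n - k = Suc (n - 1 - k)" "n - Suc k = n - 1 - k" using k by auto
    have swap: "Z = law_sum V (law_sum Q (law_scale \<sigma> \<mu>))"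
      if Z: "borel_prob Z" and Q: "borel_prob Q" 
        and eq: "\<And>\<phi>. charf Z \<phi> = charf Q \<phi> * (charf lam \<phi> ^ k * charf \<mu> \<phi> ^ (n - 1 - k))" for Z Q
    proof (rule charf_eqI[OF Z])
      show "borel_prob (law_sum V (law_sum Q (law_scale \<sigma> \<mu>)))" by (intro bp V Q)
      fix \<phi>
      let ?e = "complex_of_real (exp (- (1 - \<alpha>) * gvar \<phi> / 2))"
      have "charf Z \<phi> = charf Q \<phi> * ((?e * charf \<nu> (sqrt \<alpha> *\<^sub>R \<phi>)) ^ k * (?e * charf \<mu> (sqrt \<alpha> *\<^sub>R \<phi>)) ^ (n - 1 - k))"
        using eq[of \<phi>] ch[of \<phi>] cm[of \<phi>] by (simp only:)
      also have "\<dots> = (charf \<nu> (sqrt \<alpha> *\<^sub>R \<phi>) ^ k * charf \<mu> (sqrt \<alpha> *\<^sub>R \<phi>) ^ (n - 1 - k)) * (charf Q \<phi> * (?e ^ k * ?e ^ (n - 1 - k)))"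
        by (simp only: power_mult_distrib mult_ac)
      also have "?e ^ k * ?e ^ (n - 1 - k) = charf (law_scale \<sigma> \<mu>) \<phi>"
        unfolding cs power_add[symmetric] n1(1)[symmetric] ..
      also have "(charf \<nu> (sqrt \<alpha> *\<^sub>R \<phi>) ^ k * charf \<mu> (sqrt \<alpha> *\<^sub>R \<phi>) ^ (n - 1 - k)) * (charf Q \<phi> * charf (law_scale \<sigma> \<mu>) \<phi>) =
         charf (law_sum V (law_sum Q (law_scale \<sigma> \<mu>))) \<phi>"
        unfolding V_def
        by (simp only: charf_law_sum charf_law_power charf_law_scale[OF \<nu>] charf_law_scale[OF borel_prob_mu, of "sqrt \<alpha>"] bp Q)
      finally show "charf Z \<phi> = charf (law_sum V (law_sum Q (law_scale \<sigma> \<mu>))) \<phi>" .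
    qed
    have Sb: "borel_prob (S i)" for i unfolding S_def by (intro bp)
    have SS: "S (Suc k) = law_sum V (law_sum lam (law_scale \<sigma> \<mu>))"
      by (rule swap[OF Sb l(2)]) (simp only: S_def n1(3) charf_law_sum charf_law_power bp power_Suc mult.assoc)
    have S: "S k = law_sum V (law_sum \<mu> (law_scale \<sigma> \<mu>))"
      by (rule swap[OF Sb borel_prob_mu]) (simp only: S_def n1(2) charf_law_sum charf_law_power bp power_Suc mult_ac)
    show ?thesis unfolding SS S
    proof (rule measure_law_sum_diff[OF V _ _ _ B])
      show "borel_prob (law_sum lam (law_scale \<sigma> \<mu>))" "borel_prob (law_sum \<mu> (law_scale \<sigma> \<mu>))"
        by (intro bp)+
      show "\<bar>measure (law_sum lam (law_scale \<sigma> \<mu>)) B - measure (law_sum \<mu> (law_scale \<sigma> \<mu>)) B\<bar> \<le> \<epsilon>"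
        if "B \<in> sets borel" for B
        using smoothed_law_diff[OF g l C \<sigma>(1) that] unfolding \<epsilon>_def \<sigma>(2) .
    qed
  qed
  have tel: "k \<le> n \<Longrightarrow> \<bar>measure (S k) B - measure (S 0) B\<bar> \<le> real k * \<epsilon>" for k
  proof (induction k)
    case (Suc k)
    have "\<bar>measure (S (Suc k)) B - measure (S 0) B\<bar> \<le> \<bar>measure (S (Suc k)) B - measure (S k) B\<bar> + \<bar>measure (S k) B - measure (S 0) B\<bar>"
      by linarith
    also have "\<dots> \<le> \<epsilon> + real k * \<epsilon>" using Suc by (intro add_mono step) auto
    finally show ?case by (simp add: algebra_simps)
  qed simp
  have "S n = law_power lam n"
  proof (rule charf_eqI)
    show "borel_prob (S n)" "borel_prob (law_power lam n)" unfolding S_def by (intro bp)+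
    show "charf (S n) \<phi> = charf (law_power lam n) \<phi>" for \<phi>
      unfolding S_def by (simp only: charf_law_sum charf_law_power bp diff_self_eq_0 power_0 mult_1_right)
  qed
  moreover have "S 0 = law_power \<mu> n"
  proof (rule charf_eqI)
    show "borel_prob (S 0)" "borel_prob (law_power \<mu> n)" unfolding S_def by (intro bp)+
    show "charf (S 0) \<phi> = charf (law_power \<mu> n) \<phi>" for \<phi>
      unfolding S_def by (simp only: charf_law_sum charf_law_power bp minus_nat.diff_0 power_0 mult_1_left)
  qed
  ultimately show ?thesis using tel[of n] by (simp add: \<epsilon>_def)
qed

end

section \<open>The density of the normalized sum\<close>

lemma charf_sum_indep:
  fixes X :: "nat \<Rightarrow> 'a \<Rightarrow> 'w::{real_normed_vector,second_countable_topology}"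
  assumes P: "prob_space P" and ind: "prob_space.indep_vars P (\<lambda>_. borel) X {1..}"
    and law: "\<And>i. 1 \<le> i \<Longrightarrow> distr P borel (X i) = lam" and l: "borel_prob lam"
  shows "distr P borel (\<lambda>\<omega>. \<Sum>i=1..n. X i \<omega>) = law_power lam n"
proof -
  interpret P: prob_space P by fact
  have Xm: "X i \<in> borel_measurable P" if "1 \<le> i" for i
    using ind that unfolding P.indep_vars_def by auto
  have Sm: "(\<lambda>\<omega>. \<Sum>i=1..n. X i \<omega>) \<in> borel_measurable P"
    by (intro borel_measurable_sum Xm) simp
  show ?thesis
  proof (rule charf_eqI)
    show "borel_prob (distr P borel (\<lambda>\<omega>. \<Sum>i=1..n. X i \<omega>))"
      using P.prob_space_distr[OF Sm] by (simp add: borel_prob_def)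
    show "borel_prob (law_power lam n)" by (rule borel_prob_law_power[OF l])
    fix \<phi> :: "'w \<Rightarrow>\<^sub>L real"
    have "P.indep_vars (\<lambda>_. borel) (\<lambda>i \<omega>. iexp (blinfun_apply \<phi> (X i \<omega>))) {1..n}"
    proof (rule P.indep_vars_compose2[where M'="\<lambda>_. borel" and X=X])
      show "P.indep_vars (\<lambda>_. borel) X {1..n}" by (rule P.indep_vars_subset[OF ind]) auto
    qed (rule iexp_blinfun_measurable)
    moreover have "integrable P (\<lambda>\<omega>. iexp (blinfun_apply \<phi> (X i \<omega>)))" if "i \<in> {1..n}" for i
      using Xm[of i] that by (intro P.integrable_const_bound[where B=1]) auto
    ultimately have "(\<integral>\<omega>. (\<Prod>i=1..n. iexp (blinfun_apply \<phi> (X i \<omega>))) \<partial>P) = (\<Prod>i=1..n. \<integral>\<omega>. iexp (blinfun_apply \<phi> (X i \<omega>)) \<partial>P)"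
      by (intro P.indep_vars_lebesgue_integral) auto
    moreover have "(\<integral>\<omega>. iexp (blinfun_apply \<phi> (X i \<omega>)) \<partial>P) = charf lam \<phi>" if "i \<in> {1..n}" for i
    proof -
      have "charf (distr P borel (X i)) \<phi> = (\<integral>\<omega>. iexp (blinfun_apply \<phi> (X i \<omega>)) \<partial>P)"
        unfolding charf_def using Xm[of i] that by (subst integral_distr) auto
      thus ?thesis using law[of i] that by simp
    qed
    moreover have "charf (distr P borel (\<lambda>\<omega>. \<Sum>i=1..n. X i \<omega>)) \<phi> = (\<integral>\<omega>. (\<Prod>i=1..n. iexp (blinfun_apply \<phi> (X i \<omega>))) \<partial>P)"
      unfolding charf_def using Sm
      by (subst integral_distr) (auto simp: blinfun.sum_right sum_distrib_left exp_sum)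
    ultimately show "charf (distr P borel (\<lambda>\<omega>. \<Sum>i=1..n. X i \<omega>)) \<phi> = charf (law_power lam n) \<phi>"
      by (simp add: charf_law_power[OF l])
  qed
qed

text \<open>
  As \<open>\<rho> - 1\<close> has integral zero, its \<open>L\<^sup>1\<close> norm is twice its integral over the set where \<open>\<rho> \<ge> 1\<close>.
\<close>

lemma density_total_variation:
  fixes \<mu> L :: "'w measure"
  assumes "prob_space \<mu>" "prob_space L" and sets: "sets L = sets \<mu>" and ac: "absolutely_continuous \<mu> L"
  defines "\<rho> \<equiv> \<lambda>w. enn2real (RN_deriv \<mu> L w)"
  shows "integrable \<mu> \<rho>" "\<And>w. 0 \<le> \<rho> w"
    "\<exists>A\<in>sets \<mu>. (\<integral>w. \<bar>\<rho> w - 1\<bar> \<partial>\<mu>) = 2 * (measure L A - measure \<mu> A)"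
proof -
  interpret M: prob_space \<mu> by fact
  interpret L: prob_space L by fact
  show r0: "0 \<le> \<rho> w" for w by (simp add: \<rho>_def)
  have rm [measurable]: "\<rho> \<in> borel_measurable \<mu>" unfolding \<rho>_def by measurable
  have fin: "AE w in \<mu>. RN_deriv \<mu> L w \<noteq> \<infinity>"
    by (rule M.RN_deriv_finite[OF L.sigma_finite_measure_axioms ac sets])
  have dens: "density \<mu> (\<lambda>w. ennreal (\<rho> w)) = L"
  proof -
    have "density \<mu> (\<lambda>w. ennreal (\<rho> w)) = density \<mu> (RN_deriv \<mu> L)"
      using fin by (intro density_cong) (auto simp: \<rho>_def less_top elim!: eventually_mono)
    thus ?thesis using M.density_RN_deriv[OF ac sets] by simp
  qed
  have emA: "(\<integral>\<^sup>+ w. ennreal (\<rho> w * indicator A w) \<partial>\<mu>) = emeasure L A" if "A \<in> sets \<mu>" for A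
    unfolding dens[symmetric] using that
    by (simp add: emeasure_density) (intro nn_integral_cong, simp add: indicator_def)
  have i: "integrable \<mu> (\<lambda>w. \<rho> w * indicator A w)" if A [measurable]: "A \<in> sets \<mu>" for A
    using r0 by (intro integrableI_nonneg) (auto simp: emA[OF A] L.emeasure_eq_measure)
  have mA: "(\<integral>w. \<rho> w * indicator A w \<partial>\<mu>) = measure L A" if "A \<in> sets \<mu>" for A
    using i[OF that] r0 that by (subst integral_eq_nn_integral) (auto simp: emA measure_def)
  show ri: "integrable \<mu> \<rho>"
    using i[of "space \<mu>"] by (rule Bochner_Integration.integrable_cong[THEN iffD1, rotated -1]) auto
  have tot: "(\<integral>w. \<rho> w \<partial>\<mu>) = 1"
  proof -
    have "(\<integral>w. \<rho> w \<partial>\<mu>) = (\<integral>w. \<rho> w * indicator (space \<mu>) w \<partial>\<mu>)"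
      by (intro Bochner_Integration.integral_cong) auto
    also have "\<dots> = 1" using mA[of "space \<mu>"] L.prob_space sets_eq_imp_space_eq[OF sets] by simp
    finally show ?thesis .
  qed
  define A where "A = {w \<in> space \<mu>. 1 \<le> \<rho> w}"
  have A: "A \<in> sets \<mu>" unfolding A_def by measurable
  have iA: "integrable \<mu> (\<lambda>w. indicator A w :: real)"
    by (rule M.integrable_const_bound[where B=1]) (use A in auto)
  have "(\<integral>w. \<bar>\<rho> w - 1\<bar> \<partial>\<mu>) = (\<integral>w. 2 * (\<rho> w * indicator A w - indicator A w) - (\<rho> w - 1) \<partial>\<mu>)"
    by (intro Bochner_Integration.integral_cong refl) (auto simp: A_def indicator_def)
  also have "\<dots> = 2 * (measure L A - measure \<mu> A)"
    using i[OF A] iA ri tot mA[OF A] A M.prob_space by simp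
  finally show "\<exists>A\<in>sets \<mu>. (\<integral>w. \<bar>\<rho> w - 1\<bar> \<partial>\<mu>) = 2 * (measure L A - measure \<mu> A)" using A by blast
qed

context abstract_wiener_space
begin

lemma integral_density_iexp:
  assumes G: "integrable \<mu> G"
  shows "(\<integral>w. G w *\<^sub>R iexp (blinfun_apply \<phi> w) \<partial>\<mu>) =
    Complex (\<integral>w. G w * cos (blinfun_apply \<phi> w + 0) \<partial>\<mu>) (\<integral>w. G w * cos (blinfun_apply \<phi> w + - (pi / 2)) \<partial>\<mu>)"
proof -
  have i: "integrable \<mu> (\<lambda>w. G w *\<^sub>R iexp (blinfun_apply \<phi> w))"
    by (rule Bochner_Integration.integrable_bound[OF G]) (use G in auto)
  have s: "cos (x + - (pi / 2)) = sin x" for x :: real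
    by (simp add: cos_add del: add_uminus_conv_diff)
  show ?thesis unfolding s
    using integral_Re[OF i] integral_Im[OF i] by (intro complex_eqI) (simp_all add: Re_exp Im_exp)
qed

text \<open>
  Order 0 consists of the constants, so there the normalization of \<open>g\<close> is what counts.
\<close>

lemma density_minus_one_orthogonal:
  assumes p: "p > 1" and g: "g \<in> Lp \<mu> p" "(\<integral>w. g w \<partial>\<mu>) = 1"
    and J: "Lp_chaos_projection \<iota> \<mu> p 1 g (\<lambda>_. 0)" "Lp_chaos_projection \<iota> \<mu> p 2 g (\<lambda>_. 0)"
    and n: "n < 3" and S: "S \<in> simple_chaos \<iota> n"
  shows "(\<integral>w. (g w - 1) * S w \<partial>\<mu>) = 0"
proof -
  obtain m0 :: nat where m0: "p / (p - 1) \<le> real m0" using real_arch_simple by blast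
  hence m: "p / (p - 1) \<le> real (2 * m0)" by simp
  have Sm: "all_moments \<mu> S" by (rule all_moments_simple_chaos[OF S])
  have gS: "integrable \<mu> (\<lambda>w. g w * S w)"
    by (rule Lp_mult_integrable(1)[OF finite_measure_axioms p m g(1) all_momentsD(1)[OF Sm] all_momentsD(3)[OF Sm]])
  have eq: "(\<integral>w. (g w - 1) * S w \<partial>\<mu>) = (\<integral>w. g w * S w \<partial>\<mu>) - (\<integral>w. S w \<partial>\<mu>)"
    using gS all_momentsD(4)[OF Sm] by (simp add: left_diff_distrib)
  show ?thesis
  proof (cases "n = 0")
    case True
    have "\<exists>c. S = (\<lambda>_. c)" using S unfolding True
    proof (induction rule: simple_chaos_induct)
      case (add S a \<phi>)
      then obtain c where "S = (\<lambda>_. c)" by blast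
      thus ?case by (intro exI[of _ "c + a"]) (simp add: wiener_hermite_def)
    qed blast
    then obtain c where "S = (\<lambda>_. c)" by blast
    thus ?thesis unfolding eq using g(2) prob_space by simp
  next
    case False
    have "(\<integral>w. S w * (1 * wiener_hermite 0 0 w) \<partial>\<mu>) = 0"
      by (rule simple_chaos_orthogonal[OF S simple_chaos_hermite False])
    moreover have "(\<integral>w. g w * S w \<partial>\<mu>) = 0"
    proof -
      have "n = 1 \<or> n = 2" using n False by auto
      thus ?thesis using Lp_chaos_projection_zero[OF p J(1)] Lp_chaos_projection_zero[OF p J(2)] S by blast
    qed
    ultimately show ?thesis unfolding eq by (simp add: wiener_hermite_def)
  qed
qed

end

lemma rate_bound:
  fixes c :: real
  assumes c: "0 < c" "c < 1" and n: "n \<ge> 1"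
  shows "real n * (1 / sqrt (1 + c * real (n - 1))) ^ 3 \<le> 1 / sqrt c ^ 3 * (1 / sqrt (real n))"
proof -
  have "c * real n \<le> 1 + c * real (n - 1)" using c n by (simp add: of_nat_diff algebra_simps)
  hence "sqrt (c * real n) \<le> sqrt (1 + c * real (n - 1))" by simp
  hence "(1 / sqrt (1 + c * real (n - 1))) ^ 3 \<le> (1 / sqrt (c * real n)) ^ 3"
    using c n by (intro power_mono frac_le) auto
  hence "real n * (1 / sqrt (1 + c * real (n - 1))) ^ 3 \<le> real n * (1 / sqrt (c * real n)) ^ 3"
    by (intro mult_left_mono) auto
  also have "\<dots> = 1 / sqrt c ^ 3 * (real n / sqrt (real n) ^ 3)"
    by (simp add: real_sqrt_mult power_divide power_mult_distrib)
  also have "real n / sqrt (real n) ^ 3 = 1 / sqrt (real n)"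
  proof -
    have "sqrt (real n) ^ 3 = real n * sqrt (real n)" by (simp add: power3_eq_cube)
    thus ?thesis using n by simp
  qed
  finally show ?thesis .
qed

theorem theorem3p3:
  fixes \<iota> :: "'h::{real_inner,banach,second_countable_topology} \<Rightarrow>
              'w::{banach,second_countable_topology}"
    and \<mu> :: "'w measure"
    and P :: "'a measure"
    and X :: "nat \<Rightarrow> 'a \<Rightarrow> 'w"
    and f g :: "'w \<Rightarrow> real"
    and \<alpha> p :: real
  assumes "abstract_wiener_space \<iota> \<mu>"
    and "prob_space P"
    and "prob_space.indep_vars P (\<lambda>_. borel) X {1..}"
    and "0 < \<alpha>" and "\<alpha> < 1"
    and "1 < p" and "f \<in> Lp \<mu> p" and "AE w in \<mu>. 0 \<le> f w"
    and "Lp_second_quantization \<iota> \<mu> p (sqrt \<alpha>) f g"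
    and "\<And>n. 1 \<le> n \<Longrightarrow> distributed P \<mu> (X n) (\<lambda>w. ennreal (g w))"
    and "Lp_chaos_projection \<iota> \<mu> p 1 g (\<lambda>_. 0)"
    and "Lp_chaos_projection \<iota> \<mu> p 2 g (\<lambda>_. 0)"
  shows "(\<forall>n\<ge>1. absolutely_continuous \<mu> (normalized_sum_law P X n) \<and>
                normalized_sum_density \<mu> P X n \<in> Lp \<mu> 1) \<and>
         (\<lambda>n. Lp_norm \<mu> 1 (\<lambda>w. normalized_sum_density \<mu> P X n w - 1)) \<longlonglongrightarrow> 0 \<and>
         (\<lambda>n. Lp_norm \<mu> 1 (\<lambda>w. normalized_sum_density \<mu> P X n w - 1)) \<in> O(\<lambda>n. 1 / sqrt (real n))"
proof -
  interpret abstract_wiener_space \<iota> \<mu> by fact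
  interpret P: prob_space P by fact
  note p = \<open>1 < p\<close>
  have \<alpha>: "0 \<le> \<alpha>" "\<alpha> \<le> 1" using \<open>0 < \<alpha>\<close> \<open>\<alpha> < 1\<close> by auto
  have fi: "integrable \<mu> f" and gi: "integrable \<mu> g"
    using second_quantization_indicator(1,2)[OF p \<alpha> assms(7,9), of "{}"] by simp_all
  have g0: "AE w in \<mu>. 0 \<le> g w" by (rule second_quantization_nonneg[OF p \<alpha> assms(7,8,9)])
  have gp: "g \<in> Lp \<mu> p"
    using assms(9) by (auto simp: Lp_second_quantization_def Lp_extension_def Lp_converges_def)
  have fm [measurable]: "f \<in> borel_measurable \<mu>" and gm [measurable]: "g \<in> borel_measurable \<mu>" using fi gi by auto
  define lam where "lam = density \<mu> (\<lambda>w. ennreal (g w))"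
  have law: "distr P borel (X i) = lam" if "1 \<le> i" for i
    using assms(10)[OF that] distr_cong[OF refl sets_mu refl, of P "X i"]
    by (simp add: distributed_def lam_def sets_mu)
  have Xm: "X 1 \<in> borel_measurable P" using assms(3) unfolding P.indep_vars_def by auto
  have l: "borel_prob lam"
    using P.prob_space_distr[OF Xm] law[of 1] by (simp add: borel_prob_def lam_def sets_mu)
  interpret L: prob_space lam using l by (rule borel_probD)
  define \<nu> where "\<nu> = density \<mu> (\<lambda>w. ennreal (f w))"
  have charf_density: "charf (density \<mu> (\<lambda>w. ennreal (G w))) \<phi> = (\<integral>w. G w *\<^sub>R iexp (blinfun_apply \<phi> w) \<partial>\<mu>)"
    if "G \<in> borel_measurable \<mu>" "AE w in \<mu>. 0 \<le> G w" for G \<phi>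
    unfolding charf_def using that by (intro integral_density) (auto simp: borel_mu)
  note sq_cos = Lp_second_quantization_cos[OF p assms(9)]
  have g1: "(\<integral>w. g w \<partial>\<mu>) = 1"
  proof -
    have "ennreal (\<integral>w. g w \<partial>\<mu>) = (\<integral>\<^sup>+ w. ennreal (g w) \<partial>\<mu>)" by (rule nn_integral_eq_integral[OF gi g0, symmetric])
    also have "\<dots> = emeasure lam (space lam)" by (simp add: lam_def emeasure_density)
    also have "\<dots> = 1" by (rule L.emeasure_space_1)
    finally show ?thesis by (simp add: ennreal_eq_1)
  qed
  have f1: "(\<integral>w. f w \<partial>\<mu>) = 1" using sq_cos[of 0 0] g1 by (simp add: gvar_def rep_linear)
  have \<nu>: "borel_prob \<nu>"
  proof -
    have "emeasure \<nu> (space \<nu>) = (\<integral>\<^sup>+ w. ennreal (f w) \<partial>\<mu>)" by (simp add: \<nu>_def emeasure_density)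
    also have "\<dots> = ennreal (\<integral>w. f w \<partial>\<mu>)" by (rule nn_integral_eq_integral[OF fi assms(8)])
    finally have "prob_space \<nu>" unfolding f1 by (intro prob_spaceI) simp
    thus ?thesis by (simp add: borel_prob_def \<nu>_def sets_mu)
  qed
  have charf_lam: "charf lam \<phi> = of_real (exp (- (1 - \<alpha>) * gvar \<phi> / 2)) * charf \<nu> (sqrt \<alpha> *\<^sub>R \<phi>)" for \<phi>
  proof -
    have "charf lam \<phi> = Complex (\<integral>w. g w * cos (blinfun_apply \<phi> w + 0) \<partial>\<mu>) (\<integral>w. g w * cos (blinfun_apply \<phi> w + - (pi / 2)) \<partial>\<mu>)"
      unfolding lam_def charf_density[OF gm g0] by (rule integral_density_iexp[OF gi])
    moreover have "charf \<nu> (sqrt \<alpha> *\<^sub>R \<phi>) = Complex (\<integral>w. f w * cos (sqrt \<alpha> * blinfun_apply \<phi> w + 0) \<partial>\<mu>) (\<integral>w. f w * cos (sqrt \<alpha> * blinfun_apply \<phi> w + - (pi / 2)) \<partial>\<mu>)"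
      unfolding \<nu>_def charf_density[OF fm assms(8)] integral_density_iexp[OF fi] by (simp add: blinfun.scaleR_left)
    ultimately show ?thesis unfolding sq_cos using \<alpha> by (simp add: complex_eq_iff)
  qed
  have G: "(\<lambda>w. g w - 1) \<in> Lp \<mu> p"
    using p by (intro Lp_diff gp) (auto simp: Lp_def)
  have "\<exists>C\<ge>0. \<forall>r A. 0 \<le> r \<longrightarrow> r \<le> 1 \<longrightarrow> A \<in> sets borel \<longrightarrow>
      \<bar>\<integral>w. (g w - 1) * mehler r (indicator A) w \<partial>\<mu>\<bar> \<le> C * r ^ 3"
    by (rule smoothing_bound[OF p G]) (rule density_minus_one_orthogonal[OF p gp g1 assms(11,12)])
  then obtain C where "C \<ge> 0 \<and> (\<forall>r A. 0 \<le> r \<longrightarrow> r \<le> 1 \<longrightarrow> A \<in> sets borel \<longrightarrow>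
      \<bar>\<integral>w. (g w - 1) * mehler r (indicator A) w \<partial>\<mu>\<bar> \<le> C * r ^ 3)" ..
  hence C: "C \<ge> 0" "\<And>r A. 0 \<le> r \<Longrightarrow> r \<le> 1 \<Longrightarrow> A \<in> sets borel \<Longrightarrow>
      \<bar>\<integral>w. (g w - 1) * mehler r (indicator A) w \<partial>\<mu>\<bar> \<le> C * r ^ 3" by simp_all
  define D where "D = 2 * C * (1 / sqrt (1 - \<alpha>) ^ 3)"
  have main: "absolutely_continuous \<mu> (normalized_sum_law P X n) \<and> normalized_sum_density \<mu> P X n \<in> Lp \<mu> 1 \<and>
      Lp_norm \<mu> 1 (\<lambda>w. normalized_sum_density \<mu> P X n w - 1) \<le> D * (1 / sqrt (real n))" if n: "n \<ge> 1" for n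
  proof -
    have Sm: "(\<lambda>\<omega>. \<Sum>i=1..n. X i \<omega>) \<in> borel_measurable P"
      using assms(3) unfolding P.indep_vars_def by (intro borel_measurable_sum) auto
    define L where "L = normalized_sum_law P X n"
    have L: "L = law_scale (1 / sqrt (real n)) (law_power lam n)"
    proof -
      have S: "distr P borel (\<lambda>\<omega>. \<Sum>i=1..n. X i \<omega>) = law_power lam n"
        by (rule charf_sum_indep[OF assms(2,3) law l])
      have "law_scale (1 / sqrt (real n)) (law_power lam n) =
          distr P borel ((\<lambda>w. (1 / sqrt (real n)) *\<^sub>R w) \<circ> (\<lambda>\<omega>. \<Sum>i=1..n. X i \<omega>))"
        unfolding law_scale_def S[symmetric] using Sm by (intro distr_distr) auto
      thus ?thesis by (simp add: L_def normalized_sum_law_def o_def)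
    qed
    have Lb: "borel_prob L" unfolding L by (intro borel_prob_law_scale borel_prob_law_power l)
    have "absolutely_continuous \<mu> lam"
      unfolding lam_def by (intro absolutely_continuousI_density) auto
    hence ac: "absolutely_continuous \<mu> L"
      unfolding L by (subst law_power_mu[OF n, symmetric])
        (intro absolutely_continuous_law_scale absolutely_continuous_law_power borel_prob_law_power borel_prob_mu l)
    have \<rho>: "normalized_sum_density \<mu> P X n = (\<lambda>w. enn2real (RN_deriv \<mu> L w))"
      by (simp add: fun_eq_iff normalized_sum_density_def L_def)
    have sL: "sets L = sets \<mu>" using borel_probD(2)[OF Lb] sets_mu by simp
    note dtv = density_total_variation[OF prob_space_axioms borel_probD(1)[OF Lb] sL ac, folded \<rho>]
    obtain A where A: "A \<in> sets borel"
      "(\<integral>w. \<bar>normalized_sum_density \<mu> P X n w - 1\<bar> \<partial>\<mu>) = 2 * (measure L A - measure \<mu> A)"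
      using dtv(3) sets_mu by (auto simp: \<rho>)
    define B where "B = (\<lambda>w. (1 / sqrt (real n)) *\<^sub>R w) -` A"
    have B: "B \<in> sets borel"
      unfolding B_def using measurable_sets_borel[of "\<lambda>w. (1 / sqrt (real n)) *\<^sub>R w" borel A] A(1) by simp
    have ms: "measure (law_scale (1 / sqrt (real n)) M) A = measure M B" if M: "borel_prob M" for M
    proof -
      note [measurable_cong] = borel_probD(2)[OF M]
      show ?thesis unfolding law_scale_def B_def using A(1) borel_probD(3)[OF M] by (subst measure_distr) auto
    qed
    have "measure \<mu> A = measure (law_power \<mu> n) B"
      using ms[OF borel_prob_law_power[OF borel_prob_mu], of n] unfolding law_power_mu[OF n] .
    hence "measure L A - measure \<mu> A = measure (law_power lam n) B - measure (law_power \<mu> n) B"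
      unfolding L using ms[OF borel_prob_law_power[OF l]] by simp
    also have "\<dots> \<le> real n * (C * (1 / sqrt (1 + (1 - \<alpha>) * real (n - 1))) ^ 3)"
      using law_power_total_variation[OF gi g0 lam_def l C(2) assms(4,5) \<nu> charf_lam n B] by linarith
    also have "\<dots> = C * (real n * (1 / sqrt (1 + (1 - \<alpha>) * real (n - 1))) ^ 3)" by simp
    also have "\<dots> \<le> C * (1 / sqrt (1 - \<alpha>) ^ 3 * (1 / sqrt (real n)))"
      using assms(4,5) by (intro mult_left_mono rate_bound n C(1)) auto
    finally have "(\<integral>w. \<bar>normalized_sum_density \<mu> P X n w - 1\<bar> \<partial>\<mu>) \<le> D * (1 / sqrt (real n))"
      unfolding A(2) D_def by simp
    moreover have "Lp_norm \<mu> 1 h = (\<integral>w. \<bar>h w\<bar> \<partial>\<mu>)" for h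
      by (simp add: Lp_norm_def integral_nonneg_AE)
    moreover have "normalized_sum_density \<mu> P X n \<in> Lp \<mu> 1"
      using dtv(1) by (auto simp: Lp_def)
    ultimately show ?thesis using ac by (simp add: L_def)
  qed
  have norm0: "0 \<le> Lp_norm \<mu> 1 h" for h by (simp add: Lp_norm_def)
  have ev: "eventually (\<lambda>n. norm (Lp_norm \<mu> 1 (\<lambda>w. normalized_sum_density \<mu> P X n w - 1)) \<le> D * (1 / sqrt (real n))) sequentially"
    using eventually_ge_at_top[of "1::nat"] by eventually_elim (use main norm0 in simp)
  have "(\<lambda>n. Lp_norm \<mu> 1 (\<lambda>w. normalized_sum_density \<mu> P X n w - 1)) \<longlonglongrightarrow> 0"
    by (rule Lim_null_comparison[OF ev]) real_asymp
  moreover have "(\<lambda>n. Lp_norm \<mu> 1 (\<lambda>w. normalized_sum_density \<mu> P X n w - 1)) \<in> O(\<lambda>n. 1 / sqrt (real n))"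
    by (rule bigoI[where c=D]) (use ev in simp)
  ultimately show ?thesis using main by blast
qed

end
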